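(* (Sample complexity.) Assume (A1), (A2), (A4), (A5) of the context, and let $F$ be strongly convex with parameter $\mu>0$ in the sense of the context. Let $\theta>0$, $\epsilon>0$, $p\in(0,1]$, $x_0\in\mathbb{R}^d$, and fix one of the gradient estimation methods FD, GS, SS, RC, RS. Let $\{x_k : k\in\mathbb{Z}_{++}\}$ be generated by $x_{k+1}=x_k-\alpha_k g_{S_k,T_k}(x_k)$, with $|T_k|=N$ for all $k\in\mathbb{Z}_+$ ($N=d$ for FD, $N\le d$ for RC and RS), $\alpha_k=\bar\alpha$ for all $k\in\mathbb{Z}_+$ and $\nu=\hat\nu$, with $\bar\alpha$, $\hat\nu$ as given in the context for the chosen method. Let $\mathcal{K}(\epsilon)$, $\mathcal{W}(\epsilon)$, $b_1$, $b_2$ be as in the context. (a) If $|S_k|$ is chosen according to Condition 2, then the expected total sample complexity is $$\mathbb{E}[\mathcal{W}(\epsilon)]=\mathcal{O}\!\left(Nb_1\mathcal{K}(\epsilon)+\frac{Nb_2\mathcal{K}(\epsilon)}{\epsilon\mu}\right).$$ (b) If $|S_k|$ is chosen according to Condition 3, then the total sample complexity is $$\mathcal{W}(\epsilon)=\mathcal{O}\!\left(Nb_1\mathcal{K}(\epsilon)+\frac{Nb_2\mathcal{K}(\epsilon)}{\epsilon\mu}\right).$$ The resulting sample complexities of the methods, indicating only the dependencies on $\epsilon,p,d,N,L_{\nabla f},L_{\nabla F},\mu$, are as follows. With $\Omega_7=\log(1/(\epsilon p))\frac{L_{\nabla F}d}{\mu}$ and $\Omega_8=\frac{\log(1/(\epsilon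 p))}{\epsilon}\frac{L_{\nabla F}d}{\mu^2}$, the quantity $\mathbb{E}[\mathcal{W}(\epsilon)]$ in case (a), respectively $\mathcal{W}(\epsilon)$ in case (b), is - $\mathcal{O}(\Omega_7+\Omega_8)$ for FD, RC and RS; - $\mathcal{O}\!\left(\frac{(\max\{N,d\})^2d}{\max\{N,d^2\}}\,\Omega_7+\max\{N,d\}\,\Omega_8\right)$ for GS and SS.
   Context: **Problem and notation.** $\mathbb{Z}_+=\{0,1,2,\dots\}$, $\mathbb{Z}_{++}=\{1,2,\dots\}$, $\|\cdot\|$ is the Euclidean norm. $\zeta$ is a random variable with associated probability space $(\Xi,\mathcal{F},P)$, $f:\mathbb{R}^d\times\Xi\to\mathbb{R}$, and $F(x)=\mathbb{E}_\zeta[f(x,\zeta)]$ is continuously differentiable on $\mathbb{R}^d$; $x^*$ denotes a minimizer of $F$. $\mathbb{E}[\cdot]$ is total expectation. **Gradient estimator.** At iteration $k$, given a sample set $S_k=\{\zeta_1,\dots,\zeta_{|S_k|}\}$, put $F_{S_k}(x)=\frac{1}{|S_k|}\sum_{\zeta_i\in S_k}f(x,\zeta_i)$. Given a finite collection $T_k$ of direction vectors, a sampling radius $\nu>0$ and a scaling $\gamma_k>0$, put $$g_{S_k,T_k}(x_k)=\gamma_k\sum_{u_j\in T_k}\frac{F_{S_k}(x_k+\nu u_j)-F_{S_k}(x_k)}{\nu}\,u_j ,$$ and let $g_{\zeta_i,T_k}(x_k)$ be the same expression with $F_{S_k}$ replaced by $f(\cdot,\zeta_i)$. **Methods.** FD: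 $\gamma_k=1$, $T_k=\{e_1,\dots,e_d\}$ (canonical basis, deterministic, $|T_k|=d$). GS: $\gamma_k=1/|T_k|$, $u_j$ i.i.d. $\mathcal{N}(0,I)$. SS: $\gamma_k=d/|T_k|$, $u_j$ i.i.d. uniform on the unit sphere of $\mathbb{R}^d$. RC: $\gamma_k=d/|T_k|$, $T_k$ sampled uniformly without replacement from $\{e_1,\dots,e_d\}$, $|T_k|\le d$. RS: $\gamma_k=d/|T_k|$, $T_k$ sampled uniformly without replacement from a random orthonormal basis $\tilde T_k$ of $\mathbb{R}^d$, $|T_k|\le d$. **Conditional expectations.** $\mathcal{F}_k$ is the $\sigma$-algebra generated by $x_0$ and all direction and sample sets used before iteration $k$; $\mathcal{F}_{k+1/2}$ is generated by $\mathcal{F}_k$ and $T_k$. $\mathbb{E}_k[\cdot]=\mathbb{E}_{T_k}[\cdot]=\mathbb{E}[\cdot\mid\mathcal{F}_k]$, $\mathbb{E}_{S_k}[\cdot]=\mathbb{E}[\cdot\mid\mathcal{F}_{k+1/2}]$. $\mathbb{E}_{\zeta_i}$ is expectation over a single sample $\zeta_i$ of $\zeta$, with $x_k,T_k$ held fixed. $g_{T_k}(x_k)=\mathbb{E}_{S_k}[g_{S_k,T_k}(x_k)]$ and $g(x_k)=\mathbb{E}_{T_k}[g_{T_k}(x_k)]$. **Assumptions.** (A1) At every iteration, $S_k$ consists of i.i.d. samples of $\zeta$, so $\mathbb{E}_{\zeta_i}[f(x,\zeta_i)]=F(x)$ for all $x$ and $\zeta_i\in S_k$. (A2) At every iteration,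 the vectors in $T_k$ are chosen independently of the sample set $S_k$ consisting of i.i.d. samples of $\zeta$. (A4) For every $\zeta$, $f(\cdot,\zeta)$ is continuously differentiable with $\|\nabla f(x,\zeta)-\nabla f(y,\zeta)\|\le L_{\nabla f}\|x-y\|$ for all $x,y$, $L_{\nabla f}<\infty$. This implies $\|\nabla F(x)-\nabla F(y)\|\le L_{\nabla F}\|x-y\|$ for all $x,y$ with some constant $L_{\nabla F}\le L_{\nabla f}$; $L_{\nabla F}$ denotes such a constant. (A5) There are $\beta_1,\beta_2\ge0$ with $\mathbb{E}_{\zeta_i}[\|\nabla f(x,\zeta_i)-\nabla F(x)\|^2]\le\beta_1\|\nabla F(x)\|^2+\beta_2$ for all $x\in\mathbb{R}^d$. **Sample size conditions** (with $\theta>0$). Write $V_k=\mathbb{E}_{\zeta_i}[\|g_{\zeta_i,T_k}(x_k)-g_{T_k}(x_k)\|^2]$. Condition 2: $V_k/|S_k|\le\theta^2\,\mathbb{E}_{T_k}[\|g_{T_k}(x_k)\|^2]$. Condition 3: $\mathbb{E}_{T_k}[V_k]/|S_k|\le\theta^2\,\mathbb{E}_{T_k}[\|g_{T_k}(x_k)\|^2]$. **Strong convexity.** $F$ is called strongly convex with parameter $\mu>0$ if $\|\nabla F(x)\|^2\ge2\mu(F(x)-F(x^* ))$ for all $x\in\mathbb{R}^d$, where $x^*$ is the optimal solution. **Parameters.** With $\Omega_1=\frac{1}{4(1+\theta^2)L_{\nabla F}}$, $\Omega_3=\frac{\mu}{8(1+\theta^2)L_{\nabla F}}$, $\Omega_5=\sqrt{\frac{4\epsilon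 p\mu}{3L_{\nabla F}^2d}}$: FD: $\bar\alpha=\Omega_1$, $\rho=\Omega_3$, $\hat\nu=\Omega_5$. GS: $\bar\alpha=\frac{N}{N+4.5d}\Omega_1$, $\rho=\frac{N}{N+4.5d}\Omega_3$, $\hat\nu=\sqrt{\frac{2(N+4.5d)}{8N+24d+(d+2)(d+4)}}\,\Omega_5$. SS: $\bar\alpha=\frac{N}{N+4.5d}\Omega_1$, $\rho=\frac{N}{N+4.5d}\Omega_3$, $\hat\nu=\sqrt{\frac{2(N+4.5d)d}{8N+24d+d^2}}\,\Omega_5$. RC and RS: $\bar\alpha=\frac{N}{d}\Omega_1$, $\rho=\frac{N}{d}\Omega_3$, $\hat\nu=\Omega_5$. **Complexities.** An iterate $x_k$ is an $\epsilon$-accurate solution if $F(x_k)-F(x^* )\le\epsilon$ with probability at least $1-p$. The iteration bound, treated as a positive integer, is $$\mathcal{K}(\epsilon)=\frac{\log(F(x_0)-F(x^* ))-\log(\epsilon p/2)}{\log((1-\rho)^{-1})}=\mathcal{O}\!\left(\frac{\log(\epsilon^{-1}p^{-1})}{\rho}\right);$$ for every $k\ge\mathcal{K}(\epsilon)$, $x_k$ is an $\epsilon$-accurate solution. With $\Omega_6=\log(1/(\epsilon p))\frac{L_{\nabla F}}{\mu}$, $\mathcal{K}(\epsilon)$ is $\mathcal{O}(\Omega_6)$ for FD, $\mathcal{O}\big(\frac{\max\{N,d\}}{N}\Omega_6\big)$ for GS and SS, and $\mathcal{O}\big(\frac{d}{N}\Omega_6\big)$ for RC and RS. The number of stochastic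 function evaluations at iteration $k$ is $\mathcal{W}_k=(N+1)|S_k|$, and the total number of stochastic function evaluations until $\mathcal{K}(\epsilon)$ is $$\mathcal{W}(\epsilon)=\sum_{i=0}^{\mathcal{K}(\epsilon)-1}\mathcal{W}_i=(N+1)\sum_{i=0}^{\mathcal{K}(\epsilon)-1}|S_i| .$$ **Quantities $b_1,b_2$.** These are the constants, depending on the gradient estimation method, in the following bounds on the sample size, valid for $\epsilon'>0$ and all iterations $k\in\mathbb{Z}_+$ with $\|g(x_k)\|^2>\epsilon'$: $\mathbb{E}_{T_k}[|S_k|]\le b_1+b_2/\epsilon'$ if $|S_k|$ is chosen using Condition 2, and $|S_k|\le b_1+b_2/\epsilon'$ if $|S_k|$ is chosen using Condition 3. Their orders (indicating only dependencies on $d,N,L_{\nabla f},\mu,\nu,\beta_1,\beta_2$; here $\nu=\hat\nu$) are: FD, RC, RS: $b_1=\mathcal{O}(\beta_1)$, $b_2=\mathcal{O}(\beta_1L_{\nabla f}^2\nu^2d+\beta_2)$. GS: $b_1=\mathcal{O}(\beta_1d)$, $b_2=\mathcal{O}((\beta_1+d)L_{\nabla f}^2\nu^2d^2+\beta_2d)$. SS: $b_1=\mathcal{O}(\beta_1d)$, $b_2=\mathcal{O}((\beta_1+d)L_{\nabla f}^2\nu^2d+\beta_2d)$. **$\mathcal{O}$-convention.** $\theta$ is a user-defined hyperparameter regarded as $\mathcal{O}(1)$. In the final per-method complexities, $\beta_1,\beta_2$ and $L_{\nabla f}/L_{\nabla F}$ are also regarded as $\mathcal{O}(1)$.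
   Formalization: Literal W(ε) can be unbounded near the optimum, so W counts only iterations k<K(ε) with F(x_k)-F(x* )>ε (full W(ε) if all are such); |S_k| is the least size meeting the condition; 1+β1 replaces β1 in the b1, b2 orders of FD, RC, RS and b1 of GS, SS; final orders need εp≤1/2. *)

theory Defs
  imports "HOL-Probability.Probability"
begin

section \<open>Gradient estimators\<close>

datatype estimator = FD | GS | SS | RC | RS

fun scaling :: "estimator \<Rightarrow> nat \<Rightarrow> nat \<Rightarrow> real" where
  "scaling FD d N = 1"
| "scaling GS d N = 1 / real N"
| "scaling SS d N = real d / real N"
| "scaling RC d N = real d / real N"
| "scaling RS d N = real d / real N"

text \<open>
  A collection \<open>T\<close> of \<open>N\<close> directions is a tuple \<open>u 0, \<dots>, u (N - 1)\<close>, i.e. an element of the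
  following space.  The estimator is a functional of the function that is differenced: inserting a
  sample average gives $g_{S,T}$, inserting a single realization gives $g_{\zeta,T}$.
\<close>

abbreviation dir_space :: "nat \<Rightarrow> (nat \<Rightarrow> real ^ 'd) measure" where
  "dir_space N \<equiv> PiM {..<N} (\<lambda>_. borel)"

definition grad_est ::
  "estimator \<Rightarrow> nat \<Rightarrow> real \<Rightarrow> (nat \<Rightarrow> real ^ 'd) \<Rightarrow> (real ^ 'd \<Rightarrow> real) \<Rightarrow> real ^ 'd \<Rightarrow> real ^ 'd" where
  "grad_est m N \<nu> u h x =
     scaling m CARD('d) N *\<^sub>R (\<Sum>j<N. ((h (x + \<nu> *\<^sub>R u j) - h x) / \<nu>) *\<^sub>R u j)"

definition sample_avg :: "(real ^ 'd \<Rightarrow> 'z \<Rightarrow> real) \<Rightarrow> nat \<Rightarrow> (nat \<Rightarrow> 'z) \<Rightarrow> real ^ 'd \<Rightarrow> real" where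
  "sample_avg f n z y = (\<Sum>i<n. f y (z i)) / real n"

definition std_gaussian :: "(real ^ 'd) measure" where
  "std_gaussian = density lborel (\<lambda>x. ennreal (\<Prod>i\<in>UNIV. std_normal_density (x $ i)))"

text \<open>
  The uniform distribution on the unit sphere (normalized surface measure), obtained by projecting
  the uniform distribution of the unit ball radially.
\<close>

definition uniform_sphere :: "(real ^ 'd) measure" where
  "uniform_sphere = distr (uniform_measure lborel (ball 0 1)) borel (\<lambda>x. x /\<^sub>R norm x)"

text \<open>The index tuples obtained by \<open>N\<close> uniform draws without replacement from \<open>{..<d}\<close>.\<close>

definition draws_wo_replacement :: "nat \<Rightarrow> nat \<Rightarrow> (nat \<Rightarrow> nat) pmf" where
  "draws_wo_replacement d N = pmf_of_set {s \<in> {..<N} \<rightarrow>\<^sub>E {..<d}. inj_on s {..<N}}"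

text \<open>
  \<open>direction_law m N D\<close>: \<open>D\<close> is an admissible law of the directions of one iteration of method \<open>m\<close>.
  For \<open>RS\<close> the law \<open>Q\<close> of the random orthonormal basis is arbitrary.
\<close>

fun direction_law :: "estimator \<Rightarrow> nat \<Rightarrow> (nat \<Rightarrow> real ^ 'd) measure \<Rightarrow> bool" where
  "direction_law FD N D \<longleftrightarrow> N = CARD('d) \<and>
     (\<exists>e. bij_betw e {..<N} (Basis :: (real ^ 'd) set) \<and>
          D = return (dir_space N) (restrict e {..<N}))"
| "direction_law GS N D \<longleftrightarrow> D = PiM {..<N} (\<lambda>_. std_gaussian)"
| "direction_law SS N D \<longleftrightarrow> D = PiM {..<N} (\<lambda>_. uniform_sphere)"
| "direction_law RC N D \<longleftrightarrow> N \<le> CARD('d) \<and>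
     (\<exists>e. bij_betw e {..<CARD('d)} (Basis :: (real ^ 'd) set) \<and>
          D = distr (measure_pmf (draws_wo_replacement CARD('d) N)) (dir_space N)
                (\<lambda>s. \<lambda>j\<in>{..<N}. e (s j)))"
| "direction_law RS N D \<longleftrightarrow> N \<le> CARD('d) \<and>
     (\<exists>Q. prob_space Q \<and> sets Q = sets (dir_space CARD('d) :: (nat \<Rightarrow> real ^ 'd) measure) \<and>
          (AE b in Q. \<forall>i<CARD('d). \<forall>j<CARD('d). b i \<bullet> b j = (if i = j then 1 else 0)) \<and>
          D = distr (Q \<Otimes>\<^sub>M measure_pmf (draws_wo_replacement CARD('d) N)) (dir_space N)
                (\<lambda>(b, s). \<lambda>j\<in>{..<N}. b (s j)))"

section \<open>Expected estimators and sample size conditions\<close>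

text \<open>
  The expectations over the samples or the directions of one iteration are taken with everything
  else held fixed.  In a run, where the directions are independent of the past and the samples are
  independent of the past and of the directions, these are versions of the conditional expectations.

  \<open>g_dir\<close> is $g_T(x) = E_S[g_{S,T}(x)]$; since $g_{S,T}$ is the average of the $g_{\zeta_i,T}$ over
  the identically distributed $\zeta_i \in S$, one sample suffices.  \<open>g_mean\<close> is
  $g(x) = E_T[g_T(x)]$, \<open>g_var\<close> is $V$, and \<open>g_sq\<close> is $E_T[\|g_T(x)\|^2]$, where \<open>D\<close> is the law of
  the directions.
\<close>

definition g_dir ::
  "'z measure \<Rightarrow> (real ^ 'd \<Rightarrow> 'z \<Rightarrow> real) \<Rightarrow> estimator \<Rightarrow> nat \<Rightarrow> real \<Rightarrow> (nat \<Rightarrow> real ^ 'd) \<Rightarrow>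
    real ^ 'd \<Rightarrow> real ^ 'd" where
  "g_dir P f m N \<nu> u x = (\<integral>\<zeta>. grad_est m N \<nu> u (\<lambda>y. f y \<zeta>) x \<partial>P)"

definition g_mean ::
  "'z measure \<Rightarrow> (real ^ 'd \<Rightarrow> 'z \<Rightarrow> real) \<Rightarrow> estimator \<Rightarrow> nat \<Rightarrow> real \<Rightarrow>
    (nat \<Rightarrow> real ^ 'd) measure \<Rightarrow> real ^ 'd \<Rightarrow> real ^ 'd" where
  "g_mean P f m N \<nu> D x = (\<integral>u. g_dir P f m N \<nu> u x \<partial>D)"

definition g_var ::
  "'z measure \<Rightarrow> (real ^ 'd \<Rightarrow> 'z \<Rightarrow> real) \<Rightarrow> estimator \<Rightarrow> nat \<Rightarrow> real \<Rightarrow> (nat \<Rightarrow> real ^ 'd) \<Rightarrow>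
    real ^ 'd \<Rightarrow> real" where
  "g_var P f m N \<nu> u x =
     (\<integral>\<zeta>. (norm (grad_est m N \<nu> u (\<lambda>y. f y \<zeta>) x - g_dir P f m N \<nu> u x))\<^sup>2 \<partial>P)"

definition g_sq ::
  "'z measure \<Rightarrow> (real ^ 'd \<Rightarrow> 'z \<Rightarrow> real) \<Rightarrow> estimator \<Rightarrow> nat \<Rightarrow> real \<Rightarrow>
    (nat \<Rightarrow> real ^ 'd) measure \<Rightarrow> real ^ 'd \<Rightarrow> real" where
  "g_sq P f m N \<nu> D x = (\<integral>u. (norm (g_dir P f m N \<nu> u x))\<^sup>2 \<partial>D)"

definition condition2 ::
  "'z measure \<Rightarrow> (real ^ 'd \<Rightarrow> 'z \<Rightarrow> real) \<Rightarrow> estimator \<Rightarrow> nat \<Rightarrow> real \<Rightarrow> real \<Rightarrow>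
    (nat \<Rightarrow> real ^ 'd) measure \<Rightarrow> (nat \<Rightarrow> real ^ 'd) \<Rightarrow> real ^ 'd \<Rightarrow> nat \<Rightarrow> bool" where
  "condition2 P f m N \<nu> \<theta> D u x n \<longleftrightarrow>
     g_var P f m N \<nu> u x / real n \<le> \<theta>\<^sup>2 * g_sq P f m N \<nu> D x"

definition condition3 ::
  "'z measure \<Rightarrow> (real ^ 'd \<Rightarrow> 'z \<Rightarrow> real) \<Rightarrow> estimator \<Rightarrow> nat \<Rightarrow> real \<Rightarrow> real \<Rightarrow>
    (nat \<Rightarrow> real ^ 'd) measure \<Rightarrow> real ^ 'd \<Rightarrow> nat \<Rightarrow> bool" where
  "condition3 P f m N \<nu> \<theta> D x n \<longleftrightarrow>
     (\<integral>u. g_var P f m N \<nu> u x \<partial>D) / real n \<le> \<theta>\<^sup>2 * g_sq P f m N \<nu> D x"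

text \<open>
  The conditions bound the sample size from below, so choosing it according to a condition means
  taking the smallest admissible positive integer.  No size is admissible if the right-hand
  side of the condition vanishes while the variance does not; the size is then unconstrained.
\<close>

definition chosen_by :: "(nat \<Rightarrow> bool) \<Rightarrow> nat \<Rightarrow> bool" where
  "chosen_by Q n \<longleftrightarrow> ((\<exists>k>0. Q k) \<longrightarrow> Q n \<and> (\<forall>k. 0 < k \<and> k < n \<longrightarrow> \<not> Q k))"

section \<open>Parameters\<close>

fun rate_factor :: "estimator \<Rightarrow> nat \<Rightarrow> nat \<Rightarrow> real" where
  "rate_factor FD d N = 1"
| "rate_factor GS d N = real N / (real N + 4.5 * real d)"
| "rate_factor SS d N = real N / (real N + 4.5 * real d)"
| "rate_factor RC d N = real N / real d"
| "rate_factor RS d N = real N / real d"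

definition alpha_bar :: "estimator \<Rightarrow> nat \<Rightarrow> nat \<Rightarrow> real \<Rightarrow> real \<Rightarrow> real" where
  "alpha_bar m d N \<theta> LF = rate_factor m d N * (1 / (4 * (1 + \<theta>\<^sup>2) * LF))"

definition rho :: "estimator \<Rightarrow> nat \<Rightarrow> nat \<Rightarrow> real \<Rightarrow> real \<Rightarrow> real \<Rightarrow> real" where
  "rho m d N \<theta> LF \<mu> = rate_factor m d N * (\<mu> / (8 * (1 + \<theta>\<^sup>2) * LF))"

fun radius_factor :: "estimator \<Rightarrow> nat \<Rightarrow> nat \<Rightarrow> real" where
  "radius_factor FD d N = 1"
| "radius_factor GS d N =
     sqrt (2 * (real N + 4.5 * real d) /
           (8 * real N + 24 * real d + (real d + 2) * (real d + 4)))"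
| "radius_factor SS d N =
     sqrt (2 * (real N + 4.5 * real d) * real d / (8 * real N + 24 * real d + (real d)\<^sup>2))"
| "radius_factor RC d N = 1"
| "radius_factor RS d N = 1"

definition nu_hat :: "estimator \<Rightarrow> nat \<Rightarrow> nat \<Rightarrow> real \<Rightarrow> real \<Rightarrow> real \<Rightarrow> real \<Rightarrow> real" where
  "nu_hat m d N \<epsilon> p LF \<mu> = radius_factor m d N * sqrt (4 * \<epsilon> * p * \<mu> / (3 * LF\<^sup>2 * real d))"

text \<open>
  The iteration bound, rounded up to a positive integer; \<open>gap\<close> is the initial optimality gap.  For
  \<open>gap = 0\<close> the logarithm is $-\infty$, whence the value \<open>1\<close>.
\<close>

definition iteration_bound :: "real \<Rightarrow> real \<Rightarrow> real \<Rightarrow> real \<Rightarrow> nat" where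
  "iteration_bound gap \<epsilon> p \<rho> =
     (if gap \<le> 0 then 1
      else max 1 (nat \<lceil>(ln gap - ln (\<epsilon> * p / 2)) / ln (1 / (1 - \<rho>))\<rceil>))"

section \<open>Orders\<close>

text \<open>
  Here \<open>1 + \<beta>1\<close> replaces \<open>\<beta>1\<close> where the latter occurs as a factor that must not vanish: a sample
  has at least one element even if \<open>\<beta>1 = 0\<close>, so no bound proportional to \<open>\<beta>1\<close> could hold.
\<close>

fun b1_order :: "estimator \<Rightarrow> nat \<Rightarrow> real \<Rightarrow> real" where
  "b1_order FD d \<beta>1 = 1 + \<beta>1"
| "b1_order GS d \<beta>1 = (1 + \<beta>1) * real d"
| "b1_order SS d \<beta>1 = (1 + \<beta>1) * real d"
| "b1_order RC d \<beta>1 = 1 + \<beta>1"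
| "b1_order RS d \<beta>1 = 1 + \<beta>1"

fun b2_order :: "estimator \<Rightarrow> nat \<Rightarrow> real \<Rightarrow> real \<Rightarrow> real \<Rightarrow> real \<Rightarrow> real" where
  "b2_order FD d \<beta>1 \<beta>2 Lf \<nu> = (1 + \<beta>1) * Lf\<^sup>2 * \<nu>\<^sup>2 * real d + \<beta>2"
| "b2_order GS d \<beta>1 \<beta>2 Lf \<nu> = (\<beta>1 + real d) * Lf\<^sup>2 * \<nu>\<^sup>2 * (real d)\<^sup>2 + \<beta>2 * real d"
| "b2_order SS d \<beta>1 \<beta>2 Lf \<nu> = (\<beta>1 + real d) * Lf\<^sup>2 * \<nu>\<^sup>2 * real d + \<beta>2 * real d"
| "b2_order RC d \<beta>1 \<beta>2 Lf \<nu> = (1 + \<beta>1) * Lf\<^sup>2 * \<nu>\<^sup>2 * real d + \<beta>2"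
| "b2_order RS d \<beta>1 \<beta>2 Lf \<nu> = (1 + \<beta>1) * Lf\<^sup>2 * \<nu>\<^sup>2 * real d + \<beta>2"

definition Omega7 :: "nat \<Rightarrow> real \<Rightarrow> real \<Rightarrow> real \<Rightarrow> real \<Rightarrow> real" where
  "Omega7 d \<epsilon> p LF \<mu> = ln (1 / (\<epsilon> * p)) * (LF * real d / \<mu>)"

definition Omega8 :: "nat \<Rightarrow> real \<Rightarrow> real \<Rightarrow> real \<Rightarrow> real \<Rightarrow> real" where
  "Omega8 d \<epsilon> p LF \<mu> = ln (1 / (\<epsilon> * p)) / \<epsilon> * (LF * real d / \<mu>\<^sup>2)"

definition smoothing_order :: "nat \<Rightarrow> nat \<Rightarrow> real \<Rightarrow> real \<Rightarrow> real \<Rightarrow> real \<Rightarrow> real" where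
  "smoothing_order d N \<epsilon> p LF \<mu> =
     (max (real N) (real d))\<^sup>2 * real d / max (real N) ((real d)\<^sup>2) * Omega7 d \<epsilon> p LF \<mu>
     + max (real N) (real d) * Omega8 d \<epsilon> p LF \<mu>"

fun total_order :: "estimator \<Rightarrow> nat \<Rightarrow> nat \<Rightarrow> real \<Rightarrow> real \<Rightarrow> real \<Rightarrow> real \<Rightarrow> real" where
  "total_order FD d N \<epsilon> p LF \<mu> = Omega7 d \<epsilon> p LF \<mu> + Omega8 d \<epsilon> p LF \<mu>"
| "total_order GS d N \<epsilon> p LF \<mu> = smoothing_order d N \<epsilon> p LF \<mu>"
| "total_order SS d N \<epsilon> p LF \<mu> = smoothing_order d N \<epsilon> p LF \<mu>"
| "total_order RC d N \<epsilon> p LF \<mu> = Omega7 d \<epsilon> p LF \<mu> + Omega8 d \<epsilon> p LF \<mu>"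
| "total_order RS d N \<epsilon> p LF \<mu> = Omega7 d \<epsilon> p LF \<mu> + Omega8 d \<epsilon> p LF \<mu>"

text \<open>
  The constants hidden in the order notation.  They are explicit because the dimension is a type:
  an existentially quantified constant could depend on it.  What matters is on which quantities
  they depend: \<open>c_evals\<close> on nothing, \<open>c_size\<close> on \<open>\<theta>\<close> only, \<open>c_total\<close> in addition on \<open>\<beta>1\<close>, \<open>\<beta>2\<close>, on
  the ratio \<open>\<kappa>\<close> of the Lipschitz constants and on the initial optimality gap.  The numbers are not
  optimized.
\<close>

definition c_evals :: real where
  "c_evals = 16"

definition c_size :: "real \<Rightarrow> real" where
  "c_size \<theta> = 40 * (1 + 1 / \<theta>\<^sup>2)"

definition c_total :: "real \<Rightarrow> real \<Rightarrow> real \<Rightarrow> real \<Rightarrow> real \<Rightarrow> real" where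
  "c_total \<theta> \<beta>1 \<beta>2 \<kappa> gap =
     10 ^ 6 * (1 + \<theta>\<^sup>2) * (1 + 1 / \<theta>\<^sup>2) * (1 + \<beta>1 + \<beta>2) * \<kappa>\<^sup>2 * (1 + max 0 (ln (2 * gap)))"

section \<open>The optimization problem\<close>

locale stochastic_problem = prob_space P
  for P :: "'z measure" +
  fixes f :: "real ^ 'd \<Rightarrow> 'z \<Rightarrow> real"
    and f' :: "real ^ 'd \<Rightarrow> 'z \<Rightarrow> real ^ 'd"
    and F :: "real ^ 'd \<Rightarrow> real"
    and F' :: "real ^ 'd \<Rightarrow> real ^ 'd"
    and xs :: "real ^ 'd"
    and Lf LF \<beta>1 \<beta>2 \<mu> :: real
  assumes f_integrable: "integrable P (f x)"
    and F_eq: "F x = (\<integral>\<zeta>. f x \<zeta> \<partial>P)"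
    and F_gradient: "GDERIV F x :> F' x"
    and F'_continuous: "continuous_on UNIV F'"
    and minimizer: "F xs \<le> F x"
    and f_gradient: "\<zeta> \<in> space P \<Longrightarrow> GDERIV (\<lambda>y. f y \<zeta>) x :> f' x \<zeta>"
    and f'_lipschitz: "\<zeta> \<in> space P \<Longrightarrow> Lf-lipschitz_on UNIV (\<lambda>x. f' x \<zeta>)"
    and F'_lipschitz: "LF-lipschitz_on UNIV F'"
    and LF_pos: "0 < LF"
    and LF_le: "LF \<le> Lf"
    and beta_nonneg: "0 \<le> \<beta>1" "0 \<le> \<beta>2"
    and variance: "(\<integral>\<^sup>+\<zeta>. ennreal ((norm (f' x \<zeta> - F' x))\<^sup>2) \<partial>P)
                     \<le> ennreal (\<beta>1 * (norm (F' x))\<^sup>2 + \<beta>2)"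
    and mu_pos: "0 < \<mu>"
    and strong_convexity: "2 * \<mu> * (F x - F xs) \<le> (norm (F' x))\<^sup>2"

section \<open>The method\<close>

text \<open>
  \<open>U k\<close> is the tuple of directions of iteration \<open>k\<close>, \<open>n k\<close> is the sample size and \<open>Z k i\<close>, \<open>i < n k\<close>,
  are the samples.  The remaining \<open>Z k i\<close> are draws that are not used; they are there because \<open>n k\<close>
  is random.  \<open>history M D P U Z k l\<close> is generated by the directions of the iterations before \<open>k\<close>
  and the draws of the iterations before \<open>l\<close>, so that the \<sigma>-algebras $F_k$ and
  $F_{k+1/2}$ are \<open>history M D P U Z k k\<close> and \<open>history M D P U Z (Suc k) k\<close>.
\<close>

definition history ::
  "'w measure \<Rightarrow> 'u measure \<Rightarrow> 'z measure \<Rightarrow> (nat \<Rightarrow> 'w \<Rightarrow> 'u) \<Rightarrow> (nat \<Rightarrow> nat \<Rightarrow> 'w \<Rightarrow> 'z) \<Rightarrow>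
    nat \<Rightarrow> nat \<Rightarrow> 'w measure" where
  "history M D P U Z k l = sigma (space M)
     ((\<Union>i<k. sets (vimage_algebra (space M) (U i) D)) \<union>
      (\<Union>i<l. \<Union>j. sets (vimage_algebra (space M) (Z i j) P)))"

abbreviation dir_distr ::
  "'w measure \<Rightarrow> nat \<Rightarrow> (nat \<Rightarrow> 'w \<Rightarrow> nat \<Rightarrow> real ^ 'd) \<Rightarrow> nat \<Rightarrow> (nat \<Rightarrow> real ^ 'd) measure" where
  "dir_distr M N U k \<equiv> distr M (dir_space N) (U k)"

locale adaptive_run =
  stochastic_problem P f f' F F' xs Lf LF \<beta>1 \<beta>2 \<mu> + run: prob_space M
  for P :: "'z measure"
    and f :: "real ^ 'd \<Rightarrow> 'z \<Rightarrow> real"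
    and f' F F' xs Lf LF \<beta>1 \<beta>2 \<mu>
    and M :: "'w measure" +
  fixes m :: estimator
    and N :: nat
    and \<theta> \<epsilon> p \<nu> \<alpha> :: real
    and x0 :: "real ^ 'd"
    and U :: "nat \<Rightarrow> 'w \<Rightarrow> nat \<Rightarrow> real ^ 'd"
    and Z :: "nat \<Rightarrow> nat \<Rightarrow> 'w \<Rightarrow> 'z"
    and n :: "nat \<Rightarrow> 'w \<Rightarrow> nat"
    and x :: "nat \<Rightarrow> 'w \<Rightarrow> real ^ 'd"
  assumes theta_pos: "0 < \<theta>"
    and eps_pos: "0 < \<epsilon>"
    and p_range: "0 < p" "p \<le> 1"
    and N_pos: "0 < N"
    and nu_eq: "\<nu> = nu_hat m CARD('d) N \<epsilon> p LF \<mu>"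
    and alpha_eq: "\<alpha> = alpha_bar m CARD('d) N \<theta> LF"
    and directions_measurable: "U k \<in> M \<rightarrow>\<^sub>M dir_space N"
    and directions_law: "direction_law m N (dir_distr M N U k)"
    and directions_indep:
      "run.indep_set (sets (history M (dir_space N) P U Z k k))
                     (sets (vimage_algebra (space M) (U k) (dir_space N)))"
    and samples_iid: "run.indep_vars (\<lambda>_. P) (Z k) UNIV" "distr M P (Z k i) = P"
    and samples_indep:
      "run.indep_set (sets (history M (dir_space N) P U Z (Suc k) k))
                     (sigma_sets (space M) (\<Union>j. sets (vimage_algebra (space M) (Z k j) P)))"
    and size_adapted:
      "n k \<in> history M (dir_space N) P U Z (Suc k) k \<rightarrow>\<^sub>M count_space UNIV"
    and size_pos: "\<omega> \<in> space M \<Longrightarrow> 0 < n k \<omega>"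
    and start: "\<omega> \<in> space M \<Longrightarrow> x 0 \<omega> = x0"
    and step: "\<omega> \<in> space M \<Longrightarrow> x (Suc k) \<omega> =
      x k \<omega> - \<alpha> *\<^sub>R grad_est m N \<nu> (U k \<omega>) (sample_avg f (n k \<omega>) (\<lambda>i. Z k i \<omega>)) (x k \<omega>)"

text \<open>
  The defining property of the constants \<open>b1\<close>, \<open>b2\<close>, for either condition; the conditional
  expectation given \<open>history M D P U Z k k\<close> is $E_{T_k}$.
\<close>

definition mean_size_bound ::
  "'z measure \<Rightarrow> (real ^ 'd \<Rightarrow> 'z \<Rightarrow> real) \<Rightarrow> 'w measure \<Rightarrow> estimator \<Rightarrow> nat \<Rightarrow> real \<Rightarrow>
    (nat \<Rightarrow> 'w \<Rightarrow> nat \<Rightarrow> real ^ 'd) \<Rightarrow> (nat \<Rightarrow> nat \<Rightarrow> 'w \<Rightarrow> 'z) \<Rightarrow> (nat \<Rightarrow> 'w \<Rightarrow> nat) \<Rightarrow>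
    (nat \<Rightarrow> 'w \<Rightarrow> real ^ 'd) \<Rightarrow> real \<Rightarrow> real \<Rightarrow> bool" where
  "mean_size_bound P f M m N \<nu> U Z n x b1 b2 \<longleftrightarrow>
     (\<forall>\<epsilon>'>0. \<forall>k. AE \<omega> in M.
        (norm (g_mean P f m N \<nu> (dir_distr M N U k) (x k \<omega>)))\<^sup>2 > \<epsilon>' \<longrightarrow>
        nn_cond_exp M (history M (dir_space N) P U Z k k) (\<lambda>\<omega>. ennreal (real (n k \<omega>))) \<omega>
          \<le> ennreal (b1 + b2 / \<epsilon>'))"

definition size_bound ::
  "'z measure \<Rightarrow> (real ^ 'd \<Rightarrow> 'z \<Rightarrow> real) \<Rightarrow> 'w measure \<Rightarrow> estimator \<Rightarrow> nat \<Rightarrow> real \<Rightarrow>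
    (nat \<Rightarrow> 'w \<Rightarrow> nat \<Rightarrow> real ^ 'd) \<Rightarrow> (nat \<Rightarrow> 'w \<Rightarrow> nat) \<Rightarrow>
    (nat \<Rightarrow> 'w \<Rightarrow> real ^ 'd) \<Rightarrow> real \<Rightarrow> real \<Rightarrow> bool" where
  "size_bound P f M m N \<nu> U n x b1 b2 \<longleftrightarrow>
     (\<forall>\<epsilon>'>0. \<forall>k. AE \<omega> in M.
        (norm (g_mean P f m N \<nu> (dir_distr M N U k) (x k \<omega>)))\<^sup>2 > \<epsilon>' \<longrightarrow>
        real (n k \<omega>) \<le> b1 + b2 / \<epsilon>')"

section \<open>Sample complexity\<close>

text \<open>
  \<open>total_evals N n K\<close> is the number of function evaluations in the first \<open>K\<close> iterations.
  \<open>evals_to_accuracy\<close> counts only the iterations whose iterate has not reached the accuracy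
  \<open>\<epsilon>\<close>.  Once an iterate is more accurate than that, \<open>g_sq\<close> may be arbitrarily small or zero there
  and the sample sizes demanded by the conditions have no bound in terms of \<open>\<epsilon>\<close>.
\<close>

definition total_evals :: "nat \<Rightarrow> (nat \<Rightarrow> 'w \<Rightarrow> nat) \<Rightarrow> nat \<Rightarrow> 'w \<Rightarrow> real" where
  "total_evals N n K \<omega> = (real N + 1) * (\<Sum>i<K. real (n i \<omega>))"

definition evals_to_accuracy ::
  "(real ^ 'd \<Rightarrow> real) \<Rightarrow> real ^ 'd \<Rightarrow> real \<Rightarrow> (nat \<Rightarrow> 'w \<Rightarrow> real ^ 'd) \<Rightarrow>
    nat \<Rightarrow> (nat \<Rightarrow> 'w \<Rightarrow> nat) \<Rightarrow> nat \<Rightarrow> 'w \<Rightarrow> real" where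
  "evals_to_accuracy F xs \<epsilon> x N n K \<omega> =
     (real N + 1) * (\<Sum>i | i < K \<and> F (x i \<omega>) - F xs > \<epsilon>. real (n i \<omega>))"

definition mean_le :: "'w measure \<Rightarrow> ('w \<Rightarrow> real) \<Rightarrow> real \<Rightarrow> bool" where
  "mean_le M X B \<longleftrightarrow> (\<integral>\<^sup>+\<omega>. ennreal (X \<omega>) \<partial>M) \<le> ennreal B"

end

theory Submission
  imports Defs
begin

text \<open>
  Conditions 2 and 3 force a sample of size about $1 + V/(\theta^2 E\|g_T\|^2)$, so everything reduces to
  three bounds for one iteration: the bias $\|g - \nabla F\|^2 = O(L^2\nu^2)$, the bound
  $E\|g_T\|^2 \ge c\,\|g\|^2$, and
  $E V \le c\,(A\,(\beta_1\|\nabla F\|^2 + \beta_2) + A' L^2 \nu^2)$ with the same factor $c$ in both.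
  For \<open>RC\<close> and \<open>RS\<close> this factor is $d/N$ and cancels in the quotient.  For \<open>GS\<close> and \<open>SS\<close> the bias
  is estimated by pairing a direction with its mirror image in the hyperplane orthogonal to the component
  under consideration; this needs only the reflection invariance of the two distributions, and it gives
  the constants $3d$ and $1$ in the first bound, where a Taylor bound on absolute moments would lose a factor of order $d$.
  While $F(x) - F(x^* ) > \epsilon$, strong convexity gives $\|\nabla F\|^2 > 2\mu\epsilon$, and at the radius
  $\hat\nu$ the bias is so small that $\|g\|^2 > \epsilon\mu/8$; hence the sample sizes are at most
  $b_1 + 8 b_2/(\epsilon\mu)$.
\<close>

section \<open>Functions with Lipschitz gradient\<close>

text \<open>Variances occur whose integrability is not known in advance. They are bounded in
  \<open>ennreal\<close>: the Bochner integral of a nonnegative function never exceeds its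
  nonnegative integral, as it is 0 for a non-integrable one. For \<open>g_sq\<close>, which is
  bounded from below, the same default forces a proof of integrability. The gradient is only
  Lipschitz, so the bias has no third-order expansion. Mirroring leaves a factor
  \<open>u \<bullet> v\<close> in the error, and the average of
  \<open>norm u * (u \<bullet> v)\<^sup>2\<close> is \<open>1 / d\<close> times the third moment of
  \<open>norm u\<close>; this is the factor d that is gained. \<open>FD\<close> and
  \<open>RC\<close> become instances of the form of \<open>RS\<close> by viewing a fixed basis as a
  degenerate random one. For a fixed basis, averaging over the draws is then an exact computation,
  by Pythagoras and equal coverage of the indices. Condition 3 bounds the sample size on each path.
  Under Condition 2 the size depends on the current directions, and its conditional mean is found by
  freezing the past and integrating over the direction law. The 8 in the final bound comes from the
  margin \<open>sqrt 2 - sqrt 1.1 > 0.36\<close>, whose square exceeds \<open>1 / 8\<close>.\<close>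

lemma gderiv_along_line:
  fixes h :: "'a::real_inner \<Rightarrow> real"
  assumes "\<And>y. GDERIV h y :> h' y"
  shows "((\<lambda>t. h (y + t *\<^sub>R w)) has_real_derivative h' (y + t *\<^sub>R w) \<bullet> w) (at t within S)"
proof -
  have "(h has_derivative (\<lambda>k. k \<bullet> h' (y + t *\<^sub>R w))) (at (y + t *\<^sub>R w))"
    using assms unfolding gderiv_def by blast
  then have "((\<lambda>t. h (y + t *\<^sub>R w)) has_derivative (\<lambda>s. (s *\<^sub>R w) \<bullet> h' (y + t *\<^sub>R w))) (at t within S)"
    by (rule has_derivative_compose[rotated]) (auto intro!: derivative_eq_intros)
  moreover have "(\<lambda>s. (s *\<^sub>R w) \<bullet> h' (y + t *\<^sub>R w)) = (*) (h' (y + t *\<^sub>R w) \<bullet> w)"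
    by (auto simp: fun_eq_iff inner_commute)
  ultimately show ?thesis by (simp add: has_field_derivative_def)
qed

text \<open>Descent lemma: \<open>\<phi>\<close> subtracts the linear part and the quadratic
  majorant along the segment. Cauchy-Schwarz and the Lipschitz condition make its derivative
  nonpositive on the unit interval, so monotonicity takes the place of an integral
  remainder.\<close>

lemma lipschitz_gradient_upper:
  fixes h :: "'a::real_inner \<Rightarrow> real"
  assumes der: "\<And>y. GDERIV h y :> h' y" and lip: "L-lipschitz_on UNIV h'"
  shows "h (y + w) - h y - h' y \<bullet> w \<le> L / 2 * (norm w)\<^sup>2"
proof -
  define \<phi> where "\<phi> t = h (y + t *\<^sub>R w) - t * (h' y \<bullet> w) - L * t\<^sup>2 / 2 * (norm w)\<^sup>2" for t
  have "\<phi> 1 \<le> \<phi> 0"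
  proof (rule DERIV_nonpos_imp_nonincreasing[where f = \<phi>])
    fix t :: real assume t: "0 \<le> t" "t \<le> 1"
    have "(\<phi> has_real_derivative
        h' (y + t *\<^sub>R w) \<bullet> w - h' y \<bullet> w - L * t * (norm w)\<^sup>2) (at t)"
      unfolding \<phi>_def by (auto intro!: derivative_eq_intros gderiv_along_line[OF der])
    moreover have "(h' (y + t *\<^sub>R w) - h' y) \<bullet> w \<le> norm (h' (y + t *\<^sub>R w) - h' y) * norm w"
      by (rule norm_cauchy_schwarz)
    moreover have "norm (h' (y + t *\<^sub>R w) - h' y) \<le> L * (t * norm w)"
      using lipschitz_on_normD[OF lip, of "y + t *\<^sub>R w" y] t by simp
    ultimately show "\<exists>D. (\<phi> has_real_derivative D) (at t) \<and> D \<le> 0"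
      using mult_right_mono[of "norm (h' (y + t *\<^sub>R w) - h' y)" "L * (t * norm w)" "norm w"]
      by (intro exI conjI) (auto simp: inner_diff_left power2_eq_square algebra_simps)
  qed simp
  then show ?thesis by (simp add: \<phi>_def)
qed

lemma lipschitz_gradient_taylor:
  fixes h :: "'a::real_inner \<Rightarrow> real"
  assumes der: "\<And>y. GDERIV h y :> h' y" and lip: "L-lipschitz_on UNIV h'"
  shows "\<bar>h (y + w) - h y - h' y \<bullet> w\<bar> \<le> L / 2 * (norm w)\<^sup>2"
proof -
  have "GDERIV (\<lambda>y. - h y) y :> - h' y" for y
    using der[of y] unfolding gderiv_def inner_minus_right by (rule has_derivative_minus)
  moreover have "L-lipschitz_on UNIV (\<lambda>y. - h' y)"
    using lip by (simp add: lipschitz_on_def dist_minus)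
  ultimately have "- h (y + w) - (- h y) - (- h' y) \<bullet> w \<le> L / 2 * (norm w)\<^sup>2"
    by (rule lipschitz_gradient_upper)
  then show ?thesis using lipschitz_gradient_upper[OF der lip, of y w]
    unfolding inner_minus_left by linarith
qed

text \<open>A gradient step of length \<open>1 / L\<close> lowers \<open>h\<close> by at least
  \<open>(norm (h' y))\<^sup>2 / (2 * L)\<close> and cannot go below \<open>m\<close>. Compared with
  strong convexity, this gives \<open>\<mu> \<le> LF\<close>.\<close>

lemma lipschitz_gradient_bounded_below:
  fixes h :: "'a::real_inner \<Rightarrow> real"
  assumes der: "\<And>y. GDERIV h y :> h' y" and lip: "L-lipschitz_on UNIV h'" and "0 < L"
    and low: "\<And>y. m \<le> h y"
  shows "(norm (h' y))\<^sup>2 \<le> 2 * L * (h y - m)"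
proof -
  have "h (y + (- (1 / L)) *\<^sub>R h' y) - h y - h' y \<bullet> ((- (1 / L)) *\<^sub>R h' y)
      \<le> L / 2 * (norm ((- (1 / L)) *\<^sub>R h' y))\<^sup>2"
    by (rule lipschitz_gradient_upper[OF der lip])
  then have "m - h y + (norm (h' y))\<^sup>2 / L \<le> (norm (h' y))\<^sup>2 / (2 * L)"
    using low[of "y + (- (1 / L)) *\<^sub>R h' y"] \<open>0 < L\<close>
    by (simp add: dot_square_norm power2_eq_square)
  moreover have "(norm (h' y))\<^sup>2 / L = 2 * ((norm (h' y))\<^sup>2 / (2 * L))" by simp
  ultimately have "(norm (h' y))\<^sup>2 / (2 * L) \<le> h y - m" by linarith
  then show ?thesis using \<open>0 < L\<close> by (simp add: field_simps)
qed

text \<open>The symmetric difference between a point and its mirror image in the hyperplane orthogonal to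
  \<open>v\<close> sees the gradient in direction \<open>v\<close> only.\<close>

lemma lipschitz_gradient_reflection:
  fixes h :: "'a::real_inner \<Rightarrow> real"
  assumes der: "\<And>y. GDERIV h y :> h' y" and lip: "L-lipschitz_on UNIV h'" and v: "norm v = 1"
  shows "\<bar>h (y + w) - h (y + (w - (2 * (w \<bullet> v)) *\<^sub>R v)) - 2 * (w \<bullet> v) * (h' y \<bullet> v)\<bar>
           \<le> 2 * L * norm w * \<bar>w \<bullet> v\<bar>"
proof -
  define s where "s = w \<bullet> v"
  define a where "a = w - (2 * s) *\<^sub>R v"
  have vv: "v \<bullet> v = 1" using v by (simp add: dot_square_norm)
  have norm_a: "norm a = norm w"
  proof -
    have "a \<bullet> a = w \<bullet> w"
      by (simp add: a_def s_def inner_diff_left inner_diff_right vv inner_commute algebra_simps)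
    then show ?thesis by (simp add: norm_eq_sqrt_inner)
  qed
  obtain t where t: "0 < t" "t < 1" and
    eq: "h (y + a + 1 *\<^sub>R (w - a)) - h (y + a + 0 *\<^sub>R (w - a)) =
        (1 - 0) * (h' (y + a + t *\<^sub>R (w - a)) \<bullet> (w - a))"
    using MVT2[OF zero_less_one, of "\<lambda>t. h (y + a + t *\<^sub>R (w - a))"
        "\<lambda>t. h' (y + a + t *\<^sub>R (w - a)) \<bullet> (w - a)"] gderiv_along_line[OF der] by blast
  let ?z = "a + t *\<^sub>R (w - a)"
  \<comment> \<open>The intermediate point of the mean value theorem lies between two points of norm
    \<open>norm w\<close>, so the gradient there differs from \<open>h' y\<close> by at most
    \<open>L * norm w\<close>.\<close>
  have "?z = (1 - t) *\<^sub>R a + t *\<^sub>R w" by (simp add: algebra_simps)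
  then have "norm ?z \<le> norm ((1 - t) *\<^sub>R a) + norm (t *\<^sub>R w)"
    by (metis norm_triangle_ineq)
  also have "\<dots> = (1 - t) * norm w + t * norm w" using t norm_a by simp
  finally have z: "norm ?z \<le> norm w" by (simp add: algebra_simps)
  have wa: "w - a = (2 * s) *\<^sub>R v" by (simp add: a_def)
  have L: "0 \<le> L" using lip by (rule lipschitz_on_nonneg)
  have "\<bar>(h' (y + ?z) - h' y) \<bullet> v\<bar> \<le> norm (h' (y + ?z) - h' y)"
    using Cauchy_Schwarz_ineq2[of "h' (y + ?z) - h' y" v] v by simp
  also have "\<dots> \<le> L * norm ?z"
    using lipschitz_on_normD[OF lip, of "y + ?z" y] by simp
  also have "\<dots> \<le> L * norm w" using z L by (rule mult_left_mono)
  finally have *: "\<bar>(h' (y + ?z) - h' y) \<bullet> v\<bar> \<le> L * norm w" .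
  have "h (y + w) - h (y + a) = h' (y + ?z) \<bullet> (w - a)"
    using eq by (simp add: add.assoc)
  then have "h (y + w) - h (y + a) - 2 * s * (h' y \<bullet> v) = 2 * s * ((h' (y + ?z) - h' y) \<bullet> v)"
    by (simp add: wa inner_diff_left algebra_simps)
  then have "\<bar>h (y + w) - h (y + a) - 2 * s * (h' y \<bullet> v)\<bar> = 2 * \<bar>s\<bar> * \<bar>(h' (y + ?z) - h' y) \<bullet> v\<bar>"
    by (simp add: abs_mult)
  also have "\<dots> \<le> 2 * \<bar>s\<bar> * (L * norm w)" using * by (intro mult_left_mono) auto
  finally show ?thesis by (simp add: a_def s_def algebra_simps)
qed

section \<open>Measurability and mean values\<close>

text \<open>Rounding the coordinates of \<open>y\<close> down to a grid of mesh
  \<open>1 / Suc n\<close> gives maps \<open>q n\<close> with countable range. Hence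
  \<open>g (q n y) \<zeta>\<close> is jointly measurable, and continuity in \<open>y\<close> passes
  this on to the limit. Joint measurability of \<open>f\<close> is what Tonelli and the
  measurability of the iterates rest on.\<close>

lemma caratheodory_measurable:
  fixes g :: "'a::euclidean_space \<Rightarrow> 'z \<Rightarrow> 'b::{second_countable_topology, metric_space}"
  assumes g: "\<And>y. g y \<in> borel_measurable P"
    and cont: "\<And>\<zeta>. \<zeta> \<in> space P \<Longrightarrow> continuous_on UNIV (\<lambda>y. g y \<zeta>)"
  shows "(\<lambda>(y, \<zeta>). g y \<zeta>) \<in> borel_measurable (borel \<Otimes>\<^sub>M P)"
proof -
  define q where "q n y = (\<Sum>b\<in>Basis. (real_of_int \<lfloor>real (Suc n) * (y \<bullet> b)\<rfloor> / real (Suc n)) *\<^sub>R b)"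
    for n and y :: 'a
  have q_meas [measurable]: "q n \<in> borel_measurable borel" for n
    unfolding q_def by measurable
  have q_lim: "(\<lambda>n. q n y) \<longlonglongrightarrow> y" for y
  proof -
    have "(\<lambda>n. real_of_int \<lfloor>real (Suc n) * r\<rfloor> / real (Suc n)) \<longlonglongrightarrow> r" for r
    proof (rule tendsto_sandwich)
      show "\<forall>\<^sub>F n in sequentially. r - inverse (real (Suc n)) \<le> real_of_int \<lfloor>real (Suc n) * r\<rfloor> / real (Suc n)"
      proof (rule always_eventually, rule allI)
        fix n
        have "real (Suc n) * r - 1 \<le> real_of_int \<lfloor>real (Suc n) * r\<rfloor>" by linarith
        then have "(real (Suc n) * r - 1) / real (Suc n) \<le> real_of_int \<lfloor>real (Suc n) * r\<rfloor> / real (Suc n)"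
          by (rule divide_right_mono) simp
        then show "r - inverse (real (Suc n)) \<le> real_of_int \<lfloor>real (Suc n) * r\<rfloor> / real (Suc n)"
          by (simp add: diff_divide_distrib inverse_eq_divide)
      qed
      show "\<forall>\<^sub>F n in sequentially. real_of_int \<lfloor>real (Suc n) * r\<rfloor> / real (Suc n) \<le> r"
        by (intro always_eventually allI) (simp add: pos_divide_le_eq mult.commute del: of_nat_Suc)
      show "(\<lambda>n. r - inverse (real (Suc n))) \<longlonglongrightarrow> r"
        using tendsto_diff[OF tendsto_const LIMSEQ_inverse_real_of_nat] by simp
    qed simp
    then have "(\<lambda>n. q n y) \<longlonglongrightarrow> (\<Sum>b\<in>Basis. (y \<bullet> b) *\<^sub>R b)"
      unfolding q_def by (intro tendsto_sum tendsto_scaleR tendsto_const)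
    then show ?thesis by (simp add: euclidean_representation)
  qed
  have range_q: "countable (range (q n))" for n
  proof -
    have "countable ((Basis :: 'a set) \<rightarrow>\<^sub>E (\<int> :: real set))"
      by (rule countable_PiE) (auto intro: countable_int)
    moreover have "range (q n) \<subseteq> (\<lambda>c. \<Sum>b\<in>Basis. (c b / real (Suc n)) *\<^sub>R b) ` (Basis \<rightarrow>\<^sub>E (\<int> :: real set))"
    proof
      fix z assume "z \<in> range (q n)"
      then obtain y where "z = q n y" by auto
      then show "z \<in> (\<lambda>c. \<Sum>b\<in>Basis. (c b / real (Suc n)) *\<^sub>R b) ` (Basis \<rightarrow>\<^sub>E (\<int> :: real set))"
        by (intro image_eqI[of _ _ "\<lambda>b\<in>Basis. real_of_int \<lfloor>real (Suc n) * (y \<bullet> b)\<rfloor>"])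
          (auto simp: q_def)
    qed
    ultimately show ?thesis by (meson countable_image countable_subset)
  qed
  show ?thesis
  proof (rule borel_measurable_LIMSEQ_metric)
    fix n
    have "(\<lambda>z. (\<lambda>y \<zeta>. g y (snd \<zeta>)) (q n (fst z)) z) \<in> borel_measurable (borel \<Otimes>\<^sub>M P)"
    proof (rule measurable_compose_countable'[where I = "range (q n)"])
      fix y
      show "(\<lambda>\<zeta>. g y (snd \<zeta>)) \<in> borel_measurable (borel \<Otimes>\<^sub>M P)"
        using g by measurable
    next
      show "(\<lambda>z. q n (fst z)) \<in> borel \<Otimes>\<^sub>M P \<rightarrow>\<^sub>M count_space (range (q n))"
      proof (rule measurable_count_space_eq_countable[OF range_q, THEN iffD2], intro conjI ballI)
        fix y
        show "(\<lambda>z. q n (fst z)) -` {y} \<inter> space (borel \<Otimes>\<^sub>M P) \<in> sets (borel \<Otimes>\<^sub>M P)"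
          by measurable
      qed auto
    qed (rule range_q)
    then show "(\<lambda>z. g (q n (fst z)) (snd z)) \<in> borel_measurable (borel \<Otimes>\<^sub>M P)" .
  next
    fix z :: "'a \<times> 'z" assume "z \<in> space (borel \<Otimes>\<^sub>M P)"
    then have "isCont (\<lambda>y. g y (snd z)) (fst z)"
      using cont[of "snd z"] by (auto simp: space_pair_measure continuous_on_eq_continuous_at)
    then show "(\<lambda>n. g (q n (fst z)) (snd z)) \<longlonglongrightarrow> (case z of (y, \<zeta>) \<Rightarrow> g y \<zeta>)"
      using isCont_tendsto_compose[OF _ q_lim, of _ "\<lambda>y. g y (snd z)"] by (simp add: case_prod_beta)
  qed
qed

text \<open>Jensen's inequality for the square, read off from the nonnegative variance of
  \<open>norm X\<close>.\<close>

lemma (in prob_space) norm_expectation_squared_le: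
  fixes X :: "'a \<Rightarrow> 'b::{banach, second_countable_topology}"
  assumes X [measurable]: "X \<in> borel_measurable M" and int: "integrable M (\<lambda>\<omega>. (norm (X \<omega>))\<^sup>2)"
  shows "integrable M X" and "(norm (\<integral>\<omega>. X \<omega> \<partial>M))\<^sup>2 \<le> (\<integral>\<omega>. (norm (X \<omega>))\<^sup>2 \<partial>M)"
proof -
  have *: "integrable M (\<lambda>\<omega>. norm (X \<omega>))"
    by (rule square_integrable_imp_integrable[OF _ int]) simp
  then show "integrable M X" by (simp add: integrable_norm_iff)
  have "norm (\<integral>\<omega>. X \<omega> \<partial>M) \<le> (\<integral>\<omega>. norm (X \<omega>) \<partial>M)" by simp
  then have "(norm (\<integral>\<omega>. X \<omega> \<partial>M))\<^sup>2 \<le> (\<integral>\<omega>. norm (X \<omega>) \<partial>M)\<^sup>2" by (intro power_mono) auto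
  also have "\<dots> \<le> (\<integral>\<omega>. (norm (X \<omega>))\<^sup>2 \<partial>M)"
    using variance_eq[OF * int] variance_positive[of "\<lambda>\<omega>. norm (X \<omega>)"] by simp
  finally show "(norm (\<integral>\<omega>. X \<omega> \<partial>M))\<^sup>2 \<le> (\<integral>\<omega>. (norm (X \<omega>))\<^sup>2 \<partial>M)" .
qed

text \<open>If \<open>\<phi>\<close> is not integrable, the left side is 0 by convention. This
  allows \<open>g_var\<close> and its mean over the directions to be bounded without an
  integrability argument.\<close>

lemma ennreal_integral_le_nn_integral:
  fixes \<phi> :: "'a \<Rightarrow> real"
  assumes "\<And>x. 0 \<le> \<phi> x"
  shows "ennreal (\<integral>x. \<phi> x \<partial>M) \<le> (\<integral>\<^sup>+x. ennreal (\<phi> x) \<partial>M)"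
proof (cases "integrable M \<phi>")
  case True
  then show ?thesis using assms by (simp add: nn_integral_eq_integral)
qed (simp add: not_integrable_integral_eq)

section \<open>Reflection-invariant distributions\<close>

text \<open>The Householder reflection if \<open>v\<close> is a unit vector. Invariance under these
  maps stands in for invariance under the whole orthogonal group: they suffice to carry any unit
  vector to any other and to reverse the sign of \<open>u \<bullet> v\<close>.\<close>

definition reflect :: "'a::euclidean_space \<Rightarrow> 'a \<Rightarrow> 'a" where
  "reflect v u = u - (2 * (u \<bullet> v)) *\<^sub>R v"

lemma reflect_measurable [measurable]: "reflect v \<in> borel_measurable borel"
  unfolding reflect_def by measurable

lemma reflect_add: "reflect v (x + y) = reflect v x + reflect v y"
  by (simp add: reflect_def inner_add_left algebra_simps)

lemma reflect_scaleR: "reflect v (c *\<^sub>R x) = c *\<^sub>R reflect v x"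
  by (simp add: reflect_def algebra_simps)

lemma reflect_inner:
  assumes "norm v = 1"
  shows "reflect v x \<bullet> reflect v y = x \<bullet> y"
proof -
  have "v \<bullet> v = 1" using assms by (simp add: dot_square_norm)
  then show ?thesis
    by (simp add: reflect_def inner_diff_left inner_diff_right inner_commute algebra_simps)
qed

lemma norm_reflect: "norm v = 1 \<Longrightarrow> norm (reflect v x) = norm x"
  by (simp only: norm_eq_sqrt_inner reflect_inner)

lemma reflect_inner_axis: "norm v = 1 \<Longrightarrow> reflect v x \<bullet> v = - (x \<bullet> v)"
  by (simp add: reflect_def inner_diff_left dot_square_norm)

lemma reflect_reflect: "norm v = 1 \<Longrightarrow> reflect v (reflect v x) = x"
  by (simp add: reflect_def inner_diff_left dot_square_norm)

text \<open>The mirror is the hyperplane bisecting \<open>v\<close> and \<open>w\<close>. For unit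
  vectors \<open>2 * (v \<bullet> (v - w))\<close> equals the squared distance, so exactly
  \<open>v - w\<close> is subtracted. The case \<open>v = w\<close> stays separate because the
  difference then has no direction.\<close>

lemma obtain_reflection:
  fixes v w :: "'a::euclidean_space"
  assumes v: "norm v = 1" and w: "norm w = 1"
  obtains r where "norm r = 1" "reflect r v = w \<or> v = w"
proof (cases "v = w")
  case True
  then show ?thesis using that v by blast
next
  case False
  define r where "r = (v - w) /\<^sub>R norm (v - w)"
  have "(norm (v - w))\<^sup>2 = 2 - 2 * (v \<bullet> w)"
    using v w by (simp add: dot_norm_neg field_simps)
  moreover have "2 * (v \<bullet> (v - w)) = 2 - 2 * (v \<bullet> w)"
    using v by (simp add: inner_diff_right dot_square_norm)
  moreover have "(2 * (v \<bullet> r)) *\<^sub>R r = (2 * (v \<bullet> (v - w)) / (norm (v - w))\<^sup>2) *\<^sub>R (v - w)"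
    by (simp add: r_def power2_eq_square divide_inverse algebra_simps)
  ultimately have "(2 * (v \<bullet> r)) *\<^sub>R r = ((norm (v - w))\<^sup>2 / (norm (v - w))\<^sup>2) *\<^sub>R (v - w)"
    by simp
  then have "(2 * (v \<bullet> r)) *\<^sub>R r = v - w" using False by simp
  then have "reflect r v = w" by (simp add: reflect_def)
  moreover have "norm r = 1" using False by (simp add: r_def)
  ultimately show ?thesis using that by blast
qed

text \<open>Uniqueness of translation-invariant measures, by Fubini's theorem: both sides of the
  conclusion are the integral of \<open>indicator A x * indicator B (x + y)\<close> over \<open>\<mu> \<Otimes> lborel\<close>.\<close>

lemma translation_invariant_product:
  fixes \<mu> :: "'a::euclidean_space measure"
  assumes sf: "sigma_finite_measure \<mu>" and sets_\<mu> [measurable_cong]: "sets \<mu> = sets borel"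
    and inv: "\<And>c. distr \<mu> borel (\<lambda>x. x + c) = \<mu>"
    and A [measurable]: "A \<in> sets borel" and B [measurable]: "B \<in> sets borel"
  shows "emeasure \<mu> A * emeasure lborel B = emeasure lborel A * emeasure \<mu> B"
proof -
  interpret \<mu>: sigma_finite_measure \<mu> by (rule sf)
  interpret pair_sigma_finite \<mu> lborel ..
  have "emeasure \<mu> A * emeasure lborel B = (\<integral>\<^sup>+x. indicator A x * emeasure lborel B \<partial>\<mu>)"
    by (simp add: nn_integral_multc)
  also have "\<dots> = (\<integral>\<^sup>+x. \<integral>\<^sup>+y. indicator A x * indicator B (x + y) \<partial>lborel \<partial>\<mu>)"
  proof (rule nn_integral_cong)
    fix x
    have "emeasure lborel B = (\<integral>\<^sup>+y. indicator B y \<partial>distr lborel borel ((+) x))"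
      by (simp add: lborel_distr_plus)
    also have "\<dots> = (\<integral>\<^sup>+y. indicator B (x + y) \<partial>lborel)" by (subst nn_integral_distr) auto
    finally show "indicator A x * emeasure lborel B = (\<integral>\<^sup>+y. indicator A x * indicator B (x + y) \<partial>lborel)"
      by (simp add: nn_integral_cmult)
  qed
  also have "\<dots> = (\<integral>\<^sup>+y. \<integral>\<^sup>+x. indicator A x * indicator B (x + y) \<partial>\<mu> \<partial>lborel)"
    by (rule Fubini'[symmetric]) measurable
  also have "\<dots> = (\<integral>\<^sup>+y. \<integral>\<^sup>+x. indicator A (x - y) * indicator B x \<partial>\<mu> \<partial>lborel)"
  proof (rule nn_integral_cong)
    fix y :: 'a
    have "(\<integral>\<^sup>+x. indicator A (x - y) * indicator B x \<partial>\<mu>) =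
        (\<integral>\<^sup>+x. indicator A (x - y) * indicator B x \<partial>distr \<mu> borel (\<lambda>x. x + y))"
      by (simp add: inv)
    also have "\<dots> = (\<integral>\<^sup>+x. indicator A x * indicator B (x + y) \<partial>\<mu>)"
      by (subst nn_integral_distr) auto
    finally show "(\<integral>\<^sup>+x. indicator A x * indicator B (x + y) \<partial>\<mu>) =
        (\<integral>\<^sup>+x. indicator A (x - y) * indicator B x \<partial>\<mu>)" by simp
  qed
  also have "\<dots> = (\<integral>\<^sup>+x. \<integral>\<^sup>+y. indicator A (x - y) * indicator B x \<partial>lborel \<partial>\<mu>)"
    by (rule Fubini') measurable
  also have "\<dots> = (\<integral>\<^sup>+x. emeasure lborel A * indicator B x \<partial>\<mu>)"
  proof (rule nn_integral_cong)
    fix x :: 'a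
    have "lborel = density (distr lborel borel (\<lambda>y. x + (-1) *\<^sub>R y)) (\<lambda>_. \<bar>-1::real\<bar>^DIM('a))"
      using lborel_affine[of "-1" x] by simp
    then have eq: "distr lborel borel (\<lambda>y. x - y) = lborel" by (simp add: density_1)
    have "emeasure lborel A = (\<integral>\<^sup>+y. indicator A y \<partial>distr lborel borel (\<lambda>y. x - y))"
      by (simp add: eq)
    also have "\<dots> = (\<integral>\<^sup>+y. indicator A (x - y) \<partial>lborel)" by (subst nn_integral_distr) auto
    finally show "(\<integral>\<^sup>+y. indicator A (x - y) * indicator B x \<partial>lborel) =
        emeasure lborel A * indicator B x"
      by (simp add: nn_integral_multc)
  qed
  also have "\<dots> = emeasure lborel A * emeasure \<mu> B"
    by (simp add: nn_integral_cmult)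
  finally show ?thesis .
qed

text \<open>A shift by \<open>c\<close> after the reflection is a shift by
  \<open>reflect v c\<close> before it, so the image measure is translation-invariant and therefore
  proportional to \<open>lborel\<close>. The unit ball is mapped to itself and has positive finite
  measure, which fixes the factor as 1.\<close>

lemma lborel_distr_reflect:
  fixes v :: "'a::euclidean_space"
  assumes v: "norm v = 1"
  shows "distr lborel borel (reflect v) = (lborel :: 'a measure)"
proof -
  let ?\<mu> = "distr lborel borel (reflect v) :: 'a measure" and ?B = "ball 0 1 :: 'a set"
  have inv: "distr ?\<mu> borel (\<lambda>x. x + c) = ?\<mu>" for c
  proof -
    have "distr ?\<mu> borel (\<lambda>x. x + c) = distr lborel borel (reflect v \<circ> (+) (reflect v c))"
      by (subst distr_distr) (auto simp: comp_def reflect_add reflect_reflect[OF v] add.commute)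
    also have "\<dots> = distr (distr lborel borel ((+) (reflect v c))) borel (reflect v)"
      by (subst distr_distr) auto
    finally show ?thesis by (simp add: lborel_distr_plus)
  qed
  have sf: "sigma_finite_measure ?\<mu>"
  proof (rule sigma_finite_measure.intro)
    show "\<exists>A. countable A \<and> A \<subseteq> sets ?\<mu> \<and> \<Union> A = space ?\<mu> \<and> (\<forall>a\<in>A. emeasure ?\<mu> a \<noteq> \<infinity>)"
    proof (intro exI conjI ballI)
      show "countable (range (\<lambda>n. ball 0 (real n)) :: 'a set set)" by simp
      show "\<Union> (range (\<lambda>n. ball (0::'a) (real n))) = space ?\<mu>"
        by (auto simp: dist_norm reals_Archimedean2)
      fix a :: "'a set" assume "a \<in> range (\<lambda>n. ball 0 (real n))"
      then obtain n where a: "a = ball 0 (real n)" by auto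
      have "reflect v -` a = a" using norm_reflect[OF v] by (auto simp: a)
      then have "emeasure ?\<mu> a = emeasure lborel a" by (subst emeasure_distr) (auto simp: a)
      then show "emeasure ?\<mu> a \<noteq> \<infinity>" 
        using emeasure_lborel_ball_finite[of "0::'a" "real n"] unfolding a by simp
    qed auto
  qed
  have "reflect v -` ?B = ?B" using norm_reflect[OF v] by auto
  then have ball: "emeasure ?\<mu> ?B = emeasure lborel ?B" by (subst emeasure_distr) auto
  have pos: "emeasure lborel ?B \<noteq> 0"
    using content_ball_pos[of 1 "0::'a"] by (auto simp: measure_def)
  have fin: "emeasure lborel ?B \<noteq> top" using emeasure_lborel_ball_finite[of "0::'a" 1] by simp
  show ?thesis
  proof (rule measure_eqI)
    fix A :: "'a set" assume "A \<in> sets ?\<mu>"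
    then have "emeasure ?\<mu> A * emeasure lborel ?B = emeasure lborel A * emeasure lborel ?B"
      using translation_invariant_product[OF sf _ inv, of A ?B] ball by simp
    then show "emeasure ?\<mu> A = emeasure lborel A"
      using pos fin by (metis ennreal_mult_divide_eq mult.commute)
  qed simp
qed

text \<open>The common ground of the Gaussian and the sphere. The sixth moment is required because
  the squared Taylor remainder is of order \<open>norm u ^ 4\<close> and is multiplied by another
  \<open>(norm u)\<^sup>2\<close> from the direction itself.\<close>

locale isotropic = prob_space R
  for R :: "'a::euclidean_space measure" +
  assumes sets_R [measurable_cong]: "sets R = sets borel"
    and reflection_invariant: "norm v = 1 \<Longrightarrow> distr R borel (reflect v) = R"
    and sixth_moment: "integrable R (\<lambda>u. (norm u) ^ 6)"
begin

lemma integrable_norm_power: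
  assumes "k \<le> 6"
  shows "integrable R (\<lambda>u. (norm u) ^ k)"
proof (rule Bochner_Integration.integrable_bound)
  show "integrable R (\<lambda>u. 1 + (norm u) ^ 6)" using sixth_moment by simp
  have "t ^ k \<le> 1 + t ^ 6" if "0 \<le> t" for t :: real
  proof (cases "t \<le> 1")
    case True
    then show ?thesis using that by (intro add_increasing2) (auto intro: power_le_one)
  next
    case False
    then have "t ^ k \<le> t ^ 6" using assms by (intro power_increasing) auto
    then show ?thesis by simp
  qed
  then show "AE u in R. norm ((norm u) ^ k) \<le> norm (1 + (norm u) ^ 6)" by simp
qed measurable

lemma integral_reflect:
  fixes \<phi> :: "'a \<Rightarrow> 'b::{banach, second_countable_topology}"
  assumes "norm v = 1" and [measurable]: "\<phi> \<in> borel_measurable borel"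
  shows "(\<integral>u. \<phi> (reflect v u) \<partial>R) = (\<integral>u. \<phi> u \<partial>R)"
proof -
  have "(\<integral>u. \<phi> u \<partial>R) = (\<integral>u. \<phi> u \<partial>distr R borel (reflect v))"
    using assms by (simp add: reflection_invariant)
  also have "\<dots> = (\<integral>u. \<phi> (reflect v u) \<partial>R)" by (subst integral_distr) auto
  finally show ?thesis by simp
qed

lemma integrable_directional_moment:
  assumes "k \<le> 4"
  shows "integrable R (\<lambda>u. (norm u) ^ k * (u \<bullet> v)\<^sup>2)"
proof (rule Bochner_Integration.integrable_bound)
  show "integrable R (\<lambda>u. (norm v)\<^sup>2 * (norm u) ^ (k + 2))"
    using assms by (intro integrable_mult_right integrable_norm_power) simp
  have "(norm u) ^ k * (u \<bullet> v)\<^sup>2 \<le> (norm v)\<^sup>2 * (norm u) ^ (k + 2)" for u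
  proof -
    have "(u \<bullet> v)\<^sup>2 \<le> (norm u * norm v)\<^sup>2"
      using Cauchy_Schwarz_ineq2[of u v] by (intro abs_le_square_iff[THEN iffD1]) simp
    then have "(norm u) ^ k * (u \<bullet> v)\<^sup>2 \<le> (norm u) ^ k * (norm u * norm v)\<^sup>2"
      by (intro mult_left_mono) auto
    then show ?thesis by (simp add: power_mult_distrib power_add power2_eq_square algebra_simps)
  qed
  then show "AE u in R. norm ((norm u) ^ k * (u \<bullet> v)\<^sup>2) \<le> norm ((norm v)\<^sup>2 * (norm u) ^ (k + 2))"
    by simp
qed measurable

text \<open>By reflections the left side is the same for all unit vectors. Summed over an
  orthonormal basis it gives the moment of order \<open>k + 2\<close>, so each direction carries a
  share of \<open>1 / DIM('a)\<close>; homogeneity handles general \<open>v\<close>.\<close>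

lemma directional_moment:
  assumes "k \<le> 4"
  shows "(\<integral>u. (norm u) ^ k * (u \<bullet> v)\<^sup>2 \<partial>R) = (norm v)\<^sup>2 * (\<integral>u. (norm u) ^ (k + 2) \<partial>R) / DIM('a)"
proof -
  define I where "I v = (\<integral>u. (norm u) ^ k * (u \<bullet> v)\<^sup>2 \<partial>R)" for v
  have I_eq: "I v = I w" if v: "norm v = 1" and w: "norm w = 1" for v w
  proof -
    obtain r where r: "norm r = 1" "reflect r v = w \<or> v = w" using obtain_reflection[OF v w] .
    have "reflect r u \<bullet> v = u \<bullet> reflect r v" for u
      using reflect_inner[OF r(1), of u "reflect r v"] reflect_reflect[OF r(1), of v] by simp
    then have "I v = I (reflect r v)"
      using integral_reflect[OF r(1), of "\<lambda>u. (norm u) ^ k * (u \<bullet> v)\<^sup>2"] norm_reflect[OF r(1)]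
      by (simp add: I_def)
    then show ?thesis using r(2) by auto
  qed
  have unit: "DIM('a) * I v = (\<integral>u. (norm u) ^ (k + 2) \<partial>R)" if "norm v = 1" for v
  proof -
    have "DIM('a) * I v = (\<Sum>b\<in>(Basis :: 'a set). I v)" by simp
    also have "\<dots> = (\<Sum>b\<in>Basis. I b)"
      by (intro sum.cong refl I_eq that) simp
    also have "\<dots> = (\<integral>u. (\<Sum>b\<in>Basis. (norm u) ^ k * (u \<bullet> b)\<^sup>2) \<partial>R)"
      unfolding I_def using integrable_directional_moment[OF assms]
      by (intro Bochner_Integration.integral_sum[symmetric])
    also have "\<dots> = (\<integral>u. (norm u) ^ (k + 2) \<partial>R)"
    proof (rule Bochner_Integration.integral_cong[OF refl])
      fix u :: 'a
      have "(\<Sum>b\<in>Basis. (u \<bullet> b)\<^sup>2) = (norm u)\<^sup>2"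
        unfolding power2_norm_eq_inner by (simp add: euclidean_inner[of u u] power2_eq_square)
      then show "(\<Sum>b\<in>Basis. (norm u) ^ k * (u \<bullet> b)\<^sup>2) = (norm u) ^ (k + 2)"
        by (simp add: sum_distrib_left[symmetric] power_add power2_eq_square)
    qed
    finally show ?thesis .
  qed
  show ?thesis
  proof (cases "v = 0")
    case False
    have "I (v /\<^sub>R norm v) = I v / (norm v)\<^sup>2"
      by (simp add: I_def power_divide divide_inverse power_mult_distrib mult.assoc[symmetric]
          flip: Bochner_Integration.integral_mult_left_zero) (simp add: mult_ac power_inverse)
    then have "I v = (norm v)\<^sup>2 * (DIM('a) * I (v /\<^sub>R norm v)) / DIM('a)"
      using False by simp
    also have "DIM('a) * I (v /\<^sub>R norm v) = (\<integral>u. (norm u) ^ (k + 2) \<partial>R)"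
      using False by (intro unit) simp
    finally have "I v = (norm v)\<^sup>2 * (\<integral>u. (norm u) ^ (k + 2) \<partial>R) / DIM('a)" .
    then show ?thesis by (simp add: I_def)
  qed simp
qed

text \<open>The condition on \<open>c\<close> normalizes the second moment matrix of
  \<open>u\<close> to the identity, so a linear \<open>F\<close> has no bias. For the general case,
  the bias is tested against a unit vector \<open>v\<close>; the mirrored remainder is at most of
  order \<open>norm u * \<bar>u \<bullet> v\<bar>\<close>, and the weight
  \<open>u \<bullet> v\<close> makes it a directional moment with \<open>k = 1\<close>.\<close>

lemma smoothed_gradient_bias:
  fixes F :: "'a \<Rightarrow> real"
  assumes der: "\<And>y. GDERIV F y :> F' y" and lip: "L-lipschitz_on UNIV F'"
    and \<nu>: "0 < \<nu>" and c: "0 \<le> c" "c * (\<integral>u. (norm u)\<^sup>2 \<partial>R) = DIM('a)"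
  shows "integrable R (\<lambda>u. ((F (x + \<nu> *\<^sub>R u) - F x) / \<nu>) *\<^sub>R u)" (is "integrable R ?au")
    and "norm (c *\<^sub>R (\<integral>u. ((F (x + \<nu> *\<^sub>R u) - F x) / \<nu>) *\<^sub>R u \<partial>R) - F' x)
           \<le> c * L * \<nu> * (\<integral>u. (norm u) ^ 3 \<partial>R) / DIM('a)"
proof -
  define a where "a u = (F (x + \<nu> *\<^sub>R u) - F x) / \<nu>" for u
  have L: "0 \<le> L" using lip by (rule lipschitz_on_nonneg)
  have "isCont F y" for y
    using der[of y] unfolding gderiv_def by (rule has_derivative_continuous)
  then have F_meas [measurable]: "F \<in> borel_measurable borel"
    by (intro borel_measurable_continuous_onI) (simp add: continuous_on_eq_continuous_at)
  have a_meas [measurable]: "a \<in> borel_measurable borel"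
    unfolding a_def by measurable
  have a_bound: "\<bar>a u\<bar> \<le> norm (F' x) * norm u + L * \<nu> / 2 * (norm u)\<^sup>2" for u
  proof -
    have "\<bar>F (x + \<nu> *\<^sub>R u) - F x\<bar> \<le> \<bar>F' x \<bullet> (\<nu> *\<^sub>R u)\<bar> + L / 2 * (norm (\<nu> *\<^sub>R u))\<^sup>2"
      using lipschitz_gradient_taylor[OF der lip, of x "\<nu> *\<^sub>R u"] by linarith
    also have "\<dots> \<le> norm (F' x) * norm (\<nu> *\<^sub>R u) + L / 2 * (norm (\<nu> *\<^sub>R u))\<^sup>2"
      using Cauchy_Schwarz_ineq2[of "F' x" "\<nu> *\<^sub>R u"] by simp
    also have "\<dots> = \<nu> * (norm (F' x) * norm u + L * \<nu> / 2 * (norm u)\<^sup>2)"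
      using \<nu> by (simp add: power2_eq_square algebra_simps)
    finally show ?thesis using \<nu> by (simp add: a_def pos_divide_le_eq mult.commute)
  qed
  have int_au: "integrable R (\<lambda>u. a u *\<^sub>R u)"
  proof (rule Bochner_Integration.integrable_bound)
    show "integrable R (\<lambda>u. norm (F' x) * (norm u)\<^sup>2 + L * \<nu> / 2 * (norm u) ^ 3)"
      by (intro Bochner_Integration.integrable_add integrable_mult_right integrable_norm_power) auto
    have "norm (a u *\<^sub>R u) \<le> norm (F' x) * (norm u)\<^sup>2 + L * \<nu> / 2 * (norm u) ^ 3" for u
      using mult_right_mono[OF a_bound[of u], of "norm u"]
      by (simp add: power2_eq_square power3_eq_cube algebra_simps)
    then show "AE u in R. norm (a u *\<^sub>R u) \<le> norm (norm (F' x) * (norm u)\<^sup>2 + L * \<nu> / 2 * (norm u) ^ 3)"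
      using L \<nu> by (simp add: abs_of_nonneg)
  qed measurable
  then show "integrable R ?au" by (simp add: a_def)
  let ?G = "c *\<^sub>R (\<integral>u. a u *\<^sub>R u \<partial>R) - F' x"
  let ?B = "c * L * \<nu> * (\<integral>u. (norm u) ^ 3 \<partial>R) / DIM('a)"
  have dir: "\<bar>?G \<bullet> v\<bar> \<le> ?B" if v: "norm v = 1" for v
  proof -
    let ?r = "\<lambda>u. a u - a (reflect v u) - 2 * (u \<bullet> v) * (F' x \<bullet> v)"
    have int1: "integrable R (\<lambda>u. a u * (u \<bullet> v))"
      using integrable_inner_left[OF int_au, of v] by simp
    have int1': "integrable R (\<lambda>u. a (reflect v u) * (u \<bullet> v))"
    proof -
      have "integrable (distr R borel (reflect v)) (\<lambda>u. a u * (u \<bullet> v))"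
        using int1 reflection_invariant[OF v] by simp
      then have "integrable R (\<lambda>u. a (reflect v u) * (reflect v u \<bullet> v))"
        by (subst (asm) integrable_distr_eq) auto
      then show ?thesis by (simp add: reflect_inner_axis[OF v])
    qed
    have int2: "integrable R (\<lambda>u. (u \<bullet> v)\<^sup>2)"
      using integrable_directional_moment[of 0 v] by simp
    have one: "c * (\<integral>u. (u \<bullet> v)\<^sup>2 \<partial>R) = 1"
    proof -
      have "(\<integral>u. (u \<bullet> v)\<^sup>2 \<partial>R) = (\<integral>u. (norm u)\<^sup>2 \<partial>R) / DIM('a)"
        using directional_moment[of 0 v] v by (simp add: power2_eq_square)
      then show ?thesis using c(2) by simp
    qed
    \<comment> \<open>The reflection reverses the sign of \<open>u \<bullet> v\<close>, so
      subtracting the mirrored quotient doubles the contribution instead of cancelling it. This is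
      the 2 in \<open>eq\<close>.\<close>
    have sym: "(\<integral>u. a (reflect v u) * (u \<bullet> v) \<partial>R) = - (\<integral>u. a u * (u \<bullet> v) \<partial>R)"
      using integral_reflect[OF v, of "\<lambda>u. a u * (u \<bullet> v)"] by (simp add: reflect_inner_axis[OF v])
    have "(\<integral>u. ?r u * (u \<bullet> v) \<partial>R) =
        (\<integral>u. a u * (u \<bullet> v) - a (reflect v u) * (u \<bullet> v) - 2 * (F' x \<bullet> v) * (u \<bullet> v)\<^sup>2 \<partial>R)"
      by (rule Bochner_Integration.integral_cong) (auto simp: power2_eq_square algebra_simps)
    also have "\<dots> = 2 * (\<integral>u. a u * (u \<bullet> v) \<partial>R) - 2 * (F' x \<bullet> v) * (\<integral>u. (u \<bullet> v)\<^sup>2 \<partial>R)"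
      using int1 int1' int2 by (simp add: sym)
    finally have int_r: "(\<integral>u. ?r u * (u \<bullet> v) \<partial>R) =
        2 * (\<integral>u. a u * (u \<bullet> v) \<partial>R) - 2 * (F' x \<bullet> v) * (\<integral>u. (u \<bullet> v)\<^sup>2 \<partial>R)" .
    have "c * (\<integral>u. ?r u * (u \<bullet> v) \<partial>R) =
        2 * (c * (\<integral>u. a u * (u \<bullet> v) \<partial>R)) - 2 * (F' x \<bullet> v) * (c * (\<integral>u. (u \<bullet> v)\<^sup>2 \<partial>R))"
      unfolding int_r by (simp add: algebra_simps)
    then have eq: "2 * (?G \<bullet> v) = c * (\<integral>u. ?r u * (u \<bullet> v) \<partial>R)"
      unfolding one using integral_inner_left[of v R "\<lambda>u. a u *\<^sub>R u"] int_au
      by (simp add: inner_diff_left)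
    have r_bound: "norm (?r u * (u \<bullet> v)) \<le> 2 * L * \<nu> * ((norm u) ^ 1 * (u \<bullet> v)\<^sup>2)" for u
    proof -
      have "?r u = (F (x + \<nu> *\<^sub>R u) - F (x + (\<nu> *\<^sub>R u - (2 * ((\<nu> *\<^sub>R u) \<bullet> v)) *\<^sub>R v))
            - 2 * ((\<nu> *\<^sub>R u) \<bullet> v) * (F' x \<bullet> v)) / \<nu>"
        using \<nu> by (simp add: a_def reflect_def scaleR_diff_right field_simps)
      then have "\<bar>?r u\<bar> \<le> (2 * L * norm (\<nu> *\<^sub>R u) * \<bar>(\<nu> *\<^sub>R u) \<bullet> v\<bar>) / \<nu>"
        using divide_right_mono[OF lipschitz_gradient_reflection[OF der lip v, of x "\<nu> *\<^sub>R u"], of \<nu>] \<nu>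
        by (simp only: abs_divide) simp
      also have "\<dots> = 2 * L * \<nu> * norm u * \<bar>u \<bullet> v\<bar>" using \<nu> by (simp add: abs_mult)
      finally have "\<bar>?r u\<bar> * \<bar>u \<bullet> v\<bar> \<le> 2 * L * \<nu> * norm u * \<bar>u \<bullet> v\<bar> * \<bar>u \<bullet> v\<bar>"
        by (rule mult_right_mono) simp
      then show ?thesis by (simp add: abs_mult power2_eq_square mult.assoc)
    qed
    have int_r': "integrable R (\<lambda>u. ?r u * (u \<bullet> v))"
    proof -
      have "integrable R (\<lambda>u. a u * (u \<bullet> v) - a (reflect v u) * (u \<bullet> v) - 2 * (F' x \<bullet> v) * (u \<bullet> v)\<^sup>2)"
        using int1 int1' int2 by simp
      then show ?thesis by (simp add: power2_eq_square algebra_simps)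
    qed
    have "norm (\<integral>u. ?r u * (u \<bullet> v) \<partial>R) \<le> (\<integral>u. 2 * L * \<nu> * ((norm u) ^ 1 * (u \<bullet> v)\<^sup>2) \<partial>R)"
      by (intro Bochner_Integration.integral_norm_bound_integral int_r' r_bound
          integrable_mult_right integrable_directional_moment) simp
    also have "\<dots> = 2 * L * \<nu> * (\<integral>u. (norm u) ^ 3 \<partial>R) / DIM('a)"
      using directional_moment[of 1 v] v by (simp add: numeral_3_eq_3)
    finally have "c * norm (\<integral>u. ?r u * (u \<bullet> v) \<partial>R) \<le> c * (2 * L * \<nu> * (\<integral>u. (norm u) ^ 3 \<partial>R) / DIM('a))"
      using c(1) by (rule mult_left_mono)
    moreover have "2 * \<bar>?G \<bullet> v\<bar> = c * norm (\<integral>u. ?r u * (u \<bullet> v) \<partial>R)"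
      using arg_cong[OF eq, of abs] c(1) by (simp add: abs_mult)
    moreover have "c * (2 * L * \<nu> * (\<integral>u. (norm u) ^ 3 \<partial>R) / DIM('a)) = 2 * ?B" by simp
    ultimately show ?thesis by linarith
  qed
  have "norm ?G \<le> ?B"
  proof (cases "?G = 0")
    case True
    then show ?thesis using c(1) L \<nu> by simp
  next
    case False
    \<comment> \<open>The unit vector along the bias itself turns the directional bound into a bound
      on the norm, with no loss from summing over coordinates.\<close>
    let ?v = "?G /\<^sub>R norm ?G"
    have "?G \<bullet> ?v = norm ?G" using False by (simp add: dot_square_norm power2_eq_square)
    then show ?thesis using dir[of ?v] False by simp
  qed
  then show "norm (c *\<^sub>R (\<integral>u. ((F (x + \<nu> *\<^sub>R u) - F x) / \<nu>) *\<^sub>R u \<partial>R) - F' x) \<le> ?B"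
    by (simp add: a_def)
qed

end

text \<open>Power mean inequality, from the tangent of the cube at the mean \<open>t\<close>. The
  linear terms add up to zero because \<open>t\<close> is the mean. It reduces the sixth moment of
  the norm to coordinate moments.\<close>

lemma sum_power3_le:
  fixes a :: "'i \<Rightarrow> real"
  assumes "finite I" and nn: "\<And>i. i \<in> I \<Longrightarrow> 0 \<le> a i"
  shows "(\<Sum>i\<in>I. a i) ^ 3 \<le> (card I)\<^sup>2 * (\<Sum>i\<in>I. a i ^ 3)"
proof (cases "I = {}")
  case False
  define t where "t = (\<Sum>i\<in>I. a i) / card I"
  have n: "0 < card I" using assms False by (simp add: card_gt_0_iff)
  have t: "0 \<le> t" unfolding t_def using nn by (intro divide_nonneg_nonneg sum_nonneg) auto
  have "t ^ 3 + 3 * t\<^sup>2 * (s - t) \<le> s ^ 3" if "0 \<le> s" for s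
  proof -
    have "s ^ 3 - (t ^ 3 + 3 * t\<^sup>2 * (s - t)) = (s - t)\<^sup>2 * (s + 2 * t)"
      by (simp add: power2_eq_square power3_eq_cube algebra_simps)
    moreover have "0 \<le> (s - t)\<^sup>2 * (s + 2 * t)" using that t by simp
    ultimately show ?thesis by linarith
  qed
  then have "(\<Sum>i\<in>I. t ^ 3 + 3 * t\<^sup>2 * (a i - t)) \<le> (\<Sum>i\<in>I. a i ^ 3)"
    using nn by (intro sum_mono) auto
  also have "(\<Sum>i\<in>I. t ^ 3 + 3 * t\<^sup>2 * (a i - t)) = card I * t ^ 3 + 3 * t\<^sup>2 * ((\<Sum>i\<in>I. a i) - card I * t)"
    by (simp add: sum.distrib sum_distrib_left[symmetric] sum_subtractf)
  also have "(\<Sum>i\<in>I. a i) - card I * t = 0" using n by (simp add: t_def)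
  finally have "(card I)\<^sup>2 * (card I * t ^ 3) \<le> (card I)\<^sup>2 * (\<Sum>i\<in>I. a i ^ 3)"
    by (intro mult_left_mono) auto
  moreover have "(card I)\<^sup>2 * (card I * t ^ 3) = (\<Sum>i\<in>I. a i) ^ 3"
    using n by (simp add: t_def power_divide power2_eq_square power3_eq_cube)
  ultimately show ?thesis by simp
qed simp

subsection \<open>The standard Gaussian\<close>

lemma prod_axis_Basis:
  fixes x :: "real ^ 'd"
  shows "(\<Prod>i\<in>UNIV. g (axis i 1) (x $ i)) = (\<Prod>b\<in>Basis. g b (x \<bullet> b))"
proof -
  have Basis: "(Basis :: (real ^ 'd) set) = (\<lambda>i. axis i 1) ` UNIV"
    by (auto simp: Basis_vec_def)
  have "inj (\<lambda>i. axis i (1::real) :: real ^ 'd)" by (auto simp: inj_def axis_eq_axis)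
  then show ?thesis by (simp add: Basis prod.reindex inner_axis)
qed

text \<open>The monomial is attached to a single factor of the product density, so the integral
  splits into one-dimensional ones, all but one of which equal 1.\<close>

lemma std_gaussian_moment:
  "(\<integral>\<^sup>+u. ennreal ((u $ i) ^ (2 * k)) \<partial>(std_gaussian :: (real ^ 'd) measure))
     = ennreal (fact (2 * k) / (2 ^ k * fact k))"
proof -
  define g :: "real ^ 'd \<Rightarrow> real \<Rightarrow> real" where
    "g b y = std_normal_density y * (if b = axis i 1 then y ^ (2 * k) else 1)" for b y
  have g_nn: "0 \<le> g b y" for b y by (simp add: g_def zero_le_even_power)
  have g_meas [measurable]: "g b \<in> borel_measurable borel" for b
    unfolding g_def by (cases "b = axis i 1") simp_all
  have dens: "(\<Prod>i\<in>UNIV. std_normal_density (x $ i)) * (x $ i) ^ (2 * k) = (\<Prod>b\<in>Basis. g b (x \<bullet> b))"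
    for x :: "real ^ 'd"
  proof -
    have "(\<Prod>b\<in>Basis. g b (x \<bullet> b)) = (\<Prod>j\<in>UNIV. std_normal_density (x $ j) * (if j = i then (x $ i) ^ (2 * k) else 1))"
      unfolding prod_axis_Basis[of g, symmetric] by (intro prod.cong) (auto simp: g_def axis_eq_axis)
    also have "\<dots> = (\<Prod>j\<in>UNIV. std_normal_density (x $ j)) * (x $ i) ^ (2 * k)"
      by (simp add: prod.distrib)
    finally show ?thesis by simp
  qed
  have one: "(\<integral>\<^sup>+y. ennreal (std_normal_density y) \<partial>lborel) = 1"
    using std_normal_moment_even[of 0]
    by (subst nn_integral_eq_integral) (auto simp: has_bochner_integral_iff)
  have even: "(\<integral>\<^sup>+y. ennreal (std_normal_density y * y ^ (2 * k)) \<partial>lborel)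
      = ennreal (fact (2 * k) / (2 ^ k * fact k))"
    using std_normal_moment_even[of k]
    by (subst nn_integral_eq_integral) (auto simp: has_bochner_integral_iff zero_le_even_power)
  have axis: "axis i 1 \<in> (Basis :: (real ^ 'd) set)" by (auto simp: Basis_vec_def)
  have "(\<integral>\<^sup>+u. ennreal ((u $ i) ^ (2 * k)) \<partial>(std_gaussian :: (real ^ 'd) measure))
      = (\<integral>\<^sup>+u. ennreal (\<Prod>i\<in>UNIV. std_normal_density (u $ i)) * ennreal ((u $ i) ^ (2 * k)) \<partial>lborel)"
    unfolding std_gaussian_def by (subst nn_integral_density) auto
  also have "\<dots> = (\<integral>\<^sup>+u. (\<Prod>b\<in>Basis. ennreal (g b (u \<bullet> b))) \<partial>lborel)"
    by (intro nn_integral_cong) (simp add: prod_ennreal g_nn dens[symmetric] ennreal_mult' prod_nonneg)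
  also have "\<dots> = (\<Prod>b\<in>Basis. (\<integral>\<^sup>+y. ennreal (g b y) \<partial>lborel))"
    by (subst nn_integral_lborel_prod) auto
  also have "\<dots> = (\<Prod>b\<in>(Basis :: (real ^ 'd) set). if b = axis i 1 then ennreal (fact (2 * k) / (2 ^ k * fact k)) else 1)"
    by (intro prod.cong refl) (simp add: g_def one even)
  also have "\<dots> = ennreal (fact (2 * k) / (2 ^ k * fact k))"
    using axis by simp
  finally show ?thesis .
qed

lemma std_gaussian_has_moment:
  "has_bochner_integral (std_gaussian :: (real ^ 'd) measure) (\<lambda>u. (u $ i) ^ (2 * k))
     (fact (2 * k) / (2 ^ k * fact k))"
proof (rule has_bochner_integral_nn_integral)
  show "(\<lambda>u. (u $ i) ^ (2 * k)) \<in> borel_measurable (std_gaussian :: (real ^ 'd) measure)"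
    unfolding std_gaussian_def by simp
qed (auto simp: std_gaussian_moment zero_le_even_power)

lemma norm_power2_vec: "(norm (u :: real ^ 'd))\<^sup>2 = (\<Sum>i\<in>UNIV. (u $ i)\<^sup>2)"
  unfolding power2_norm_eq_inner by (simp add: inner_vec_def power2_eq_square)

text \<open>The density is a function of \<open>norm x\<close>, so reflection invariance is
  inherited from Lebesgue measure.\<close>

lemma std_gaussian_isotropic: "isotropic (std_gaussian :: (real ^ 'd) measure)"
proof -
  let ?R = "std_gaussian :: (real ^ 'd) measure"
  have sets_R [measurable_cong]: "sets ?R = sets borel" by (simp add: std_gaussian_def)
  have "prob_space ?R"
  proof
    show "emeasure ?R (space ?R) = 1"
      \<comment> \<open>The moment of order 0, in an arbitrary coordinate, is the total
        mass.\<close>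
      using std_gaussian_moment[of undefined 0] by simp
  qed
  then interpret prob_space ?R .
  define D where "D x = (\<Prod>i\<in>UNIV. std_normal_density (x $ i))" for x :: "real ^ 'd"
  have D_meas [measurable]: "D \<in> borel_measurable borel" unfolding D_def by measurable
  have D_norm: "D x = (1 / sqrt (2 * pi)) ^ CARD('d) * exp (- (norm x)\<^sup>2 / 2)" for x
    by (simp add: D_def std_normal_density_def prod_dividef exp_sum[symmetric] norm_power2_vec
        sum_divide_distrib sum_negf power_one_over)
  have R_eq: "?R = density lborel (\<lambda>x. ennreal (D x))" by (simp add: std_gaussian_def D_def)
  have inv: "distr ?R borel (reflect v) = ?R" if v: "norm v = 1" for v
  proof (rule measure_eqI)
    fix A assume "A \<in> sets (distr ?R borel (reflect v))"
    then have A [measurable]: "A \<in> sets borel" by simp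
    have "emeasure (distr ?R borel (reflect v)) A = (\<integral>\<^sup>+u. indicator A u \<partial>distr ?R borel (reflect v))"
      by simp
    also have "\<dots> = (\<integral>\<^sup>+u. indicator A (reflect v u) \<partial>?R)"
      by (subst nn_integral_distr) auto
    also have "\<dots> = (\<integral>\<^sup>+u. ennreal (D (reflect v u)) * indicator A (reflect v u) \<partial>lborel)"
      unfolding R_eq by (subst nn_integral_density) (auto simp: D_norm norm_reflect[OF v])
    also have "\<dots> = (\<integral>\<^sup>+u. ennreal (D u) * indicator A u \<partial>distr lborel borel (reflect v))"
      by (subst nn_integral_distr) auto
    also have "\<dots> = emeasure ?R A"
      unfolding R_eq lborel_distr_reflect[OF v] by (subst emeasure_density) auto
    finally show "emeasure (distr ?R borel (reflect v)) A = emeasure ?R A" .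
  qed (simp add: sets_R)
  have "integrable ?R (\<lambda>u. (norm u) ^ 6)"
  proof (rule Bochner_Integration.integrable_bound)
    show "integrable ?R (\<lambda>u. (CARD('d))\<^sup>2 * (\<Sum>i\<in>UNIV. (u $ i) ^ (2 * 3)))"
    proof (intro integrable_mult_right Bochner_Integration.integrable_sum)
      show "integrable ?R (\<lambda>u. (u $ i) ^ (2 * 3))" for i
        using std_gaussian_has_moment[of i 3] by (simp add: has_bochner_integral_iff)
    qed
    have "(norm u) ^ 6 \<le> (CARD('d))\<^sup>2 * (\<Sum>i\<in>UNIV. (u $ i) ^ (2 * 3))" for u :: "real ^ 'd"
      using sum_power3_le[of "UNIV :: 'd set" "\<lambda>i. (u $ i)\<^sup>2"]
      unfolding norm_power2_vec[symmetric] power_mult[symmetric] by simp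
    then show "AE u in ?R. norm ((norm u) ^ 6) \<le> norm ((CARD('d))\<^sup>2 * (\<Sum>i\<in>UNIV. (u $ i) ^ (2 * 3)))"
      by (intro AE_I2) (force intro: order_trans[OF _ abs_ge_self])
  qed measurable
  then show ?thesis using inv sets_R by unfold_locales auto
qed

text \<open>The coordinate moments 1, 3, 15 enter through power mean inequalities, which keep the
  right powers of the dimension at the price of upper bounds instead of exact values.\<close>

lemma std_gaussian_norm_moments:
  fixes R :: "(real ^ 'd) measure"
  defines "R \<equiv> std_gaussian"
  shows "(\<integral>u. (norm u)\<^sup>2 \<partial>R) = real CARD('d)"
    and "(\<integral>u. (norm u) ^ 3 \<partial>R) \<le> real CARD('d) * sqrt (3 * real CARD('d))"
    and "(\<integral>u. (norm u) ^ 4 \<partial>R) \<le> 3 * (real CARD('d))\<^sup>2"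
    and "(\<integral>u. (norm u) ^ 6 \<partial>R) \<le> 15 * real CARD('d) ^ 3"
proof -
  let ?d = "real CARD('d)"
  interpret isotropic R unfolding R_def by (rule std_gaussian_isotropic)
  have m: "integrable R (\<lambda>u. (u $ i) ^ (2 * k))"
      "(\<integral>u. (u $ i) ^ (2 * k) \<partial>R) = fact (2 * k) / (2 ^ k * fact k)" for i k
    using std_gaussian_has_moment[of i k] by (auto simp: R_def has_bochner_integral_iff)
  have m2: "(\<integral>u. (u $ i)\<^sup>2 \<partial>R) = 1" for i using m(2)[of i 1] by simp
  have m4: "(\<integral>u. (u $ i) ^ 4 \<partial>R) = 3" for i using m(2)[of i 2] by (simp add: fact_numeral)
  have m6: "(\<integral>u. (u $ i) ^ 6 \<partial>R) = 15" for i using m(2)[of i 3] by (simp add: fact_numeral)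
  show E2: "(\<integral>u. (norm u)\<^sup>2 \<partial>R) = ?d"
    unfolding norm_power2_vec using m(1)[of _ 1] m2 by simp
  have "(\<integral>u. (norm u) ^ 4 \<partial>R) \<le> (\<integral>u. ?d * (\<Sum>i\<in>UNIV. (u $ i) ^ 4) \<partial>R)"
  proof (rule integral_mono)
    show "(norm u) ^ 4 \<le> ?d * (\<Sum>i\<in>UNIV. (u $ i) ^ 4)" for u :: "real ^ 'd"
      using sum_squared_le_sum_of_squares[of "\<lambda>i. (u $ i)\<^sup>2" UNIV]
      unfolding norm_power2_vec[symmetric] power_mult[symmetric] by (simp add: mult.commute)
  qed (use m(1)[of _ 2] integrable_norm_power[of 4] in auto)
  also have "\<dots> = 3 * ?d\<^sup>2" using m(1)[of _ 2] m4 by (simp add: power2_eq_square)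
  finally show E4: "(\<integral>u. (norm u) ^ 4 \<partial>R) \<le> 3 * ?d\<^sup>2" .
  have "(\<integral>u. (norm u) ^ 6 \<partial>R) \<le> (\<integral>u. ?d\<^sup>2 * (\<Sum>i\<in>UNIV. (u $ i) ^ 6) \<partial>R)"
  proof (rule integral_mono)
    show "(norm u) ^ 6 \<le> ?d\<^sup>2 * (\<Sum>i\<in>UNIV. (u $ i) ^ 6)" for u :: "real ^ 'd"
      using sum_power3_le[of "UNIV :: 'd set" "\<lambda>i. (u $ i)\<^sup>2"]
      unfolding norm_power2_vec[symmetric] power_mult[symmetric] by simp
  qed (use m(1)[of _ 3] integrable_norm_power[of 6] in auto)
  also have "\<dots> = 15 * ?d ^ 3" using m(1)[of _ 3] m6 by (simp add: power2_eq_square power3_eq_cube)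
  finally show "(\<integral>u. (norm u) ^ 6 \<partial>R) \<le> 15 * ?d ^ 3" .
  \<comment> \<open>Interpolation between the second and the fourth moment; this \<open>t\<close>
    minimizes \<open>t / 2 * d + 3 * d\<^sup>2 / (2 * t)\<close>. Its square becomes the bias
    coefficient \<open>3 * d\<close>.\<close>
  define t where "t = sqrt (3 * ?d)"
  have t: "0 < t" "t\<^sup>2 = 3 * ?d" by (simp_all add: t_def)
  have "(\<integral>u. (norm u) ^ 3 \<partial>R) \<le> (\<integral>u. t / 2 * (norm u)\<^sup>2 + 1 / (2 * t) * (norm u) ^ 4 \<partial>R)"
  proof (rule integral_mono)
    show "(norm u) ^ 3 \<le> t / 2 * (norm u)\<^sup>2 + 1 / (2 * t) * (norm u) ^ 4" for u :: "real ^ 'd"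
    proof -
      have "0 \<le> (norm u)\<^sup>2 * (t - norm u)\<^sup>2" by simp
      then have "2 * t * (norm u) ^ 3 \<le> t\<^sup>2 * (norm u)\<^sup>2 + (norm u) ^ 4"
        by (simp add: power2_eq_square power3_eq_cube power4_eq_xxxx algebra_simps)
      then show ?thesis using t(1) by (simp add: field_simps power2_eq_square)
    qed
  qed (use integrable_norm_power in auto)
  also have "\<dots> = t / 2 * (\<integral>u. (norm u)\<^sup>2 \<partial>R) + 1 / (2 * t) * (\<integral>u. (norm u) ^ 4 \<partial>R)"
    using integrable_norm_power[of 2] integrable_norm_power[of 4] by simp
  also have "\<dots> \<le> t / 2 * ?d + 1 / (2 * t) * (3 * ?d\<^sup>2)"
    unfolding E2 using E4 t(1) by (intro add_left_mono mult_left_mono) auto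
  also have "\<dots> = ?d * t"
    using t by (simp add: field_simps power2_eq_square)
  finally show "(\<integral>u. (norm u) ^ 3 \<partial>R) \<le> ?d * sqrt (3 * ?d)" by (simp add: t_def)
qed

subsection \<open>The uniform distribution on the sphere\<close>

text \<open>Radial projection commutes with reflections, so the invariance of the ball carries over
  to the sphere.\<close>

lemma uniform_sphere_isotropic: "isotropic (uniform_sphere :: (real ^ 'd) measure)"
  and uniform_sphere_norm: "AE u in (uniform_sphere :: (real ^ 'd) measure). norm u = 1"
proof -
  let ?U = "uniform_measure lborel (ball 0 1) :: (real ^ 'd) measure"
  let ?R = "uniform_sphere :: (real ^ 'd) measure"
  have sets_R [measurable_cong]: "sets ?R = sets borel" by (simp add: uniform_sphere_def)
  have pos: "emeasure lborel (ball (0 :: real ^ 'd) 1) \<noteq> 0"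
    using content_ball_pos[of 1 "0 :: real ^ 'd"] by (auto simp: measure_def)
  have fin: "emeasure lborel (ball (0 :: real ^ 'd) 1) \<noteq> \<infinity>"
    using emeasure_lborel_ball_finite[of "0 :: real ^ 'd" 1] by simp
  have prob_U: "prob_space ?U" using pos fin by (rule prob_space_uniform_measure)
  then have "prob_space ?R"
    unfolding uniform_sphere_def by (rule prob_space.prob_space_distr) measurable
  then interpret prob_space ?R .
  show ae: "AE u in ?R. norm u = 1"
  proof -
    \<comment> \<open>The projection sends the origin to 0, so unit norm holds only outside a null
      set.\<close>
    have "AE u in lborel. u \<noteq> (0 :: real ^ 'd)" by (rule AE_lborel_singleton)
    then have "AE u in ?U. u \<noteq> 0"
      using pos fin by (intro AE_uniform_measureI) auto
    then show ?thesis unfolding uniform_sphere_def by (subst AE_distr_iff) auto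
  qed
  have inv_U: "distr ?U borel (reflect v) = ?U" if v: "norm v = 1" for v
  proof (rule measure_eqI)
    fix A assume "A \<in> sets (distr ?U borel (reflect v))"
    then have A [measurable]: "A \<in> sets borel" by simp
    have "ball 0 1 \<inter> reflect v -` A = reflect v -` (ball 0 1 \<inter> A)"
      using norm_reflect[OF v] by auto
    then have "emeasure lborel (ball 0 1 \<inter> reflect v -` A) = emeasure (distr lborel borel (reflect v)) (ball 0 1 \<inter> A)"
      by (subst emeasure_distr) auto
    also have "\<dots> = emeasure lborel (ball 0 1 \<inter> A)" by (simp add: lborel_distr_reflect[OF v])
    finally show "emeasure (distr ?U borel (reflect v)) A = emeasure ?U A"
      using measurable_sets_borel[OF reflect_measurable A, of v]
      by (subst emeasure_distr) auto
  qed simp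
  have inv: "distr ?R borel (reflect v) = ?R" if v: "norm v = 1" for v
  proof -
    have "distr ?R borel (reflect v) = distr ?U borel ((\<lambda>x. x /\<^sub>R norm x) \<circ> reflect v)"
      unfolding uniform_sphere_def
      by (subst distr_distr) (auto simp: comp_def reflect_scaleR norm_reflect[OF v])
    also have "\<dots> = distr (distr ?U borel (reflect v)) borel (\<lambda>x. x /\<^sub>R norm x)"
      by (subst distr_distr) auto
    finally show ?thesis by (simp add: inv_U[OF v] uniform_sphere_def)
  qed
  have "integrable ?R (\<lambda>u. (norm u) ^ 6)"
    by (rule integrable_const_bound[of _ 1]) (use ae in auto)
  then show "isotropic ?R" using inv sets_R by unfold_locales auto
qed

lemma uniform_sphere_norm_moment:
  "(\<integral>u. (norm u) ^ k \<partial>(uniform_sphere :: (real ^ 'd) measure)) = 1"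
proof -
  let ?S = "uniform_sphere :: (real ^ 'd) measure"
  interpret isotropic ?S by (rule uniform_sphere_isotropic)
  have "(\<integral>u. (norm u) ^ k \<partial>?S) = (\<integral>u. 1 \<partial>?S)"
    by (rule integral_cong_AE) (use uniform_sphere_norm in auto)
  then show ?thesis by (simp add: prob_space)
qed

section \<open>Moments of the estimators\<close>

definition diff_quot :: "real \<Rightarrow> (real ^ 'd \<Rightarrow> real) \<Rightarrow> real ^ 'd \<Rightarrow> real ^ 'd \<Rightarrow> real" where
  "diff_quot \<nu> h y u = (h (y + \<nu> *\<^sub>R u) - h y) / \<nu>"

lemma grad_est_diff_quot:
  "grad_est m N \<nu> u h y = scaling m CARD('d) N *\<^sub>R (\<Sum>j<N. diff_quot \<nu> h y (u j) *\<^sub>R u j)"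
  for y :: "real ^ 'd"
  by (simp add: grad_est_def diff_quot_def)

text \<open>Linearity in the differenced function turns \<open>g_var\<close> into a second moment of
  the estimator applied to the noise \<open>f - F\<close>.\<close>

lemma grad_est_diff:
  "grad_est m N \<nu> u (\<lambda>y. h y - k y) y = grad_est m N \<nu> u h y - grad_est m N \<nu> u k y"
  unfolding grad_est_def scaleR_diff_right[symmetric] sum_subtractf[symmetric] scaleR_diff_left[symmetric]
  by (intro arg_cong2[where f = scaleR] sum.cong refl) (simp add: add_divide_distrib diff_divide_distrib)

lemma diff_quot_approx:
  assumes taylor: "\<And>w. \<bar>h (y + w) - h y - D \<bullet> w\<bar> \<le> C * (norm w)\<^sup>2" and \<nu>: "0 < \<nu>"
  shows "\<bar>diff_quot \<nu> h y u - D \<bullet> u\<bar> \<le> C * \<nu> * (norm u)\<^sup>2"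
proof -
  have "diff_quot \<nu> h y u - D \<bullet> u = (h (y + \<nu> *\<^sub>R u) - h y - D \<bullet> (\<nu> *\<^sub>R u)) / \<nu>"
    using \<nu> by (simp add: diff_quot_def diff_divide_distrib)
  then have "\<bar>diff_quot \<nu> h y u - D \<bullet> u\<bar> = \<bar>h (y + \<nu> *\<^sub>R u) - h y - D \<bullet> (\<nu> *\<^sub>R u)\<bar> / \<nu>"
    using \<nu> by simp
  also have "\<dots> \<le> (C * (norm (\<nu> *\<^sub>R u))\<^sup>2) / \<nu>"
    using \<nu> by (intro divide_right_mono taylor) simp
  also have "\<dots> = C * \<nu> * (norm u)\<^sup>2" using \<nu> by (simp add: power2_eq_square)
  finally show ?thesis .
qed

text \<open>It is used with \<open>C = LF / 2\<close> for \<open>F\<close> itself and with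
  \<open>C = Lf\<close> for the noise.\<close>

lemma diff_quot_square_le:
  assumes taylor: "\<And>w. \<bar>h (y + w) - h y - D \<bullet> w\<bar> \<le> C * (norm w)\<^sup>2" and \<nu>: "0 < \<nu>"
  shows "(diff_quot \<nu> h y u)\<^sup>2 \<le> 2 * (u \<bullet> D)\<^sup>2 + 2 * C\<^sup>2 * \<nu>\<^sup>2 * (norm u) ^ 4"
proof -
  define a b where "a = D \<bullet> u" and "b = diff_quot \<nu> h y u - D \<bullet> u"
  have "\<bar>b\<bar> \<le> C * \<nu> * (norm u)\<^sup>2" unfolding b_def by (rule diff_quot_approx[OF assms])
  then have "b\<^sup>2 \<le> (C * \<nu> * (norm u)\<^sup>2)\<^sup>2"
    by (metis abs_ge_zero power2_abs power_mono)
  moreover have "0 \<le> (a - b)\<^sup>2" by simp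
  then have "(a + b)\<^sup>2 \<le> 2 * a\<^sup>2 + 2 * b\<^sup>2" by (simp add: power2_eq_square algebra_simps)
  moreover have "diff_quot \<nu> h y u = a + b" by (simp add: a_def b_def)
  ultimately show ?thesis
    by (simp add: a_def inner_commute power_mult_distrib flip: power_mult)
qed

lemma norm_sum_squared_le:
  fixes v :: "'i \<Rightarrow> 'b::real_normed_vector"
  shows "(norm (\<Sum>i\<in>I. v i))\<^sup>2 \<le> card I * (\<Sum>i\<in>I. (norm (v i))\<^sup>2)"
proof -
  have "(norm (\<Sum>i\<in>I. v i))\<^sup>2 \<le> (\<Sum>i\<in>I. norm (v i))\<^sup>2"
    by (intro power_mono norm_sum) simp
  also have "\<dots> \<le> card I * (\<Sum>i\<in>I. (norm (v i))\<^sup>2)"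
    using sum_squared_le_sum_of_squares[of "\<lambda>i. norm (v i)" I] by (simp add: mult.commute)
  finally show ?thesis .
qed

section \<open>Measurability, the noise \<open>f - F\<close>, and estimators with isotropic
  directions\<close>

context stochastic_problem
begin

lemma f_continuous: "\<zeta> \<in> space P \<Longrightarrow> continuous_on UNIV (\<lambda>y. f y \<zeta>)"
  using f_gradient unfolding gderiv_def
  by (auto simp: continuous_on_eq_continuous_at intro: has_derivative_continuous)

lemma F_continuous: "continuous_on UNIV F"
  using F_gradient unfolding gderiv_def
  by (auto simp: continuous_on_eq_continuous_at intro: has_derivative_continuous)

lemma F_measurable [measurable]: "F \<in> borel_measurable borel"
  by (rule borel_measurable_continuous_onI[OF F_continuous])

lemma F'_measurable [measurable]: "F' \<in> borel_measurable borel"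
  by (rule borel_measurable_continuous_onI[OF F'_continuous])

lemma f_measurable: "f y \<in> borel_measurable P"
  using f_integrable by auto

lemma f_measurable_compose [measurable (raw)]:
  assumes "g \<in> M \<rightarrow>\<^sub>M borel" and "k \<in> M \<rightarrow>\<^sub>M P"
  shows "(\<lambda>\<omega>. f (g \<omega>) (k \<omega>)) \<in> borel_measurable M"
proof -
  have "(\<lambda>(y, \<zeta>). f y \<zeta>) \<in> borel_measurable (borel \<Otimes>\<^sub>M P)"
    by (rule caratheodory_measurable[OF f_measurable f_continuous])
  from measurable_compose[OF measurable_Pair[OF assms] this] show ?thesis by simp
qed

text \<open>Each component is a limit of difference quotients of \<open>f\<close> with step
  \<open>inverse (real (Suc n))\<close>.\<close>

lemma f'_measurable [measurable]: "f' y \<in> borel_measurable P"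
proof (rule borel_measurable_euclidean_space[THEN iffD2], rule ballI)
  fix b :: "real ^ 'd"
  have lim: "(\<lambda>n. (f (y + inverse (real (Suc n)) *\<^sub>R b) \<zeta> - f y \<zeta>) / inverse (real (Suc n)))
      \<longlonglongrightarrow> f' y \<zeta> \<bullet> b" if "\<zeta> \<in> space P" for \<zeta>
  proof -
    have "((\<lambda>t. f (y + t *\<^sub>R b) \<zeta>) has_real_derivative f' (y + 0 *\<^sub>R b) \<zeta> \<bullet> b) (at 0)"
      by (rule gderiv_along_line) (rule f_gradient[OF that])
    then have "(\<lambda>t. (f (y + t *\<^sub>R b) \<zeta> - f y \<zeta>) / t) \<midarrow>0\<rightarrow> f' y \<zeta> \<bullet> b"
      by (simp add: DERIV_def)
    then show ?thesis
      using LIMSEQ_inverse_real_of_nat unfolding LIMSEQ_SEQ_conv[symmetric] by auto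
  qed
  show "(\<lambda>\<zeta>. f' y \<zeta> \<bullet> b) \<in> borel_measurable P"
    by (rule borel_measurable_LIMSEQ_real[OF lim]) measurable
qed

lemma g_dir_eq: "g_dir P f m N \<nu> u y = grad_est m N \<nu> u F y"
proof -
  have "integrable P (\<lambda>\<zeta>. ((f (y + \<nu> *\<^sub>R u j) \<zeta> - f y \<zeta>) / \<nu>) *\<^sub>R u j)" for j
    by (intro integrable_scaleR_left Bochner_Integration.integrable_divide Bochner_Integration.integrable_diff f_integrable)
  moreover have "(\<integral>\<zeta>. ((f (y + \<nu> *\<^sub>R u j) \<zeta> - f y \<zeta>) / \<nu>) *\<^sub>R u j \<partial>P)
      = ((F (y + \<nu> *\<^sub>R u j) - F y) / \<nu>) *\<^sub>R u j" for j
    by (subst integral_scaleR_left) (simp_all add: F_eq f_integrable)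
  ultimately show ?thesis
    unfolding g_dir_def grad_est_def by (subst integral_scaleR_right) (simp add: Bochner_Integration.integral_sum)
qed

text \<open>The remainders of \<open>f\<close> and \<open>F\<close> contribute \<open>Lf / 2\<close>
  and \<open>LF / 2\<close>, and \<open>LF \<le> Lf\<close>.\<close>

lemma noise_taylor:
  assumes "\<zeta> \<in> space P"
  shows "\<bar>(f (y + w) \<zeta> - F (y + w)) - (f y \<zeta> - F y) - (f' y \<zeta> - F' y) \<bullet> w\<bar> \<le> Lf * (norm w)\<^sup>2"
proof -
  have "\<bar>f (y + w) \<zeta> - f y \<zeta> - f' y \<zeta> \<bullet> w\<bar> \<le> Lf / 2 * (norm w)\<^sup>2"
    using f_gradient[OF assms] f'_lipschitz[OF assms] by (rule lipschitz_gradient_taylor)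
  moreover have "\<bar>F (y + w) - F y - F' y \<bullet> w\<bar> \<le> LF / 2 * (norm w)\<^sup>2"
    by (rule lipschitz_gradient_taylor[OF F_gradient F'_lipschitz])
  moreover have "LF / 2 * (norm w)\<^sup>2 \<le> Lf / 2 * (norm w)\<^sup>2"
    using LF_le by (intro mult_right_mono) auto
  ultimately show ?thesis unfolding inner_diff_left by linarith
qed

lemma g_var_le:
  "ennreal (g_var P f m N \<nu> u y)
     \<le> (\<integral>\<^sup>+\<zeta>. ennreal ((norm (grad_est m N \<nu> u (\<lambda>y. f y \<zeta> - F y) y))\<^sup>2) \<partial>P)"
  unfolding g_var_def g_dir_eq grad_est_diff by (rule ennreal_integral_le_nn_integral) simp

text \<open>The point where the assumption on the variance of the stochastic gradient
  enters.\<close>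

lemma noise_second_moment:
  assumes "0 \<le> a" "0 \<le> b"
  shows "(\<integral>\<^sup>+\<zeta>. ennreal (a * (norm (f' y \<zeta> - F' y))\<^sup>2 + b) \<partial>P)
           \<le> ennreal (a * (\<beta>1 * (norm (F' y))\<^sup>2 + \<beta>2) + b)"
proof -
  have "(\<integral>\<^sup>+\<zeta>. ennreal (a * (norm (f' y \<zeta> - F' y))\<^sup>2 + b) \<partial>P)
      = ennreal a * (\<integral>\<^sup>+\<zeta>. ennreal ((norm (f' y \<zeta> - F' y))\<^sup>2) \<partial>P) + ennreal b"
    using assms by (simp add: ennreal_plus ennreal_mult nn_integral_add nn_integral_cmult emeasure_space_1)
  also have "\<dots> \<le> ennreal a * ennreal (\<beta>1 * (norm (F' y))\<^sup>2 + \<beta>2) + ennreal b"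
    using variance by (intro add_right_mono mult_left_mono) auto
  also have "\<dots> = ennreal (a * (\<beta>1 * (norm (F' y))\<^sup>2 + \<beta>2) + b)"
    using assms beta_nonneg by (simp add: ennreal_plus ennreal_mult)
  finally show ?thesis .
qed

text \<open>The interface between the methods and the sample size analysis. \<open>C\<close>
  measures the bias, \<open>A\<close> weighs the gradient noise and \<open>A'\<close> the
  curvature.\<close>

definition estimator_bounds ::
  "estimator \<Rightarrow> nat \<Rightarrow> real \<Rightarrow> (nat \<Rightarrow> real ^ 'd) measure \<Rightarrow> real ^ 'd \<Rightarrow> real \<Rightarrow> real \<Rightarrow> real \<Rightarrow> real \<Rightarrow> bool"
  where
  "estimator_bounds m N \<nu> D y c A A' C \<longleftrightarrow>
     (norm (g_mean P f m N \<nu> D y - F' y))\<^sup>2 \<le> C * LF\<^sup>2 * \<nu>\<^sup>2 \<and>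
     c * (norm (g_mean P f m N \<nu> D y))\<^sup>2 \<le> g_sq P f m N \<nu> D y \<and>
     (\<integral>\<^sup>+u. ennreal (g_var P f m N \<nu> u y) \<partial>D)
       \<le> ennreal (c * (A * (\<beta>1 * (norm (F' y))\<^sup>2 + \<beta>2) + A' * Lf\<^sup>2 * \<nu>\<^sup>2))"

text \<open>Here \<open>c\<close> is the scaling of a single direction: 1 for the Gaussian, the
  dimension for the sphere. The second moment of the sum is bounded by convexity and not through
  independence of the directions, so the bounds do not improve with \<open>N\<close> and the common
  factor is 1.\<close>

lemma isotropic_estimator_bounds:
  fixes R :: "(real ^ 'd) measure" and y :: "real ^ 'd"
  assumes iso: "isotropic R" and D: "D = PiM {..<N} (\<lambda>_. R)"
    and N: "0 < N" and \<nu>: "0 < \<nu>" and c: "0 \<le> c" "scaling m CARD('d) N = c / real N"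
    and m2: "c * (\<integral>u. (norm u)\<^sup>2 \<partial>R) = CARD('d)"
    and m3: "c * (\<integral>u. (norm u) ^ 3 \<partial>R) \<le> CARD('d) * sqrt C" and C: "0 \<le> C"
    and m4: "2 * c\<^sup>2 * (\<integral>u. (norm u) ^ 4 \<partial>R) \<le> CARD('d) * A"
    and m6: "2 * c\<^sup>2 * (\<integral>u. (norm u) ^ 6 \<partial>R) \<le> A'"
  shows "estimator_bounds m N \<nu> D y 1 A A' C"
proof -
  interpret R: isotropic R by (rule iso)
  have [measurable_cong]: "sets R = sets borel" by (rule R.sets_R)
  interpret D: prob_space D unfolding D by (intro prob_space_PiM R.prob_space_axioms)
  have sets_D [measurable_cong]: "sets D = sets (dir_space N :: (nat \<Rightarrow> real ^ 'd) measure)"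
    unfolding D by (intro sets_PiM_cong refl R.sets_R)
  have comp: "(\<lambda>u. u j) \<in> D \<rightarrow>\<^sub>M borel" if "j < N" for j
    by measurable (simp add: that)
  have distr_comp: "distr D borel (\<lambda>u. u j) = R" if "j < N" for j
  proof -
    have "distr D R (\<lambda>u. u j) = R"
      unfolding D using that by (intro distr_PiM_component R.prob_space_axioms) auto
    then show ?thesis by (simp add: R.sets_R cong: distr_cong)
  qed
  let ?s = "scaling m CARD('d) N" and ?a = "diff_quot \<nu> F y" and ?g = "g_mean P f m N \<nu> D y"
  have dq_F [measurable]: "?a \<in> borel_measurable borel"
    unfolding diff_quot_def by measurable
  define G where "G = (\<integral>u. ?a u *\<^sub>R u \<partial>R)"
  have int_dq: "integrable R (\<lambda>u. ?a u *\<^sub>R u)"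
    using R.smoothed_gradient_bias(1)[OF F_gradient F'_lipschitz \<nu> c(1), of y] m2
    by (simp add: diff_quot_def)
  have int_comp: "integrable D (\<lambda>u. \<phi> (u j))" "(\<integral>u. \<phi> (u j) \<partial>D) = (\<integral>u. \<phi> u \<partial>R)"
    if "j < N" "integrable R \<phi>" for j and \<phi> :: "real ^ 'd \<Rightarrow> 'b::{banach, second_countable_topology}"
  proof -
    have [measurable]: "\<phi> \<in> borel_measurable borel"
      using that(2) R.sets_R by (metis borel_measurable_integrable measurable_cong_sets)
    show "integrable D (\<lambda>u. \<phi> (u j))"
      using that by (subst integrable_distr_eq[symmetric, of "\<lambda>u. u j" D borel]) (auto simp: distr_comp comp)
    show "(\<integral>u. \<phi> (u j) \<partial>D) = (\<integral>u. \<phi> u \<partial>R)"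
      using that by (subst integral_distr[symmetric, of "\<lambda>u. u j" D borel]) (auto simp: distr_comp comp)
  qed
  have g_mean: "?g = c *\<^sub>R G"
  proof -
    have "?g = ?s *\<^sub>R (\<Sum>j<N. \<integral>u. ?a (u j) *\<^sub>R u j \<partial>D)"
      unfolding g_mean_def g_dir_eq grad_est_diff_quot
      using int_comp(1)[OF _ int_dq] by (simp add: Bochner_Integration.integral_sum)
    also have "\<dots> = ?s *\<^sub>R (\<Sum>j<N. G)"
      using int_comp(2)[OF _ int_dq] by (simp add: G_def)
    also have "\<dots> = c *\<^sub>R G" using N c(2) by (simp add: sum_constant_scaleR del: sum_constant)
    finally show ?thesis .
  qed
  have bias: "(norm (?g - F' y))\<^sup>2 \<le> C * LF\<^sup>2 * \<nu>\<^sup>2"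
  proof -
    have "norm (c *\<^sub>R G - F' y) \<le> c * LF * \<nu> * (\<integral>u. (norm u) ^ 3 \<partial>R) / DIM(real ^ 'd)"
      using R.smoothed_gradient_bias(2)[OF F_gradient F'_lipschitz \<nu> c(1), of y] m2
      by (simp add: diff_quot_def G_def)
    also have "\<dots> = LF * \<nu> * (c * (\<integral>u. (norm u) ^ 3 \<partial>R)) / CARD('d)" by simp
    also have "\<dots> \<le> LF * \<nu> * (CARD('d) * sqrt C) / CARD('d)"
      using m3 LF_pos \<nu> by (intro divide_right_mono mult_left_mono) auto
    also have "\<dots> = LF * \<nu> * sqrt C" by simp
    finally have "(norm (c *\<^sub>R G - F' y))\<^sup>2 \<le> (LF * \<nu> * sqrt C)\<^sup>2" by (intro power_mono) auto
    then show ?thesis using C by (simp add: g_mean power_mult_distrib mult_ac)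
  qed
  \<comment> \<open>Cauchy-Schwarz over the \<open>N\<close> directions costs a factor
    \<open>N\<close>, which the scaling \<open>c / N\<close> turns into an average over single
    directions.\<close>
  have est_sq: "(norm (grad_est m N \<nu> u h y))\<^sup>2
      \<le> c\<^sup>2 / real N * (\<Sum>j<N. (diff_quot \<nu> h y (u j))\<^sup>2 * (norm (u j))\<^sup>2)" for u h
  proof -
    have "(norm (grad_est m N \<nu> u h y))\<^sup>2 = ?s\<^sup>2 * (norm (\<Sum>j<N. diff_quot \<nu> h y (u j) *\<^sub>R u j))\<^sup>2"
      by (simp add: grad_est_diff_quot power_mult_distrib)
    also have "\<dots> \<le> ?s\<^sup>2 * (real N * (\<Sum>j<N. (norm (diff_quot \<nu> h y (u j) *\<^sub>R u j))\<^sup>2))"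
      using norm_sum_squared_le[of "\<lambda>j. diff_quot \<nu> h y (u j) *\<^sub>R u j" "{..<N}"]
      by (intro mult_left_mono) auto
    also have "\<dots> = (?s\<^sup>2 * real N) * (\<Sum>j<N. (diff_quot \<nu> h y (u j))\<^sup>2 * (norm (u j))\<^sup>2)"
      by (simp add: power_mult_distrib)
    also have "?s\<^sup>2 * real N = c\<^sup>2 / real N"
      using N c(2) by (simp add: power2_eq_square)
    finally show ?thesis .
  qed
  \<comment> \<open>The mean of the pointwise bound on a squared quotient times the squared length
    of its direction: for \<open>F\<close> it supplies integrability, for the noise the actual
    estimate. The directional moment gives the division by the dimension in the fourth-moment
    term.\<close>
  have quad: "integrable R (\<lambda>u. (2 * (u \<bullet> w)\<^sup>2 + b * (norm u) ^ 4) * (norm u)\<^sup>2)"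
      "(\<integral>u. (2 * (u \<bullet> w)\<^sup>2 + b * (norm u) ^ 4) * (norm u)\<^sup>2 \<partial>R)
        = 2 * (norm w)\<^sup>2 * (\<integral>u. (norm u) ^ 4 \<partial>R) / CARD('d) + b * (\<integral>u. (norm u) ^ 6 \<partial>R)" for w b
  proof -
    have eq: "(2 * (u \<bullet> w)\<^sup>2 + b * (norm u) ^ 4) * (norm u)\<^sup>2
        = 2 * ((norm u) ^ 2 * (u \<bullet> w)\<^sup>2) + b * (norm u) ^ 6" for u :: "real ^ 'd"
      by (simp add: algebra_simps flip: power_add)
    show "integrable R (\<lambda>u. (2 * (u \<bullet> w)\<^sup>2 + b * (norm u) ^ 4) * (norm u)\<^sup>2)"
      unfolding eq by (intro Bochner_Integration.integrable_add integrable_mult_right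
          R.integrable_directional_moment R.sixth_moment) simp
    show "(\<integral>u. (2 * (u \<bullet> w)\<^sup>2 + b * (norm u) ^ 4) * (norm u)\<^sup>2 \<partial>R)
        = 2 * (norm w)\<^sup>2 * (\<integral>u. (norm u) ^ 4 \<partial>R) / CARD('d) + b * (\<integral>u. (norm u) ^ 6 \<partial>R)"
      unfolding eq using R.directional_moment[of 2 w] R.integrable_directional_moment[of 2 w] R.sixth_moment
      by simp
  qed
  \<comment> \<open>Square integrability is essential here: \<open>g_sq\<close> is bounded from
    below, and a Bochner integral without integrability would be 0.\<close>
  have second: "(norm (?g))\<^sup>2 \<le> g_sq P f m N \<nu> D y"
    unfolding g_mean_def g_sq_def
  proof (rule D.norm_expectation_squared_le(2))
    show meas: "(\<lambda>u. g_dir P f m N \<nu> u y) \<in> borel_measurable D"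
      unfolding g_dir_eq grad_est_diff_quot by measurable
    have "integrable R (\<lambda>u. (?a u)\<^sup>2 * (norm u)\<^sup>2)"
    proof (rule Bochner_Integration.integrable_bound[OF quad(1)[of "F' y" "2 * (LF / 2)\<^sup>2 * \<nu>\<^sup>2"]])
      show "AE u in R. norm ((?a u)\<^sup>2 * (norm u)\<^sup>2)
          \<le> norm ((2 * (u \<bullet> F' y)\<^sup>2 + 2 * (LF / 2)\<^sup>2 * \<nu>\<^sup>2 * (norm u) ^ 4) * (norm u)\<^sup>2)"
        using diff_quot_square_le[OF lipschitz_gradient_taylor[OF F_gradient F'_lipschitz] \<nu>, of y]
        by (intro AE_I2) (auto simp: abs_mult intro!: mult_right_mono order_trans[OF _ abs_ge_self])
    qed measurable
    from int_comp(1)[OF _ this]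
    have "integrable D (\<lambda>u. c\<^sup>2 / real N * (\<Sum>j<N. (?a (u j))\<^sup>2 * (norm (u j))\<^sup>2))"
      by (intro integrable_mult_right Bochner_Integration.integrable_sum) auto
    then show "integrable D (\<lambda>u. (norm (g_dir P f m N \<nu> u y))\<^sup>2)"
    proof (rule Bochner_Integration.integrable_bound)
      show "(\<lambda>u. (norm (g_dir P f m N \<nu> u y))\<^sup>2) \<in> borel_measurable D"
        using meas by measurable
      show "AE u in D. norm ((norm (g_dir P f m N \<nu> u y))\<^sup>2)
          \<le> norm (c\<^sup>2 / real N * (\<Sum>j<N. (?a (u j))\<^sup>2 * (norm (u j))\<^sup>2))"
        using order_trans[OF est_sq abs_ge_self] by (simp add: g_dir_eq)
    qed
  qed
  define q where "q \<zeta> u = (diff_quot \<nu> (\<lambda>y. f y \<zeta> - F y) y u)\<^sup>2 * (norm u)\<^sup>2" for \<zeta> u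
  have q_nn: "0 \<le> q \<zeta> u" for \<zeta> u by (simp add: q_def)
  have q_meas [measurable]: "(\<lambda>(u, \<zeta>). q \<zeta> u) \<in> borel_measurable (borel \<Otimes>\<^sub>M P)"
    unfolding q_def diff_quot_def by measurable
  have q_int: "(\<integral>\<^sup>+u. ennreal (q \<zeta> u) \<partial>R)
      \<le> ennreal (2 * (\<integral>u. (norm u) ^ 4 \<partial>R) / CARD('d) * (norm (f' y \<zeta> - F' y))\<^sup>2
            + 2 * Lf\<^sup>2 * \<nu>\<^sup>2 * (\<integral>u. (norm u) ^ 6 \<partial>R))"
    if "\<zeta> \<in> space P" for \<zeta>
  proof -
    let ?b = "2 * Lf\<^sup>2 * \<nu>\<^sup>2" and ?w = "f' y \<zeta> - F' y"
    have "(\<integral>\<^sup>+u. ennreal (q \<zeta> u) \<partial>R) \<le> (\<integral>\<^sup>+u. ennreal ((2 * (u \<bullet> ?w)\<^sup>2 + ?b * (norm u) ^ 4) * (norm u)\<^sup>2) \<partial>R)"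
      unfolding q_def
      by (intro nn_integral_mono ennreal_leI mult_right_mono diff_quot_square_le noise_taylor[OF that] \<nu>) simp
    also have "\<dots> = ennreal (\<integral>u. (2 * (u \<bullet> ?w)\<^sup>2 + ?b * (norm u) ^ 4) * (norm u)\<^sup>2 \<partial>R)"
      by (intro nn_integral_eq_integral quad(1)) simp
    finally show ?thesis unfolding quad(2) by (simp add: mult_ac)
  qed
  have third: "(\<integral>\<^sup>+u. ennreal (g_var P f m N \<nu> u y) \<partial>D)
      \<le> ennreal (A * (\<beta>1 * (norm (F' y))\<^sup>2 + \<beta>2) + A' * Lf\<^sup>2 * \<nu>\<^sup>2)"
  proof -
    interpret pair_sigma_finite R P ..
    let ?W = "\<lambda>u. \<integral>\<^sup>+\<zeta>. ennreal (q \<zeta> u) \<partial>P"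
    have P_meas: "(\<lambda>u. \<integral>\<^sup>+\<zeta>. ennreal (q \<zeta> u) \<partial>P) \<in> borel_measurable borel"
      by measurable
    let ?m4 = "2 * (\<integral>u. (norm u) ^ 4 \<partial>R) / CARD('d)" and ?m6 = "\<integral>u. (norm u) ^ 6 \<partial>R"
    have "(\<integral>\<^sup>+u. ennreal (g_var P f m N \<nu> u y) \<partial>D)
        \<le> (\<integral>\<^sup>+u. (\<Sum>j<N. ennreal (c\<^sup>2 / real N) * ?W (u j)) \<partial>D)"
    proof (rule nn_integral_mono)
      fix u assume "u \<in> space D"
      have "ennreal (g_var P f m N \<nu> u y)
          \<le> (\<integral>\<^sup>+\<zeta>. ennreal (c\<^sup>2 / real N * (\<Sum>j<N. q \<zeta> (u j))) \<partial>P)"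
        unfolding q_def
        by (rule order_trans[OF g_var_le nn_integral_mono[OF ennreal_leI[OF est_sq]]])
      also have "\<dots> = (\<integral>\<^sup>+\<zeta>. (\<Sum>j<N. ennreal (c\<^sup>2 / real N) * ennreal (q \<zeta> (u j))) \<partial>P)"
        using q_nn by (intro nn_integral_cong) (simp add: sum_nonneg sum_distrib_left flip: ennreal_mult)
      also have "\<dots> = (\<Sum>j<N. ennreal (c\<^sup>2 / real N) * ?W (u j))"
        by (subst nn_integral_sum) (auto intro!: sum.cong nn_integral_cmult)
      finally show "ennreal (g_var P f m N \<nu> u y)
          \<le> (\<Sum>j<N. ennreal (c\<^sup>2 / real N) * ?W (u j))" .
    qed
    also have "\<dots> = (\<Sum>j<N. ennreal (c\<^sup>2 / real N) * (\<integral>\<^sup>+u. ?W (u j) \<partial>D))"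
      by (subst nn_integral_sum) (auto intro!: sum.cong nn_integral_cmult)
    also have "\<dots> = (\<Sum>j<N. ennreal (c\<^sup>2 / real N) * (\<integral>\<^sup>+u. ?W u \<partial>R))"
    proof (intro sum.cong refl arg_cong2[where f = "(*)"])
      fix j assume "j \<in> {..<N}"
      then have j: "j < N" by simp
      have "(\<integral>\<^sup>+u. ?W u \<partial>distr D borel (\<lambda>u. u j))
          = (\<integral>\<^sup>+u. ?W (u j) \<partial>D)"
        using j P_meas by (subst nn_integral_distr) (auto simp: comp)
      then show "(\<integral>\<^sup>+u. ?W (u j) \<partial>D) = (\<integral>\<^sup>+u. ?W u \<partial>R)"
        by (simp add: distr_comp[OF j])
    qed
    also have "\<dots> = ennreal (c\<^sup>2) * (\<integral>\<^sup>+u. ?W u \<partial>R)"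
      using N by (simp add: ennreal_of_nat_eq_real_of_nat mult.assoc[symmetric] ennreal_mult[symmetric])
    \<comment> \<open>Tonelli puts the average over directions inside: the Taylor bound holds for
      each sample separately, while the variance assumption speaks only about the mean over
      samples.\<close>
    also have "(\<integral>\<^sup>+u. ?W u \<partial>R) = (\<integral>\<^sup>+\<zeta>. (\<integral>\<^sup>+u. ennreal (q \<zeta> u) \<partial>R) \<partial>P)"
      by (rule Fubini'[symmetric]) measurable
    also have "\<dots> \<le> (\<integral>\<^sup>+\<zeta>. ennreal (?m4 * (norm (f' y \<zeta> - F' y))\<^sup>2 + 2 * Lf\<^sup>2 * \<nu>\<^sup>2 * ?m6) \<partial>P)"
      by (rule nn_integral_mono) (rule q_int)
    also have "\<dots> \<le> ennreal (?m4 * (\<beta>1 * (norm (F' y))\<^sup>2 + \<beta>2) + 2 * Lf\<^sup>2 * \<nu>\<^sup>2 * ?m6)"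
      by (rule noise_second_moment) simp_all
    also have "ennreal (c\<^sup>2) * \<dots> = ennreal (c\<^sup>2 * (?m4 * (\<beta>1 * (norm (F' y))\<^sup>2 + \<beta>2) + 2 * Lf\<^sup>2 * \<nu>\<^sup>2 * ?m6))"
      using beta_nonneg by (intro ennreal_mult[symmetric]) auto
    also have "\<dots> \<le> ennreal (A * (\<beta>1 * (norm (F' y))\<^sup>2 + \<beta>2) + A' * Lf\<^sup>2 * \<nu>\<^sup>2)"
    proof (rule ennreal_leI)
      have "c\<^sup>2 * ?m4 \<le> A" using m4 by (simp add: field_simps)
      then have "c\<^sup>2 * ?m4 * (\<beta>1 * (norm (F' y))\<^sup>2 + \<beta>2) \<le> A * (\<beta>1 * (norm (F' y))\<^sup>2 + \<beta>2)"
        using beta_nonneg by (intro mult_right_mono) auto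
      moreover have "2 * c\<^sup>2 * ?m6 * (Lf\<^sup>2 * \<nu>\<^sup>2) \<le> A' * (Lf\<^sup>2 * \<nu>\<^sup>2)"
        using m6 by (intro mult_right_mono) auto
      ultimately show "c\<^sup>2 * (?m4 * (\<beta>1 * (norm (F' y))\<^sup>2 + \<beta>2) + 2 * Lf\<^sup>2 * \<nu>\<^sup>2 * ?m6)
          \<le> A * (\<beta>1 * (norm (F' y))\<^sup>2 + \<beta>2) + A' * Lf\<^sup>2 * \<nu>\<^sup>2"
        by (simp add: distrib_left mult_ac)
    qed
    finally show ?thesis by (meson mult_left_mono order_trans zero_le)
  qed
  show ?thesis unfolding estimator_bounds_def using bias second third by simp
qed

end

subsection \<open>Orthonormal directions\<close>

definition orthonormal :: "(nat \<Rightarrow> real ^ 'd) \<Rightarrow> bool" where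
  "orthonormal b \<longleftrightarrow> (\<forall>i<CARD('d). \<forall>j<CARD('d). b i \<bullet> b j = (if i = j then 1 else 0))"

lemma orthonormal_norm_sum:
  fixes b :: "nat \<Rightarrow> real ^ 'd"
  assumes b: "orthonormal b" and s: "s ` J \<subseteq> {..<CARD('d)}" "inj_on s J" "finite J"
  shows "(norm (\<Sum>j\<in>J. a j *\<^sub>R b (s j)))\<^sup>2 = (\<Sum>j\<in>J. (a j)\<^sup>2)"
proof -
  have "pairwise (\<lambda>i j. orthogonal (a i *\<^sub>R b (s i)) (a j *\<^sub>R b (s j))) J"
  proof (rule pairwiseI)
    fix i j assume "i \<in> J" "j \<in> J" "i \<noteq> j"
    then have "s i < CARD('d)" "s j < CARD('d)" "s i \<noteq> s j"
      using s inj_onD[OF s(2), of i j] by auto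
    then show "orthogonal (a i *\<^sub>R b (s i)) (a j *\<^sub>R b (s j))"
      using b by (simp add: orthonormal_def orthogonal_def)
  qed
  then have "(norm (\<Sum>j\<in>J. a j *\<^sub>R b (s j)))\<^sup>2 = (\<Sum>j\<in>J. (norm (a j *\<^sub>R b (s j)))\<^sup>2)"
    by (rule norm_sum_Pythagorean[OF s(3)])
  also have "\<dots> = (\<Sum>j\<in>J. (a j)\<^sup>2)"
  proof (rule sum.cong[OF refl])
    fix j assume "j \<in> J"
    then have "b (s j) \<bullet> b (s j) = 1" using b s(1) by (auto simp: orthonormal_def)
    then show "(norm (a j *\<^sub>R b (s j)))\<^sup>2 = (a j)\<^sup>2"
      by (simp add: power_mult_distrib power2_norm_eq_inner)
  qed
  finally show ?thesis .
qed

text \<open>Orthonormal vectors are independent, and as many as the dimension of the space must span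
  it.\<close>

lemma orthonormal_expansion:
  fixes b :: "nat \<Rightarrow> real ^ 'd"
  assumes b: "orthonormal b"
  shows "(\<Sum>i<CARD('d). (w \<bullet> b i) *\<^sub>R b i) = w"
proof -
  let ?B = "b ` {..<CARD('d)}"
  have norm1: "norm v = 1" if "v \<in> ?B" for v
    using that b by (auto simp: orthonormal_def norm_eq_sqrt_inner)
  have inj: "inj_on b {..<CARD('d)}"
    by (rule inj_onI) (use b in \<open>auto simp: orthonormal_def split: if_splits\<close>, metis zero_neq_one)
  have orth: "pairwise orthogonal ?B"
    using b by (auto simp: pairwise_def orthogonal_def orthonormal_def)
  have "0 \<notin> ?B" using norm1 by force
  with orth have "independent ?B" by (rule pairwise_orthogonal_independent)
  moreover have "card ?B = dim (UNIV :: (real ^ 'd) set)"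
    using inj by (simp add: card_image dim_UNIV)
  ultimately have "w \<in> span ?B"
    using card_eq_dim[of ?B UNIV] by auto
  then have "(\<Sum>v\<in>?B. (w \<bullet> v) *\<^sub>R v) = w"
    using orthonormal_basis_expand[OF orth norm1] by simp
  then show ?thesis using inj by (simp add: sum.reindex)
qed

lemma orthonormal_Parseval:
  fixes b :: "nat \<Rightarrow> real ^ 'd"
  assumes b: "orthonormal b"
  shows "(\<Sum>i<CARD('d). (w \<bullet> b i)\<^sup>2) = (norm w)\<^sup>2"
  using orthonormal_norm_sum[OF b, of "\<lambda>i. i" "{..<CARD('d)}" "\<lambda>i. w \<bullet> b i"]
    orthonormal_expansion[OF b, of w] by simp

text \<open>It allows a deterministic basis to be treated as a random basis concentrated at one
  point.\<close>

lemma distr_return_pair: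
  assumes K: "sigma_finite_measure K" and b: "b \<in> space X" and g: "g \<in> X \<Otimes>\<^sub>M K \<rightarrow>\<^sub>M L"
  shows "distr (return X b \<Otimes>\<^sub>M K) L g = distr K L (\<lambda>s. g (b, s))"
proof (rule measure_eqI)
  interpret K: sigma_finite_measure K by (rule K)
  fix A assume "A \<in> sets (distr (return X b \<Otimes>\<^sub>M K) L g)"
  then have A [measurable]: "A \<in> sets L" by simp
  have g' [measurable]: "g \<in> return X b \<Otimes>\<^sub>M K \<rightarrow>\<^sub>M L"
    using g by (simp cong: measurable_cong_sets)
  have [measurable]: "(\<lambda>s. g (b, s)) \<in> K \<rightarrow>\<^sub>M L"
    using measurable_compose[OF measurable_Pair1'[OF b] g] .
  have "emeasure (distr (return X b \<Otimes>\<^sub>M K) L g) A = (\<integral>\<^sup>+z. indicator A (g z) \<partial>(return X b \<Otimes>\<^sub>M K))"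
    by (subst nn_integral_distr[OF g', symmetric]) auto
  also have "\<dots> = (\<integral>\<^sup>+b. \<integral>\<^sup>+s. indicator A (g (b, s)) \<partial>K \<partial>return X b)"
    by (subst K.nn_integral_fst[symmetric]) auto
  also have "\<dots> = (\<integral>\<^sup>+s. indicator A (g (b, s)) \<partial>K)"
  proof (rule nn_integral_return[OF b])
    have "(\<lambda>z. indicator A (g z) :: ennreal) \<in> borel_measurable (X \<Otimes>\<^sub>M K)"
      using g by measurable
    then show "(\<lambda>b. \<integral>\<^sup>+s. indicator A (g (b, s)) \<partial>K) \<in> borel_measurable X"
      by (rule K.borel_measurable_nn_integral_fst)
  qed
  also have "\<dots> = emeasure (distr K L (\<lambda>s. g (b, s))) A"
    by (subst nn_integral_distr[of "\<lambda>s. g (b, s)" K L "indicator A", symmetric]) auto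
  finally show "emeasure (distr (return X b \<Otimes>\<^sub>M K) L g) A = emeasure (distr K L (\<lambda>s. g (b, s))) A" .
qed simp

text \<open>A common form of the direction laws of the methods \<open>FD\<close>, \<open>RC\<close> and \<open>RS\<close>: a random orthonormal
  basis, and independently of it a uniformly chosen element of a set \<open>S\<close> of index tuples that
  covers all indices equally often.\<close>

definition subbasis_law ::
  "nat \<Rightarrow> (nat \<Rightarrow> nat) set \<Rightarrow> (nat \<Rightarrow> real ^ 'd) measure \<Rightarrow> (nat \<Rightarrow> real ^ 'd) measure \<Rightarrow> bool" where
  "subbasis_law N S Q D \<longleftrightarrow>
     prob_space Q \<and> sets Q = sets (dir_space CARD('d) :: (nat \<Rightarrow> real ^ 'd) measure) \<and>
     (AE b in Q. orthonormal b) \<and>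
     finite S \<and> S \<noteq> {} \<and> (\<forall>s\<in>S. s ` {..<N} \<subseteq> {..<CARD('d)} \<and> inj_on s {..<N}) \<and>
     (\<forall>\<phi>::nat \<Rightarrow> real. (\<Sum>s\<in>S. \<Sum>j<N. \<phi> (s j)) / card S = real N / CARD('d) * (\<Sum>i<CARD('d). \<phi> i)) \<and>
     D = distr (Q \<Otimes>\<^sub>M measure_pmf (pmf_of_set S)) (dir_space N) (\<lambda>(b, s). \<lambda>j\<in>{..<N}. b (s j))"

text \<open>Selecting a component by a random index is a countable composition, since the indices
  are discrete. An index outside the range yields the constant \<open>undefined\<close>, because the
  tuples are extensional.\<close>

lemma subbasis_map_measurable:
  assumes "sets Q = sets (dir_space d :: (nat \<Rightarrow> real ^ 'd) measure)"
  shows "(\<lambda>(b, s). \<lambda>j\<in>{..<N}. b (s j)) \<in> Q \<Otimes>\<^sub>M measure_pmf K \<rightarrow>\<^sub>M dir_space N"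
proof -
  have [measurable_cong]: "sets Q = sets (PiM {..<d} (\<lambda>_. borel :: (real ^ 'd) measure))" by (rule assms)
  have space_Q: "space Q = ({..<d} \<rightarrow>\<^sub>E UNIV)"
    using sets_eq_imp_space_eq[OF assms] by (simp add: space_PiM)
  have comp: "(\<lambda>z. fst z i) \<in> Q \<Otimes>\<^sub>M measure_pmf K \<rightarrow>\<^sub>M (borel :: (real ^ 'd) measure)" for i
  proof (cases "i < d")
    case True
    show ?thesis by measurable (simp add: True)
  next
    case False
    have "(\<lambda>z. undefined) \<in> Q \<Otimes>\<^sub>M measure_pmf K \<rightarrow>\<^sub>M (borel :: (real ^ 'd) measure)" by simp
    then show ?thesis
      by (rule measurable_cong[THEN iffD1, rotated])
        (use False in \<open>auto simp: space_pair_measure space_Q PiE_def extensional_def\<close>)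
  qed
  have "(\<lambda>z. (\<lambda>i z. fst z i) (snd z j) z) \<in> Q \<Otimes>\<^sub>M measure_pmf K \<rightarrow>\<^sub>M (borel :: (real ^ 'd) measure)" for j
  proof (rule measurable_compose_countable[OF comp])
    show "(\<lambda>z. snd z j) \<in> Q \<Otimes>\<^sub>M measure_pmf K \<rightarrow>\<^sub>M count_space UNIV"
      by (rule measurable_compose[OF measurable_snd]) simp
  qed
  then show ?thesis unfolding case_prod_beta by (intro measurable_restrict)
qed

context stochastic_problem
begin

text \<open>For a fixed basis, averaging over \<open>S\<close> turns the estimator into the full
  finite difference \<open>G b\<close>, and the averaged squared norm is exactly
  \<open>d / N\<close> times that of \<open>G b\<close>. The same identity applied to the noise
  produces the same factor in the variance.\<close>

lemma subbasis_estimator_bounds: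
  fixes D :: "(nat \<Rightarrow> real ^ 'd) measure" and y :: "real ^ 'd"
  assumes law: "subbasis_law N S Q D" and N: "0 < N" and \<nu>: "0 < \<nu>"
    and scale: "scaling m CARD('d) N = CARD('d) / real N"
  shows "estimator_bounds m N \<nu> D y (CARD('d) / real N) 2 (2 * CARD('d)) (CARD('d) / 4)"
proof -
  let ?a = "diff_quot \<nu> F y" and ?g = "g_mean P f m N \<nu> D y" and ?est = "grad_est m N \<nu>"
  let ?d = "real CARD('d)" and ?K = "measure_pmf (pmf_of_set S)"
  let ?T = "\<lambda>b s. \<lambda>j\<in>{..<N}. b (s j) :: real ^ 'd"
  have Q: "prob_space Q" and sets_Q [measurable_cong]: "sets Q = sets (dir_space CARD('d) :: (nat \<Rightarrow> real ^ 'd) measure)"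
    and ae_Q: "AE b in Q. orthonormal b" and S: "finite S" "S \<noteq> {}"
    and S_inj: "\<And>s. s \<in> S \<Longrightarrow> s ` {..<N} \<subseteq> {..<CARD('d)} \<and> inj_on s {..<N}"
    and unif: "\<And>\<phi>::nat \<Rightarrow> real. (\<Sum>s\<in>S. \<Sum>j<N. \<phi> (s j)) / card S = real N / ?d * (\<Sum>i<CARD('d). \<phi> i)"
    and D: "D = distr (Q \<Otimes>\<^sub>M ?K) (dir_space N) (\<lambda>(b, s). ?T b s)"
    using law unfolding subbasis_law_def by auto
  interpret Q: prob_space Q by (rule Q)
  interpret QK: pair_prob_space Q ?K ..
  have T_meas [measurable]: "(\<lambda>(b, s). ?T b s) \<in> Q \<Otimes>\<^sub>M ?K \<rightarrow>\<^sub>M dir_space N"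
    by (rule subbasis_map_measurable[OF sets_Q])
  have sets_D [measurable_cong]: "sets D = sets (dir_space N :: (nat \<Rightarrow> real ^ 'd) measure)" by (simp add: D)
  have comp_Q [measurable]: "(\<lambda>b. b i) \<in> Q \<rightarrow>\<^sub>M (borel :: (real ^ 'd) measure)" if "i < CARD('d)" for i
    by measurable (simp add: that)
  have dq_F [measurable]: "?a \<in> borel_measurable borel"
    unfolding diff_quot_def by measurable
  have unif_vec: "(1 / card S) *\<^sub>R (\<Sum>s\<in>S. \<Sum>j<N. \<phi> (s j)) = (real N / ?d) *\<^sub>R (\<Sum>i<CARD('d). \<phi> i)"
    for \<phi> :: "nat \<Rightarrow> real ^ 'd"
    using unif[of "\<lambda>i. \<phi> i $ k" for k] by (simp add: vec_eq_iff)
  have est_T: "?est (?T b s) h y = (?d / real N) *\<^sub>R (\<Sum>j<N. diff_quot \<nu> h y (b (s j)) *\<^sub>R b (s j))"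
    for b s h by (simp add: grad_est_diff_quot scale)
  define G where "G b = (\<Sum>i<CARD('d). ?a (b i) *\<^sub>R b i)" for b :: "nat \<Rightarrow> real ^ 'd"
  have G_meas [measurable]: "G \<in> borel_measurable Q"
    unfolding G_def by measurable
  have sq_T: "(norm (?est (?T b s) h y))\<^sup>2 = (?d / real N)\<^sup>2 * (\<Sum>j<N. (diff_quot \<nu> h y (b (s j)))\<^sup>2)"
    if "orthonormal b" "s \<in> S" for b s h
    unfolding est_T using S_inj[OF that(2)] orthonormal_norm_sum[OF that(1), of s "{..<N}"]
    by (simp add: power_mult_distrib power_divide)
  \<comment> \<open>The squared scaling \<open>(d / N)\<^sup>2\<close> meets the coverage factor
    \<open>N / d\<close>.\<close>
  have avg_sq: "(\<Sum>s\<in>S. (norm (?est (?T b s) h y))\<^sup>2) / card S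
      = ?d / real N * (\<Sum>i<CARD('d). (diff_quot \<nu> h y (b i))\<^sup>2)" if "orthonormal b" for b h
  proof -
    have "(\<Sum>s\<in>S. (norm (?est (?T b s) h y))\<^sup>2) / card S
        = (?d / real N)\<^sup>2 * ((\<Sum>s\<in>S. \<Sum>j<N. (diff_quot \<nu> h y (b (s j)))\<^sup>2) / card S)"
      using sq_T[OF that] by (simp add: sum_distrib_left)
    also have "\<dots> = ?d / real N * (\<Sum>i<CARD('d). (diff_quot \<nu> h y (b i))\<^sup>2)"
      unfolding unif[of "\<lambda>i. (diff_quot \<nu> h y (b i))\<^sup>2"] using N by (simp add: power2_eq_square)
    finally show ?thesis .
  qed
  have G_sq: "(norm (G b))\<^sup>2 = (\<Sum>i<CARD('d). (?a (b i))\<^sup>2)" if "orthonormal b" for b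
    using orthonormal_norm_sum[OF that, of "\<lambda>i. i" "{..<CARD('d)}"] by (simp add: G_def)
  have avg_vec: "(1 / card S) *\<^sub>R (\<Sum>s\<in>S. ?est (?T b s) F y) = G b" for b
  proof -
    have "(1 / card S) *\<^sub>R (\<Sum>s\<in>S. ?est (?T b s) F y)
        = (?d / real N) *\<^sub>R ((1 / card S) *\<^sub>R (\<Sum>s\<in>S. \<Sum>j<N. ?a (b (s j)) *\<^sub>R b (s j)))"
      by (simp add: est_T scaleR_sum_right mult.commute)
    also have "\<dots> = G b"
      unfolding unif_vec[of "\<lambda>i. ?a (b i) *\<^sub>R b i"] using N by (simp add: G_def)
    finally show ?thesis .
  qed
  \<comment> \<open>Each of the d coordinates is off by at most \<open>LF / 2 * \<nu>\<close>; this
    is the origin of the coefficient \<open>d / 4\<close>.\<close>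
  have G_bias: "(norm (G b - F' y))\<^sup>2 \<le> ?d / 4 * LF\<^sup>2 * \<nu>\<^sup>2" if b: "orthonormal b" for b
  proof -
    have "G b - F' y = (\<Sum>i<CARD('d). (?a (b i) - F' y \<bullet> b i) *\<^sub>R b i)"
      using orthonormal_expansion[OF b, of "F' y"]
      by (simp add: G_def scaleR_diff_left sum_subtractf)
    then have "(norm (G b - F' y))\<^sup>2 = (\<Sum>i<CARD('d). (?a (b i) - F' y \<bullet> b i)\<^sup>2)"
      using orthonormal_norm_sum[OF b, of "\<lambda>i. i" "{..<CARD('d)}"] by simp
    also have "\<dots> \<le> (\<Sum>i<CARD('d). (LF / 2 * \<nu>)\<^sup>2)"
    proof (rule sum_mono)
      fix i assume "i \<in> {..<CARD('d)}"
      then have "norm (b i) = 1" using b by (simp add: orthonormal_def norm_eq_sqrt_inner)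
      then have "\<bar>?a (b i) - F' y \<bullet> b i\<bar> \<le> LF / 2 * \<nu>"
        using diff_quot_approx[OF lipschitz_gradient_taylor[OF F_gradient F'_lipschitz] \<nu>, of y "b i"] by simp
      then show "(?a (b i) - F' y \<bullet> b i)\<^sup>2 \<le> (LF / 2 * \<nu>)\<^sup>2"
        by (metis abs_ge_zero power2_abs power_mono)
    qed
    also have "\<dots> = ?d / 4 * LF\<^sup>2 * \<nu>\<^sup>2" by (simp add: power2_eq_square)
    finally show ?thesis .
  qed
  \<comment> \<open>An almost sure bound on the bias that is uniform over orthonormal bases; it
    supplies all integrability by boundedness.\<close>
  define r where "r = sqrt (?d / 4 * LF\<^sup>2 * \<nu>\<^sup>2)"
  have r: "r\<^sup>2 = ?d / 4 * LF\<^sup>2 * \<nu>\<^sup>2" "0 \<le> r" by (simp_all add: r_def)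
  have G_near: "norm (G b - F' y) \<le> r" if "orthonormal b" for b
    unfolding r_def using G_bias[OF that] by (rule real_le_rsqrt)
  have G_bound: "norm (G b) \<le> norm (F' y) + r" if "orthonormal b" for b
    using G_near[OF that] norm_triangle_sub[of "G b" "F' y"] by simp
  have G_int: "integrable Q G"
    using ae_Q G_bound by (intro Q.integrable_const_bound[of _ "norm (F' y) + r"]) auto
  have G_sq_int: "integrable Q (\<lambda>b. (norm (G b))\<^sup>2)"
  proof (rule Q.integrable_const_bound[of _ "(norm (F' y) + r)\<^sup>2"])
    show "AE b in Q. norm ((norm (G b))\<^sup>2) \<le> (norm (F' y) + r)\<^sup>2"
      using ae_Q by eventually_elim (auto intro: power_mono G_bound)
  qed measurable
  have est_meas [measurable]: "(\<lambda>u. grad_est m N \<nu> u F y) \<in> borel_measurable (dir_space N)"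
    unfolding grad_est_diff_quot by measurable
  let ?Y = "\<lambda>z. grad_est m N \<nu> (case z of (b, s) \<Rightarrow> ?T b s) F y"
  have Y_meas: "?Y \<in> borel_measurable (Q \<Otimes>\<^sub>M ?K)"
    by (rule measurable_compose[OF T_meas est_meas])
  have ae_QK: "AE z in Q \<Otimes>\<^sub>M ?K. orthonormal (fst z) \<and> snd z \<in> S"
  proof (rule AE_conjI)
    have "AE b in distr (Q \<Otimes>\<^sub>M ?K) Q fst. orthonormal b"
      using ae_Q by (simp only: prob_space.distr_pair_fst[OF prob_space_measure_pmf])
    then show "AE z in Q \<Otimes>\<^sub>M ?K. orthonormal (fst z)" by (rule AE_distrD[rotated]) simp
    have "AE b in Q. AE s in ?K. s \<in> S"
      using S by (simp add: AE_measure_pmf_iff)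
    moreover have "snd -` S \<inter> space (Q \<Otimes>\<^sub>M ?K) \<in> sets (Q \<Otimes>\<^sub>M ?K)"
      by (rule measurable_sets[OF measurable_snd]) simp
    ultimately show "AE z in Q \<Otimes>\<^sub>M ?K. snd z \<in> S"
      by (intro QK.AE_pair_measure) (auto simp: vimage_def Int_def conj_commute)
  qed
  have Y_sq: "(norm (?Y z))\<^sup>2 \<le> (?d / real N)\<^sup>2 * (norm (F' y) + r)\<^sup>2"
    if z: "orthonormal (fst z) \<and> snd z \<in> S" for z
  proof -
    obtain b s where bs: "z = (b, s)" by (cases z)
    have "(\<Sum>j<N. (?a (b (s j)))\<^sup>2) = (\<Sum>i\<in>s ` {..<N}. (?a (b i))\<^sup>2)"
      using S_inj z by (subst sum.reindex) (auto simp: bs)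
    also have "\<dots> \<le> (\<Sum>i<CARD('d). (?a (b i))\<^sup>2)"
      using S_inj z by (intro sum_mono2) (auto simp: bs)
    also have "\<dots> = (norm (G b))\<^sup>2" using G_sq z by (simp add: bs)
    also have "\<dots> \<le> (norm (F' y) + r)\<^sup>2" using G_bound z by (intro power_mono) (auto simp: bs)
    finally show ?thesis using sq_T[of b s F] z by (simp add: bs mult_left_mono)
  qed
  have Y_sq_int: "integrable (Q \<Otimes>\<^sub>M ?K) (\<lambda>z. (norm (?Y z))\<^sup>2)"
  proof (rule QK.integrable_const_bound[of _ "(?d / real N)\<^sup>2 * (norm (F' y) + r)\<^sup>2"])
    show "AE z in Q \<Otimes>\<^sub>M ?K. norm ((norm (?Y z))\<^sup>2) \<le> (?d / real N)\<^sup>2 * (norm (F' y) + r)\<^sup>2"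
      using ae_QK by eventually_elim (use Y_sq in simp)
    show "(\<lambda>z. (norm (?Y z))\<^sup>2) \<in> borel_measurable (Q \<Otimes>\<^sub>M ?K)"
      using Y_meas by measurable
  qed
  have Y_int: "integrable (Q \<Otimes>\<^sub>M ?K) ?Y"
    by (rule QK.norm_expectation_squared_le(1)[OF Y_meas Y_sq_int])
  have K_int: "(\<integral>s. X s \<partial>?K) = (1 / card S) *\<^sub>R (\<Sum>s\<in>S. X s)"
    for X :: "(nat \<Rightarrow> nat) \<Rightarrow> 'b::{banach, second_countable_topology}"
    using S by (subst integral_measure_pmf[of S]) (auto simp: scaleR_sum_right)
  have g_mean: "?g = (\<integral>b. G b \<partial>Q)"
  proof -
    have "?g = (\<integral>z. ?Y z \<partial>(Q \<Otimes>\<^sub>M ?K))"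
      unfolding g_mean_def g_dir_eq D by (subst integral_distr) auto
    also have "\<dots> = (\<integral>b. \<integral>s. ?Y (b, s) \<partial>?K \<partial>Q)"
      by (rule QK.integral_fst'[symmetric, OF Y_int])
    also have "\<dots> = (\<integral>b. G b \<partial>Q)" by (simp add: K_int avg_vec)
    finally show ?thesis .
  qed
  have g_sq: "g_sq P f m N \<nu> D y = ?d / real N * (\<integral>b. (norm (G b))\<^sup>2 \<partial>Q)"
  proof -
    have "g_sq P f m N \<nu> D y = (\<integral>z. (norm (?Y z))\<^sup>2 \<partial>(Q \<Otimes>\<^sub>M ?K))"
      unfolding g_sq_def g_dir_eq D by (subst integral_distr) auto
    also have "\<dots> = (\<integral>b. \<integral>s. (norm (?Y (b, s)))\<^sup>2 \<partial>?K \<partial>Q)"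
      by (rule QK.integral_fst'[symmetric, OF Y_sq_int])
    also have "\<dots> = (\<integral>b. ?d / real N * (norm (G b))\<^sup>2 \<partial>Q)"
    proof (rule integral_cong_AE)
      show "AE b in Q. (\<integral>s. (norm (?Y (b, s)))\<^sup>2 \<partial>?K) = ?d / real N * (norm (G b))\<^sup>2"
        using ae_Q by eventually_elim (use avg_sq G_sq in \<open>simp add: K_int\<close>)
      show "(\<lambda>b. \<integral>s. (norm (?Y (b, s)))\<^sup>2 \<partial>?K) \<in> borel_measurable Q"
        using QK.integrable_fst'[OF Y_sq_int] by simp
    qed measurable
    finally show ?thesis by simp
  qed
  have bias: "(norm (?g - F' y))\<^sup>2 \<le> ?d / 4 * LF\<^sup>2 * \<nu>\<^sup>2"
  proof -
    have "?g - F' y = (\<integral>b. G b - F' y \<partial>Q)"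
      using G_int by (simp add: g_mean Q.prob_space)
    also have "norm \<dots> \<le> (\<integral>b. norm (G b - F' y) \<partial>Q)"
      by (rule integral_norm_bound)
    also have "\<dots> \<le> (\<integral>b. r \<partial>Q)"
      using G_int ae_Q G_near by (intro integral_mono_AE) auto
    finally have "norm (?g - F' y) \<le> r" by (simp add: Q.prob_space)
    then show ?thesis unfolding r(1)[symmetric] by (intro power_mono) auto
  qed
  \<comment> \<open>Jensen is applied to the random basis alone; the average over the draws is
    already an equality in \<open>g_sq\<close>.\<close>
  have second: "?d / real N * (norm (?g))\<^sup>2 \<le> g_sq P f m N \<nu> D y"
    unfolding g_sq g_mean
    by (intro mult_left_mono Q.norm_expectation_squared_le(2) G_sq_int) auto
  have third: "(\<integral>\<^sup>+u. ennreal (g_var P f m N \<nu> u y) \<partial>D)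
      \<le> ennreal (?d / real N * (2 * (\<beta>1 * (norm (F' y))\<^sup>2 + \<beta>2) + 2 * ?d * Lf\<^sup>2 * \<nu>\<^sup>2))"
      (is "_ \<le> ennreal ?bd")
  proof -
    let ?h = "\<lambda>\<zeta> y. f y \<zeta> - F y" and ?w = "\<lambda>\<zeta>. f' y \<zeta> - F' y"
    let ?\<psi> = "\<lambda>u. \<integral>\<^sup>+\<zeta>. ennreal ((norm (grad_est m N \<nu> u (?h \<zeta>) y))\<^sup>2) \<partial>P"
    have \<psi>_meas [measurable]: "?\<psi> \<in> borel_measurable (dir_space N)"
      unfolding grad_est_def by measurable
    have \<psi>_avg: "(\<integral>\<^sup>+s. ?\<psi> (?T b s) \<partial>?K) \<le> ennreal ?bd" if b: "orthonormal b" for b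
    proof -
      have "(\<integral>\<^sup>+s. ?\<psi> (?T b s) \<partial>?K)
          = (\<integral>\<^sup>+\<zeta>. \<integral>\<^sup>+s. ennreal ((norm (?est (?T b s) (?h \<zeta>) y))\<^sup>2) \<partial>?K \<partial>P)"
      proof -
        define X where "X s \<zeta> = ennreal ((norm (?est (?T b s) (?h \<zeta>) y))\<^sup>2)" for s \<zeta>
        have X_meas [measurable]: "X s \<in> borel_measurable P" for s
          unfolding X_def grad_est_def by measurable
        have "(\<integral>\<^sup>+s. \<integral>\<^sup>+\<zeta>. X s \<zeta> \<partial>P \<partial>?K) = (\<Sum>s\<in>S. \<integral>\<^sup>+\<zeta>. X s \<zeta> \<partial>P) / card S"
          using S by (simp add: nn_integral_pmf_of_set)
        also have "\<dots> = (\<integral>\<^sup>+\<zeta>. (\<Sum>s\<in>S. X s \<zeta>) / card S \<partial>P)"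
          by (simp add: nn_integral_divide nn_integral_sum)
        also have "\<dots> = (\<integral>\<^sup>+\<zeta>. \<integral>\<^sup>+s. X s \<zeta> \<partial>?K \<partial>P)"
          using S by (simp add: nn_integral_pmf_of_set)
        finally show ?thesis by (simp add: X_def)
      qed
      also have "\<dots> \<le> (\<integral>\<^sup>+\<zeta>. ennreal (2 * ?d / real N * (norm (?w \<zeta>))\<^sup>2
              + ?d / real N * (2 * ?d * Lf\<^sup>2 * \<nu>\<^sup>2)) \<partial>P)"
      proof (rule nn_integral_mono)
        fix \<zeta> assume \<zeta>: "\<zeta> \<in> space P"
        have "(\<integral>\<^sup>+s. ennreal ((norm (?est (?T b s) (?h \<zeta>) y))\<^sup>2) \<partial>?K)
            = ennreal ((\<Sum>s\<in>S. (norm (?est (?T b s) (?h \<zeta>) y))\<^sup>2) / card S)"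
          using S by (simp add: nn_integral_pmf_of_set sum_nonneg divide_ennreal[symmetric] card_gt_0_iff
              ennreal_of_nat_eq_real_of_nat)
        also have "\<dots> = ennreal (?d / real N * (\<Sum>i<CARD('d). (diff_quot \<nu> (?h \<zeta>) y (b i))\<^sup>2))"
          by (simp only: avg_sq[OF b])
        also have "\<dots> \<le> ennreal (?d / real N * (2 * (norm (?w \<zeta>))\<^sup>2 + 2 * ?d * Lf\<^sup>2 * \<nu>\<^sup>2))"
        proof (intro ennreal_leI mult_left_mono)
          have "(\<Sum>i<CARD('d). (diff_quot \<nu> (?h \<zeta>) y (b i))\<^sup>2)
              \<le> (\<Sum>i<CARD('d). 2 * (?w \<zeta> \<bullet> b i)\<^sup>2 + 2 * Lf\<^sup>2 * \<nu>\<^sup>2)"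
          proof (rule sum_mono)
            fix i assume "i \<in> {..<CARD('d)}"
            then have "norm (b i) = 1" using b by (simp add: orthonormal_def norm_eq_sqrt_inner)
            then show "(diff_quot \<nu> (?h \<zeta>) y (b i))\<^sup>2 \<le> 2 * (?w \<zeta> \<bullet> b i)\<^sup>2 + 2 * Lf\<^sup>2 * \<nu>\<^sup>2"
              using diff_quot_square_le[where h = "?h \<zeta>", OF noise_taylor[OF \<zeta>, of y] \<nu>, of "b i"]
              by (simp add: inner_commute)
          qed
          also have "\<dots> = 2 * (norm (?w \<zeta>))\<^sup>2 + 2 * ?d * Lf\<^sup>2 * \<nu>\<^sup>2"
            using orthonormal_Parseval[OF b, of "?w \<zeta>"]
            by (simp add: sum.distrib sum_distrib_left[symmetric])
          finally show "(\<Sum>i<CARD('d). (diff_quot \<nu> (?h \<zeta>) y (b i))\<^sup>2)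
              \<le> 2 * (norm (?w \<zeta>))\<^sup>2 + 2 * ?d * Lf\<^sup>2 * \<nu>\<^sup>2" .
        qed simp
        finally show "(\<integral>\<^sup>+s. ennreal ((norm (?est (?T b s) (?h \<zeta>) y))\<^sup>2) \<partial>?K)
            \<le> ennreal (2 * ?d / real N * (norm (?w \<zeta>))\<^sup>2 + ?d / real N * (2 * ?d * Lf\<^sup>2 * \<nu>\<^sup>2))"
          by (simp add: distrib_left mult_ac)
      qed
      also have "\<dots> \<le> ennreal (2 * ?d / real N * (\<beta>1 * (norm (F' y))\<^sup>2 + \<beta>2) + ?d / real N * (2 * ?d * Lf\<^sup>2 * \<nu>\<^sup>2))"
        by (rule noise_second_moment) simp_all
      also have "\<dots> = ennreal ?bd" by (rule arg_cong[where f = ennreal]) (simp add: algebra_simps)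
      finally show ?thesis .
    qed
    have "(\<integral>\<^sup>+u. ennreal (g_var P f m N \<nu> u y) \<partial>D) \<le> (\<integral>\<^sup>+u. ?\<psi> u \<partial>D)"
      by (intro nn_integral_mono g_var_le)
    also have "\<dots> = (\<integral>\<^sup>+z. ?\<psi> (case z of (b, s) \<Rightarrow> ?T b s) \<partial>(Q \<Otimes>\<^sub>M ?K))"
      unfolding D by (subst nn_integral_distr) auto
    also have "\<dots> = (\<integral>\<^sup>+b. \<integral>\<^sup>+s. ?\<psi> (?T b s) \<partial>?K \<partial>Q)"
      by (subst measure_pmf.nn_integral_fst[symmetric]) auto
    also have "\<dots> \<le> (\<integral>\<^sup>+b. ennreal ?bd \<partial>Q)"
      by (rule nn_integral_mono_AE, rule eventually_mono[OF ae_Q], rule \<psi>_avg)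
    also have "\<dots> = ennreal ?bd" by (simp add: Q.emeasure_space_1)
    finally show ?thesis .
  qed
  show ?thesis unfolding estimator_bounds_def using bias second third by simp
qed

end

text \<open>Exchanging the values \<open>i\<close> and \<open>i'\<close> maps the injective tuples
  with entry \<open>i\<close> at position \<open>j\<close> injectively to those with
  \<open>i'\<close> there. So every single draw is uniform, and summing over the \<open>N\<close>
  positions gives \<open>N / d\<close>.\<close>

lemma sum_draws_wo_replacement:
  fixes \<phi> :: "nat \<Rightarrow> real"
  assumes "N \<le> d" "0 < d"
  defines "S \<equiv> {s \<in> {..<N} \<rightarrow>\<^sub>E {..<d}. inj_on s {..<N}}"
  shows "finite S" "S \<noteq> {}"
    and "(\<Sum>s\<in>S. \<Sum>j<N. \<phi> (s j)) / card S = real N / d * (\<Sum>i<d. \<phi> i)"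
proof -
  show fin: "finite S"
    unfolding S_def by (rule finite_subset[OF _ finite_PiE[of "{..<N}" "\<lambda>_. {..<d}"]]) auto
  have "(\<lambda>j\<in>{..<N}. j) \<in> S" using assms(1) by (auto simp: S_def inj_on_def)
  then show ne: "S \<noteq> {}" by blast
  \<comment> \<open>One inequality is enough: with \<open>i\<close> and \<open>i'\<close>
    interchanged it gives equality of the cardinalities.\<close>
  have le: "card {s \<in> S. s j = i} \<le> card {s \<in> S. s j = i'}"
    if "j < N" "i < d" "i' < d" for i i' j
  proof (rule card_inj_on_le)
    let ?\<tau> = "\<lambda>s. \<lambda>j\<in>{..<N}. Transposition.transpose i i' (s j)"
    have \<tau>_inj: "u = w" if "Transposition.transpose i i' u = Transposition.transpose i i' w" for u w
      using arg_cong[OF that, of "Transposition.transpose i i'"] by simp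
    show "inj_on ?\<tau> {s \<in> S. s j = i}"
    proof (rule inj_onI)
      fix s t assume s: "s \<in> {s \<in> S. s j = i}" and t: "t \<in> {s \<in> S. s j = i}" and eq: "?\<tau> s = ?\<tau> t"
      show "s = t"
      proof (rule PiE_ext)
        show "s \<in> {..<N} \<rightarrow>\<^sub>E {..<d}" "t \<in> {..<N} \<rightarrow>\<^sub>E {..<d}" using s t by (auto simp: S_def)
        fix k assume "k \<in> {..<N}"
        then have "Transposition.transpose i i' (s k) = Transposition.transpose i i' (t k)"
          using fun_cong[OF eq, of k] by simp
        then show "s k = t k" by (rule \<tau>_inj)
      qed
    qed
    show "?\<tau> ` {s \<in> S. s j = i} \<subseteq> {s \<in> S. s j = i'}"
    proof (rule image_subsetI)
      fix s assume s: "s \<in> {s \<in> S. s j = i}"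
      then have inj: "inj_on s {..<N}" and ran: "\<And>k. k < N \<Longrightarrow> s k < d" by (auto simp: S_def)
      have "inj_on (?\<tau> s) {..<N}"
      proof (rule inj_onI)
        fix k l assume kl: "k \<in> {..<N}" "l \<in> {..<N}" "?\<tau> s k = ?\<tau> s l"
        then have "s k = s l" using \<tau>_inj[of "s k" "s l"] by simp
        then show "k = l" using inj kl by (auto dest: inj_onD)
      qed
      moreover have "?\<tau> s \<in> {..<N} \<rightarrow>\<^sub>E {..<d}"
        using ran that by (auto simp: Transposition.transpose_def)
      ultimately show "?\<tau> s \<in> {s \<in> S. s j = i'}" using s that by (auto simp: S_def)
    qed
    show "finite {s \<in> S. s j = i'}" using fin by simp
  qed
  have draw: "(\<Sum>s\<in>S. \<phi> (s j)) = card S / d * (\<Sum>i<d. \<phi> i)" if j: "j < N" for j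
  proof -
    have eq: "card {s \<in> S. s j = i} = card {s \<in> S. s j = 0}" if "i < d" for i
      using le[OF j that assms(2)] le[OF j assms(2) that] by simp
    have group: "(\<Sum>s\<in>S. g (s j)) = (\<Sum>i<d. g i) * card {s \<in> S. s j = 0}" for g :: "nat \<Rightarrow> real"
    proof -
      have "(\<lambda>s. s j) ` S \<subseteq> {..<d}" using j by (auto simp: S_def)
      then have "(\<Sum>s\<in>S. g (s j)) = (\<Sum>i<d. \<Sum>s\<in>{s \<in> S. s j = i}. g (s j))"
        using sum.group[OF fin, of "{..<d}" "\<lambda>s. s j" "\<lambda>s. g (s j)"] by simp
      also have "\<dots> = (\<Sum>i<d. g i * card {s \<in> S. s j = i})"
        by (intro sum.cong refl) simp
      also have "\<dots> = (\<Sum>i<d. g i * card {s \<in> S. s j = 0})"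
        by (intro sum.cong refl arg_cong2[where f = "(*)"] arg_cong[where f = real] eq) simp
      also have "\<dots> = (\<Sum>i<d. g i) * card {s \<in> S. s j = 0}"
        by (rule sum_distrib_right[symmetric])
      finally show ?thesis .
    qed
    have "real (card S) = d * card {s \<in> S. s j = 0}" using group[of "\<lambda>_. 1"] by simp
    then show ?thesis using group[of \<phi>] assms(2) by simp
  qed
  have "(\<Sum>s\<in>S. \<Sum>j<N. \<phi> (s j)) = (\<Sum>j<N. \<Sum>s\<in>S. \<phi> (s j))" by (rule sum.swap)
  also have "\<dots> = real N * (card S / d * (\<Sum>i<d. \<phi> i))" using draw by simp
  finally show "(\<Sum>s\<in>S. \<Sum>j<N. \<phi> (s j)) / card S = real N / d * (\<Sum>i<d. \<phi> i)"
    using fin ne by (simp add: card_gt_0_iff)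
qed

lemma orthonormal_Basis_enumeration:
  fixes e :: "nat \<Rightarrow> real ^ 'd"
  assumes "bij_betw e {..<CARD('d)} Basis"
  shows "orthonormal e"
  unfolding orthonormal_def
proof (intro allI impI)
  fix i j assume ij: "i < CARD('d)" "j < CARD('d)"
  have "e i \<in> Basis" "e j \<in> Basis" using assms ij by (auto dest: bij_betwE)
  moreover have "e i = e j \<longleftrightarrow> i = j"
    using assms ij by (auto simp: bij_betw_def dest: inj_onD)
  ultimately show "e i \<bullet> e j = (if i = j then 1 else 0)" by (simp add: inner_Basis)
qed

lemma return_orthonormal_basis:
  fixes e :: "nat \<Rightarrow> real ^ 'd"
  assumes e: "bij_betw e {..<CARD('d)} Basis"
  defines "b \<equiv> restrict e {..<CARD('d)}"
  shows "b \<in> space (dir_space CARD('d))" "AE b in return (dir_space CARD('d)) b. orthonormal b"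
proof -
  show b: "b \<in> space (dir_space CARD('d))" by (simp add: b_def space_PiM)
  have "orthonormal b"
    using orthonormal_Basis_enumeration[OF e] by (simp add: b_def orthonormal_def)
  \<comment> \<open>Being orthonormal is reduced to the event \<open>c = b\<close>, which is
    measurable because the singleton is a finite product of closed singletons.\<close>
  moreover have "{b} \<in> sets (dir_space CARD('d))"
  proof -
    have "{b} = (\<Pi>\<^sub>E i\<in>{..<CARD('d)}. {b i})"
      by (subst PiE_singleton) (auto simp: b_def)
    moreover have "(\<Pi>\<^sub>E i\<in>{..<CARD('d)}. {b i}) \<in> sets (dir_space CARD('d))"
      by (rule sets_PiM_I_finite) auto
    ultimately show ?thesis by simp
  qed
  then have "AE c in return (dir_space CARD('d)) b. c = b"
    using b by (subst AE_return) (auto simp: pred_def Collect_conv_if Int_def)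
  ultimately show "AE b in return (dir_space CARD('d)) b. orthonormal b"
    by (auto elim: eventually_mono)
qed

lemma subbasis_law_fixed_basis:
  fixes e :: "nat \<Rightarrow> real ^ 'd" and D :: "(nat \<Rightarrow> real ^ 'd) measure"
  assumes e: "bij_betw e {..<CARD('d)} Basis"
    and S: "finite S" "S \<noteq> {}" "\<And>s. s \<in> S \<Longrightarrow> s ` {..<N} \<subseteq> {..<CARD('d)} \<and> inj_on s {..<N}"
    and unif: "\<And>\<phi>::nat \<Rightarrow> real. (\<Sum>s\<in>S. \<Sum>j<N. \<phi> (s j)) / card S = real N / CARD('d) * (\<Sum>i<CARD('d). \<phi> i)"
    and D: "D = distr (measure_pmf (pmf_of_set S)) (dir_space N) (\<lambda>s. \<lambda>j\<in>{..<N}. e (s j))"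
  shows "subbasis_law N S (return (dir_space CARD('d)) (restrict e {..<CARD('d)})) D"
proof -
  let ?b = "restrict e {..<CARD('d)}" and ?K = "measure_pmf (pmf_of_set S)"
  have meas: "(\<lambda>(b, s). \<lambda>j\<in>{..<N}. b (s j)) \<in> dir_space CARD('d) \<Otimes>\<^sub>M ?K \<rightarrow>\<^sub>M (dir_space N :: (nat \<Rightarrow> real ^ 'd) measure)"
    by (rule subbasis_map_measurable) simp
  have "distr (return (dir_space CARD('d)) ?b \<Otimes>\<^sub>M ?K) (dir_space N) (\<lambda>(b, s). \<lambda>j\<in>{..<N}. b (s j))
      = distr ?K (dir_space N) (\<lambda>s. \<lambda>j\<in>{..<N}. ?b (s j))"
    by (subst distr_return_pair[OF _ return_orthonormal_basis(1)[OF e] meas])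
      (auto intro: prob_space_imp_sigma_finite prob_space_measure_pmf)
  also have "\<dots> = D"
    unfolding D
  proof (rule distr_cong_AE)
    show "AE s in ?K. (\<lambda>j\<in>{..<N}. ?b (s j)) = (\<lambda>j\<in>{..<N}. e (s j))"
      using S by (auto simp: AE_measure_pmf_iff fun_eq_iff)
  qed (auto simp: space_PiM)
  finally show ?thesis
    unfolding subbasis_law_def
    using S unif return_orthonormal_basis[OF e] by (auto intro!: prob_space_return)
qed

lemma direction_law_subbasis:
  fixes D :: "(nat \<Rightarrow> real ^ 'd) measure"
  assumes law: "direction_law m N D" and m: "m \<in> {FD, RC, RS}"
  shows "\<exists>S Q. subbasis_law N S Q D"
proof -
  let ?S = "{s \<in> {..<N} \<rightarrow>\<^sub>E {..<CARD('d)}. inj_on s {..<N}}"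
  consider "m = FD" | "m = RC" | "m = RS" using m by blast
  then show ?thesis
  proof cases
    case 1
    then obtain e where N: "N = CARD('d)" and e: "bij_betw e {..<CARD('d)} (Basis :: (real ^ 'd) set)"
      and D: "D = return (dir_space N) (restrict e {..<N})"
      using law by auto
    \<comment> \<open>\<open>FD\<close> takes the whole basis: the identity tuple alone covers each
      index once.\<close>
    let ?s = "\<lambda>j. j :: nat"
    have "D = distr (measure_pmf (pmf_of_set {?s})) (dir_space N) (\<lambda>s. \<lambda>j\<in>{..<N}. e (s j))"
      unfolding D pmf_of_set_singleton return_pmf.rep_eq
      by (subst distr_return) (auto simp: space_PiM)
    then have "subbasis_law N {?s} (return (dir_space CARD('d)) (restrict e {..<CARD('d)})) D"
      by (intro subbasis_law_fixed_basis[OF e]) (auto simp: N)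
    then show ?thesis by blast
  next
    case 2
    then obtain e where N: "N \<le> CARD('d)" and e: "bij_betw e {..<CARD('d)} (Basis :: (real ^ 'd) set)"
      and D: "D = distr (measure_pmf (draws_wo_replacement CARD('d) N)) (dir_space N)
                (\<lambda>s. \<lambda>j\<in>{..<N}. e (s j))"
      using law by auto
    have "subbasis_law N ?S (return (dir_space CARD('d)) (restrict e {..<CARD('d)})) D"
      using sum_draws_wo_replacement[OF N] D
      by (intro subbasis_law_fixed_basis[OF e]) (auto simp: draws_wo_replacement_def)
    then show ?thesis by blast
  next
    case 3
    then obtain Q where N: "N \<le> CARD('d)" and "prob_space Q"
      "sets Q = sets (dir_space CARD('d) :: (nat \<Rightarrow> real ^ 'd) measure)"
      "AE b in Q. \<forall>i<CARD('d). \<forall>j<CARD('d). b i \<bullet> b j = (if i = j then 1 else 0)"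
      "D = distr (Q \<Otimes>\<^sub>M measure_pmf (draws_wo_replacement CARD('d) N)) (dir_space N)
                (\<lambda>(b, s). \<lambda>j\<in>{..<N}. b (s j))"
      using law by auto
    then have "subbasis_law N ?S Q D"
      unfolding subbasis_law_def using sum_draws_wo_replacement[OF N]
      by (auto simp: draws_wo_replacement_def orthonormal_def)
    then show ?thesis by blast
  qed
qed

section \<open>Coefficients of the three bounds for all five methods\<close>

fun variance_inflation :: "estimator \<Rightarrow> nat \<Rightarrow> nat \<Rightarrow> real" where
  "variance_inflation GS d N = 1"
| "variance_inflation SS d N = 1"
| "variance_inflation _ d N = real d / real N"

text \<open>The coefficients of \<open>GS\<close> and \<open>SS\<close> here and below come from the
  moment conditions of the isotropic case. For \<open>GS\<close>, \<open>6 * d\<close> is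
  \<open>2 * (3 * d\<^sup>2) / d\<close>, \<open>30 * d ^ 3\<close> is twice the sixth-moment bound
  and \<open>3 * d\<close> is the square of \<open>sqrt (3 * d)\<close>. For \<open>SS\<close> all
  norm moments are 1 and \<open>c = d\<close>.\<close>

fun noise_coeff :: "estimator \<Rightarrow> real \<Rightarrow> real" where
  "noise_coeff GS d = 6 * d"
| "noise_coeff SS d = 2 * d"
| "noise_coeff _ d = 2"

fun smoothing_coeff :: "estimator \<Rightarrow> real \<Rightarrow> real" where
  "smoothing_coeff GS d = 30 * d ^ 3"
| "smoothing_coeff SS d = 2 * d\<^sup>2"
| "smoothing_coeff _ d = 2 * d"

fun bias_coeff :: "estimator \<Rightarrow> real \<Rightarrow> real" where
  "bias_coeff GS d = 3 * d"
| "bias_coeff SS d = 1"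
| "bias_coeff _ d = d / 4"

lemma (in stochastic_problem) direction_law_estimator_bounds:
  fixes D :: "(nat \<Rightarrow> real ^ 'd) measure"
  assumes law: "direction_law m N D" and N: "0 < N" and \<nu>: "0 < \<nu>"
  shows "estimator_bounds m N \<nu> D y (variance_inflation m CARD('d) N) (noise_coeff m CARD('d))
           (smoothing_coeff m CARD('d)) (bias_coeff m CARD('d))"
proof -
  have subbasis: ?thesis if m: "m \<in> {FD, RC, RS}"
  proof -
    obtain S Q where "subbasis_law N S Q D" using direction_law_subbasis[OF law m] by blast
    \<comment> \<open>For \<open>FD\<close> the scaling 1 has this form because \<open>N\<close> is
      the dimension.\<close>
    moreover have "scaling m CARD('d) N = real CARD('d) / real N"
      using m law N by auto
    ultimately have "estimator_bounds m N \<nu> D y (CARD('d) / real N) 2 (2 * CARD('d)) (CARD('d) / 4)"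
      using N \<nu> by (intro subbasis_estimator_bounds) auto
    then show ?thesis using m by auto
  qed
  have gaussian: ?thesis if m: "m = GS"
  proof -
    have "estimator_bounds m N \<nu> D y 1 (6 * CARD('d)) (30 * real CARD('d) ^ 3) (3 * CARD('d))"
      using law N \<nu> m std_gaussian_norm_moments[where 'd = 'd]
      by (intro isotropic_estimator_bounds[OF std_gaussian_isotropic, where c = 1])
        (auto simp: power2_eq_square)
    then show ?thesis by (simp add: m)
  qed
  have sphere: ?thesis if m: "m = SS"
  proof -
    have "estimator_bounds m N \<nu> D y 1 (2 * CARD('d)) (2 * (real CARD('d))\<^sup>2) 1"
      using law N \<nu> m
      by (intro isotropic_estimator_bounds[OF uniform_sphere_isotropic, where c = "CARD('d)"])
        (auto simp: uniform_sphere_norm_moment, simp_all add: power2_eq_square)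
    then show ?thesis by (simp add: m)
  qed
  show ?thesis using subbasis gaussian sphere by (cases m) auto
qed

section \<open>Conditioning on the past\<close>

text \<open>Freezing lemma: independence makes the joint law of the past and \<open>U\<close> a
  product measure, so on every event of \<open>H\<close> the variable \<open>U\<close> can be
  integrated out by Tonelli.\<close>

lemma (in prob_space) nn_cond_exp_indep:
  assumes sub: "subalgebra M H" and U [measurable]: "U \<in> M \<rightarrow>\<^sub>M D"
    and indep: "indep_set (sets H) (sets (vimage_algebra (space M) U D))"
    and \<phi> [measurable]: "\<phi> \<in> borel_measurable (H \<Otimes>\<^sub>M D)"
  shows "AE \<omega> in M. (\<integral>\<^sup>+u. \<phi> (\<omega>, u) \<partial>distr M D U) = nn_cond_exp M H (\<lambda>\<omega>. \<phi> (\<omega>, U \<omega>)) \<omega>"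
proof -
  have "finite_measure_subalgebra M H"
    using sub by unfold_locales
  then interpret sigma_finite_subalgebra M H by (rule finite_measure_subalgebra_is_sigma_finite)
  interpret DU: prob_space "distr M D U" by (rule prob_space_distr[OF U])
  have id [measurable]: "(\<lambda>\<omega>. \<omega>) \<in> M \<rightarrow>\<^sub>M H"
    using sub by (auto simp: subalgebra_def measurable_def)
  have space_H: "space H = space M" using sub by (simp add: subalgebra_def)
  have UM: "U \<in> space M \<rightarrow> space D" using measurable_space[OF U] by blast
  interpret id: prob_space "distr M H (\<lambda>\<omega>. \<omega>)" by (rule prob_space_distr[OF id])
  \<comment> \<open>The past is represented by the identity map from \<open>M\<close> to
    \<open>H\<close>, whose law is the restriction of \<open>M\<close> to the smaller
    sigma-algebra.\<close>
  have joint: "distr M H (\<lambda>\<omega>. \<omega>) \<Otimes>\<^sub>M distr M D U = distr M (H \<Otimes>\<^sub>M D) (\<lambda>\<omega>. (\<omega>, U \<omega>))"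
  proof (rule pair_measure_eqI)
    show "sigma_finite_measure (distr M H (\<lambda>\<omega>. \<omega>))" "sigma_finite_measure (distr M D U)"
      by unfold_locales
    show "sets (distr M H (\<lambda>\<omega>. \<omega>) \<Otimes>\<^sub>M distr M D U) = sets (distr M (H \<Otimes>\<^sub>M D) (\<lambda>\<omega>. (\<omega>, U \<omega>)))"
      by (simp cong: sets_pair_measure_cong)
    fix A B assume "A \<in> sets (distr M H (\<lambda>\<omega>. \<omega>))" "B \<in> sets (distr M D U)"
    then have A [measurable]: "A \<in> sets H" and B [measurable]: "B \<in> sets D" by simp_all
    have AM: "A \<in> events" using A sub by (auto simp: subalgebra_def)
    have "U -` B \<inter> space M \<in> sets (vimage_algebra (space M) U D)" by (rule in_vimage_algebra[OF B])
    then have "prob (A \<inter> (U -` B \<inter> space M)) = prob A * prob (U -` B \<inter> space M)"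
      by (rule indep_setD[OF indep A])
    then have "emeasure M (A \<inter> (U -` B \<inter> space M)) = emeasure M A * emeasure M (U -` B \<inter> space M)"
      by (simp add: emeasure_eq_measure ennreal_mult)
    moreover have "(\<lambda>\<omega>. (\<omega>, U \<omega>)) -` (A \<times> B) \<inter> space M = A \<inter> (U -` B \<inter> space M)" by auto
    moreover have "(\<lambda>\<omega>. \<omega>) -` A \<inter> space M = A" using sets.sets_into_space[OF AM] by auto
    ultimately show "emeasure (distr M H (\<lambda>\<omega>. \<omega>)) A * emeasure (distr M D U) B
        = emeasure (distr M (H \<Otimes>\<^sub>M D) (\<lambda>\<omega>. (\<omega>, U \<omega>))) (A \<times> B)"
      by (simp add: emeasure_distr)
  qed
  have \<phi>': "\<phi> \<in> borel_measurable (H \<Otimes>\<^sub>M distr M D U)"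
    by (simp cong: measurable_cong_sets)
  have g_meas [measurable]: "(\<lambda>\<omega>. \<integral>\<^sup>+u. \<phi> (\<omega>, u) \<partial>distr M D U) \<in> borel_measurable H"
    by (rule DU.borel_measurable_nn_integral_fst[OF \<phi>'])
  show ?thesis
  proof (rule nn_cond_exp_charact[OF _ _ g_meas])
    show "(\<lambda>\<omega>. \<phi> (\<omega>, U \<omega>)) \<in> borel_measurable M" by measurable
    fix A assume A [measurable]: "A \<in> sets H"
    have "(\<integral>\<^sup>+\<omega>\<in>A. \<phi> (\<omega>, U \<omega>) \<partial>M) = (\<integral>\<^sup>+z. \<phi> z * indicator A (fst z) \<partial>distr M (H \<Otimes>\<^sub>M D) (\<lambda>\<omega>. (\<omega>, U \<omega>)))"
      by (subst nn_integral_distr) auto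
    also have "\<dots> = (\<integral>\<^sup>+z. \<phi> z * indicator A (fst z) \<partial>(distr M H (\<lambda>\<omega>. \<omega>) \<Otimes>\<^sub>M distr M D U))"
      by (simp add: joint)
    also have "\<dots> = (\<integral>\<^sup>+\<omega>. \<integral>\<^sup>+u. \<phi> (\<omega>, u) * indicator A \<omega> \<partial>distr M D U \<partial>distr M H (\<lambda>\<omega>. \<omega>))"
      by (subst DU.nn_integral_fst[symmetric]) (auto cong: measurable_cong_sets)
    also have "\<dots> = (\<integral>\<^sup>+\<omega>. \<integral>\<^sup>+u. \<phi> (\<omega>, u) * indicator A \<omega> \<partial>distr M D U \<partial>M)"
      by (rule nn_integral_distr[OF id])
        (rule DU.borel_measurable_nn_integral, simp add: case_prod_beta cong: measurable_cong_sets)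
    also have "\<dots> = (\<integral>\<^sup>+\<omega>\<in>A. (\<integral>\<^sup>+u. \<phi> (\<omega>, u) \<partial>distr M D U) \<partial>M)"
    proof (rule nn_integral_cong)
      fix \<omega> assume "\<omega> \<in> space M"
      then have "(\<lambda>u. \<phi> (\<omega>, u)) \<in> borel_measurable (distr M D U)"
        using measurable_compose[OF measurable_Pair1'[of \<omega> H] \<phi>'] by (simp add: space_H)
      then show "(\<integral>\<^sup>+u. \<phi> (\<omega>, u) * indicator A \<omega> \<partial>distr M D U) =
          (\<integral>\<^sup>+u. \<phi> (\<omega>, u) \<partial>distr M D U) * indicator A \<omega>"
        by (rule nn_integral_multc)
    qed
    finally show "(\<integral>\<^sup>+\<omega>\<in>A. \<phi> (\<omega>, U \<omega>) \<partial>M) = (\<integral>\<^sup>+\<omega>\<in>A. (\<integral>\<^sup>+u. \<phi> (\<omega>, u) \<partial>distr M D U) \<partial>M)" .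
  qed
qed

section \<open>The sigma-algebras of the past\<close>

lemma sets_vimage_algebra_Pow: "sets (vimage_algebra X g N) \<subseteq> Pow X"
  using sets.space_closed[of "vimage_algebra X g N"] by simp

lemma history_generators:
  "(\<Union>i<k. sets (vimage_algebra (space M) (U i) D)) \<union>
     (\<Union>i<l. \<Union>j. sets (vimage_algebra (space M) (Z i j) P)) \<subseteq> Pow (space M)"
  by (intro Un_least UN_least sets_vimage_algebra_Pow)

lemma space_history [simp]: "space (history M D P U Z k l) = space M"
  unfolding history_def by (rule space_measure_of[OF history_generators])

lemma sets_history:
  "sets (history M D P U Z k l) = sigma_sets (space M)
     ((\<Union>i<k. sets (vimage_algebra (space M) (U i) D)) \<union>
      (\<Union>i<l. \<Union>j. sets (vimage_algebra (space M) (Z i j) P)))"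
  unfolding history_def by (rule sets_measure_of[OF history_generators])

lemma subalgebra_history_mono:
  assumes "k \<le> k'" "l \<le> l'"
  shows "subalgebra (history M D P U Z k' l') (history M D P U Z k l)"
  unfolding subalgebra_def
proof
  show "sets (history M D P U Z k l) \<subseteq> sets (history M D P U Z k' l')"
    unfolding sets_history using assms by (intro sigma_sets_mono' Un_mono UN_mono) auto
qed simp

lemma history_directions_measurable:
  assumes "i < k" and "U i \<in> space M \<rightarrow> space D"
  shows "U i \<in> history M D P U Z k l \<rightarrow>\<^sub>M D"
proof (rule measurableI)
  fix A assume "A \<in> sets D"
  then have "U i -` A \<inter> space M \<in> sets (vimage_algebra (space M) (U i) D)"
    by (rule in_vimage_algebra)
  then show "U i -` A \<inter> space (history M D P U Z k l) \<in> sets (history M D P U Z k l)"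
    unfolding sets_history space_history using assms(1) by (intro sigma_sets.Basic) auto
qed (use assms in auto)

lemma history_samples_measurable:
  assumes "i < l" and "Z i j \<in> space M \<rightarrow> space P"
  shows "Z i j \<in> history M D P U Z k l \<rightarrow>\<^sub>M P"
proof (rule measurableI)
  fix A assume "A \<in> sets P"
  then have "Z i j -` A \<inter> space M \<in> sets (vimage_algebra (space M) (Z i j) P)"
    by (rule in_vimage_algebra)
  then show "Z i j -` A \<inter> space (history M D P U Z k l) \<in> sets (history M D P U Z k l)"
    unfolding sets_history space_history using assms(1) by (intro sigma_sets.Basic) auto
qed (use assms in auto)

lemma subalgebra_history:
  assumes U: "\<And>i. U i \<in> M \<rightarrow>\<^sub>M D" and Z: "\<And>i j. Z i j \<in> M \<rightarrow>\<^sub>M P"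
  shows "subalgebra M (history M D P U Z k l)"
  unfolding subalgebra_def
proof
  have "sets (vimage_algebra (space M) (U i) D) \<subseteq> sets M" for i
    using measurable_sets[OF U] measurable_space[OF U] by (subst sets_vimage_algebra2) auto
  moreover have "sets (vimage_algebra (space M) (Z i j) P) \<subseteq> sets M" for i j
    using measurable_sets[OF Z] measurable_space[OF Z] by (subst sets_vimage_algebra2) auto
  ultimately show "sets (history M D P U Z k l) \<subseteq> sets M"
    unfolding sets_history by (intro sets.sigma_sets_subset) blast
qed simp

section \<open>Sample sizes\<close>

text \<open>Since \<open>s\<close> is positive, some size is admissible, so the minimality in
  \<open>chosen_by\<close> takes effect and \<open>n - 1\<close> violates the condition. The summand
  1 is the price of rounding up.\<close>

lemma chosen_by_le:
  assumes chosen: "chosen_by (\<lambda>k. v / real k \<le> s) n" and n: "0 < n" and s: "0 < s" and v: "0 \<le> v"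
  shows "real n \<le> 1 + v / s"
\<comment> \<open>For \<open>n = 1\<close> the predecessor is 0, which minimality does not exclude:
  with division by zero the condition even holds there.\<close>
proof (cases "n = 1")
  case True
  then show ?thesis using s v by simp
next
  case False
  with n have n1: "0 < n - 1" "n - 1 < n" by auto
  obtain k :: nat where k: "v / s < real k" using reals_Archimedean2 by blast
  moreover have "0 \<le> v / s" using s v by simp
  ultimately have "0 < real k" by linarith
  then have "0 < k" by simp
  moreover have "v / real k \<le> s" using k s \<open>0 < k\<close> by (simp add: field_simps)
  ultimately have "\<not> v / real (n - 1) \<le> s" using chosen n1 unfolding chosen_by_def by blast
  then have "real (n - 1) < v / s" using n1 s by (simp add: field_simps)
  then show ?thesis using n by simp
qed

text \<open>The 1 comes from rounding up, the factor 2 from \<open>norm (F' y) ^ 2 \<le> 2 * norm g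
  ^ 2 + 2 * norm (g - F' y) ^ 2\<close>. The bias part of this estimate moves to
  \<open>size_b2\<close>.\<close>

definition size_b1 :: "estimator \<Rightarrow> real \<Rightarrow> real \<Rightarrow> real \<Rightarrow> real" where [simp]:
  "size_b1 m d \<theta> \<beta>1 = 1 + 2 * noise_coeff m d * \<beta>1 / \<theta>\<^sup>2"

definition size_b2 :: "estimator \<Rightarrow> real \<Rightarrow> real \<Rightarrow> real \<Rightarrow> real \<Rightarrow> real \<Rightarrow> real \<Rightarrow> real" where [simp]:
  "size_b2 m d \<theta> \<beta>1 \<beta>2 Lf \<nu> =
     (2 * noise_coeff m d * \<beta>1 * bias_coeff m d * Lf\<^sup>2 * \<nu>\<^sup>2 + noise_coeff m d * \<beta>2
       + smoothing_coeff m d * Lf\<^sup>2 * \<nu>\<^sup>2) / \<theta>\<^sup>2"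

lemma coeff_nonneg:
  assumes "0 \<le> d"
  shows "0 \<le> noise_coeff m d" "0 \<le> smoothing_coeff m d" "0 \<le> bias_coeff m d"
  using assms by (cases m; simp)+

section \<open>From the three bounds to sample sizes\<close>

context stochastic_problem
begin

text \<open>After the true gradient is replaced by \<open>g\<close> plus the bias, the numerator has
  a part proportional to \<open>(norm g)\<^sup>2\<close>, which leaves a constant, and a part
  independent of it, which leaves a term of order \<open>1 / e\<close>.\<close>

lemma estimator_variance_ratio:
  assumes bounds: "(norm (g - F' y))\<^sup>2 \<le> C * LF\<^sup>2 * \<nu>\<^sup>2" "c * (norm g)\<^sup>2 \<le> s"
    and c: "0 < c" and \<theta>: "0 < \<theta>" and A: "0 \<le> A" "0 \<le> A'" and C: "0 \<le> C"
    and e: "0 < e" "e < (norm g)\<^sup>2"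
  shows "0 < \<theta>\<^sup>2 * s"
    and "c * (A * (\<beta>1 * (norm (F' y))\<^sup>2 + \<beta>2) + A' * Lf\<^sup>2 * \<nu>\<^sup>2) / (\<theta>\<^sup>2 * s)
           \<le> 2 * A * \<beta>1 / \<theta>\<^sup>2 + (2 * A * \<beta>1 * C * Lf\<^sup>2 * \<nu>\<^sup>2 + A * \<beta>2 + A' * Lf\<^sup>2 * \<nu>\<^sup>2) / \<theta>\<^sup>2 / e"
proof -
  define G where "G = (norm g)\<^sup>2"
  define \<Lambda> where "\<Lambda> = Lf\<^sup>2 * \<nu>\<^sup>2"
  define X where "X = A * (\<beta>1 * (2 * G + 2 * C * \<Lambda>) + \<beta>2) + A' * \<Lambda>"
  have G: "0 < G" unfolding G_def using e by linarith
  then have cG: "0 < c * G" using c by simp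
  then have s: "0 < s" using bounds(2) by (simp add: G_def)
  then show "0 < \<theta>\<^sup>2 * s" using \<theta> by simp
  have \<Lambda>: "0 \<le> \<Lambda>" by (simp add: \<Lambda>_def)
  have "(norm (F' y))\<^sup>2 \<le> (norm g + norm (g - F' y))\<^sup>2"
    using norm_triangle_sub[of "F' y" g] by (intro power_mono) (auto simp: norm_minus_commute)
  also have "\<dots> \<le> 2 * (norm g)\<^sup>2 + 2 * (norm (g - F' y))\<^sup>2"
    using zero_le_power2[of "norm g - norm (g - F' y)"] by (simp add: power2_eq_square algebra_simps)
  also have "\<dots> \<le> 2 * G + 2 * (C * LF\<^sup>2 * \<nu>\<^sup>2)" using bounds(1) by (simp add: G_def)
  \<comment> \<open>Passing from \<open>LF\<close> to \<open>Lf\<close> lets bias and curvature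
    share the single quantity \<open>\<Lambda>\<close>.\<close>
  also have "\<dots> \<le> 2 * G + 2 * C * \<Lambda>"
    using LF_pos LF_le C unfolding \<Lambda>_def
    by (simp add: mult.assoc) (intro mult_left_mono mult_right_mono power_mono; simp)
  finally have F': "(norm (F' y))\<^sup>2 \<le> 2 * G + 2 * C * \<Lambda>" .
  have X: "0 \<le> X" unfolding X_def using A G C \<Lambda> beta_nonneg by simp
  have "A * (\<beta>1 * (norm (F' y))\<^sup>2 + \<beta>2) + A' * Lf\<^sup>2 * \<nu>\<^sup>2 \<le> X"
    unfolding X_def \<Lambda>_def[symmetric] mult.assoc[of A' "Lf\<^sup>2"] using A F' beta_nonneg
    by (intro add_mono mult_left_mono) auto
  then have "c * (A * (\<beta>1 * (norm (F' y))\<^sup>2 + \<beta>2) + A' * Lf\<^sup>2 * \<nu>\<^sup>2) / (\<theta>\<^sup>2 * s) \<le> c * X / (\<theta>\<^sup>2 * s)"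
    using c s \<theta> by (intro divide_right_mono mult_left_mono) auto
  also have "\<dots> \<le> c * X / (\<theta>\<^sup>2 * (c * G))"
    using c X \<theta> cG bounds(2) s by (intro divide_left_mono mult_left_mono) (auto simp: G_def)
  also have "\<dots> = X / (\<theta>\<^sup>2 * G)" using c by simp
  also have "\<dots> = 2 * A * \<beta>1 / \<theta>\<^sup>2 + (2 * A * \<beta>1 * C * \<Lambda> + A * \<beta>2 + A' * \<Lambda>) / \<theta>\<^sup>2 / G"
  proof -
    have "X = 2 * A * \<beta>1 * G + (2 * A * \<beta>1 * C * \<Lambda> + A * \<beta>2 + A' * \<Lambda>)"
      by (simp add: X_def algebra_simps)
    then show ?thesis using G by (simp add: add_divide_distrib)
  qed
  also have "\<dots> \<le> 2 * A * \<beta>1 / \<theta>\<^sup>2 + (2 * A * \<beta>1 * C * \<Lambda> + A * \<beta>2 + A' * \<Lambda>) / \<theta>\<^sup>2 / e"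
    using e A C \<Lambda> beta_nonneg mult_pos_pos[OF G e(1)]
    by (intro add_left_mono divide_left_mono) (auto simp: G_def)
  finally show "c * (A * (\<beta>1 * (norm (F' y))\<^sup>2 + \<beta>2) + A' * Lf\<^sup>2 * \<nu>\<^sup>2) / (\<theta>\<^sup>2 * s)
           \<le> 2 * A * \<beta>1 / \<theta>\<^sup>2 + (2 * A * \<beta>1 * C * Lf\<^sup>2 * \<nu>\<^sup>2 + A * \<beta>2 + A' * Lf\<^sup>2 * \<nu>\<^sup>2) / \<theta>\<^sup>2 / e"
    by (simp add: \<Lambda>_def mult.assoc)
qed

text \<open>The second claim serves Condition 2, where the variance at the drawn directions is
  averaged afterwards; the third serves Condition 3, where the average is part of the
  condition.\<close>

lemma size_from_bounds:
  fixes D :: "(nat \<Rightarrow> real ^ 'd) measure"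
  assumes D: "prob_space D" "sets D = sets (dir_space N :: (nat \<Rightarrow> real ^ 'd) measure)"
    and law: "direction_law m N D" and N: "0 < N" and \<nu>: "0 < \<nu>" and \<theta>: "0 < \<theta>"
    and e: "0 < e" "e < (norm (g_mean P f m N \<nu> D y))\<^sup>2"
  defines "s \<equiv> \<theta>\<^sup>2 * g_sq P f m N \<nu> D y"
    and "b \<equiv> size_b1 m CARD('d) \<theta> \<beta>1 + size_b2 m CARD('d) \<theta> \<beta>1 \<beta>2 Lf \<nu> / e"
  shows "0 < s"
    and "(\<integral>\<^sup>+u. ennreal (1 + g_var P f m N \<nu> u y / s) \<partial>D) \<le> ennreal b"
    and "1 + (\<integral>u. g_var P f m N \<nu> u y \<partial>D) / s \<le> b"
proof -
  interpret D: prob_space D by (rule D(1))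
  have [measurable_cong]: "sets D = sets (dir_space N :: (nat \<Rightarrow> real ^ 'd) measure)" by (rule D(2))
  let ?d = "real CARD('d)"
  define v where "v = variance_inflation m CARD('d) N *
    (noise_coeff m ?d * (\<beta>1 * (norm (F' y))\<^sup>2 + \<beta>2) + smoothing_coeff m ?d * Lf\<^sup>2 * \<nu>\<^sup>2)"
  have infl: "0 < variance_inflation m CARD('d) N"
    using N by (cases m) auto
  have coeff: "0 \<le> noise_coeff m ?d" "0 \<le> smoothing_coeff m ?d" "0 \<le> bias_coeff m ?d"
    by (simp_all add: coeff_nonneg)
  note eb = direction_law_estimator_bounds[OF law N \<nu>, where y = y, unfolded estimator_bounds_def]
  note ratio = estimator_variance_ratio[OF eb[THEN conjunct1] eb[THEN conjunct2, THEN conjunct1]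
      infl \<theta> coeff e]
  have v: "0 \<le> v" unfolding v_def using infl coeff beta_nonneg by simp
  show s: "0 < s" unfolding s_def by (rule ratio(1))
  have vs: "1 + v / s \<le> b"
    using ratio(2) unfolding b_def s_def v_def size_b1_def size_b2_def by linarith
  have V: "(\<integral>\<^sup>+u. ennreal (g_var P f m N \<nu> u y) \<partial>D) \<le> ennreal v"
    using eb by (simp add: v_def)
  have V_nn: "0 \<le> g_var P f m N \<nu> u y" for u by (simp add: g_var_def)
  have V_meas [measurable]: "(\<lambda>u. g_var P f m N \<nu> u y) \<in> borel_measurable D"
    unfolding g_var_def g_dir_eq grad_est_def by measurable
  have "(\<integral>\<^sup>+u. ennreal (1 + g_var P f m N \<nu> u y / s) \<partial>D)
      = 1 + ennreal (1 / s) * (\<integral>\<^sup>+u. ennreal (g_var P f m N \<nu> u y) \<partial>D)"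
    using s V_nn by (simp add: ennreal_plus divide_inverse ennreal_mult'' nn_integral_add
        nn_integral_cmult D.emeasure_space_1 mult.commute)
  also have "\<dots> \<le> 1 + ennreal (1 / s) * ennreal v" by (intro add_left_mono mult_left_mono V) simp
  also have "\<dots> = ennreal (1 + v / s)"
    using s v by (simp add: ennreal_plus ennreal_mult[symmetric])
  also have "\<dots> \<le> ennreal b" using vs by (rule ennreal_leI)
  finally show "(\<integral>\<^sup>+u. ennreal (1 + g_var P f m N \<nu> u y / s) \<partial>D) \<le> ennreal b" .
  have "ennreal (\<integral>u. g_var P f m N \<nu> u y \<partial>D) \<le> ennreal v"
    using ennreal_integral_le_nn_integral[of "\<lambda>u. g_var P f m N \<nu> u y", OF V_nn] V by (rule order_trans)
  then have "(\<integral>u. g_var P f m N \<nu> u y \<partial>D) \<le> v" using v by simp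
  then have "(\<integral>u. g_var P f m N \<nu> u y \<partial>D) / s \<le> v / s" using s by (simp add: divide_right_mono)
  then show "1 + (\<integral>u. g_var P f m N \<nu> u y \<partial>D) / s \<le> b" using vs by simp
qed

lemma g_var_measurable [measurable]:
  "(\<lambda>(y, u). g_var P f m N \<nu> u y) \<in> borel_measurable (borel \<Otimes>\<^sub>M dir_space N)"
  unfolding g_var_def g_dir_eq grad_est_def by measurable

lemma g_mean_measurable:
  fixes D :: "(nat \<Rightarrow> real ^ 'd) measure"
  assumes "prob_space D" and sets_D [measurable_cong]: "sets D = sets (dir_space N :: (nat \<Rightarrow> real ^ 'd) measure)"
  shows "g_mean P f m N \<nu> D \<in> borel_measurable borel"
proof -
  interpret D: prob_space D by fact
  have "(\<lambda>y. \<integral>u. grad_est m N \<nu> u F y \<partial>D) \<in> borel_measurable borel"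
    unfolding grad_est_def by measurable
  then show ?thesis by (simp add: g_mean_def[abs_def] g_dir_eq)
qed

lemma g_sq_measurable:
  fixes D :: "(nat \<Rightarrow> real ^ 'd) measure"
  assumes "prob_space D" and sets_D [measurable_cong]: "sets D = sets (dir_space N :: (nat \<Rightarrow> real ^ 'd) measure)"
  shows "g_sq P f m N \<nu> D \<in> borel_measurable borel"
proof -
  interpret D: prob_space D by fact
  have "(\<lambda>y. \<integral>u. (norm (grad_est m N \<nu> u F y))\<^sup>2 \<partial>D) \<in> borel_measurable borel"
    unfolding grad_est_def by measurable
  then show ?thesis by (simp add: g_sq_def[abs_def] g_dir_eq)
qed

end

section \<open>The accuracy of the mean estimator\<close>

text \<open>The constant 1.1 is dictated by \<open>GS\<close>, whose ratio comes close to 1;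
  \<open>SS\<close> and the basis methods stay well below.\<close>

lemma bias_coeff_nu_hat:
  assumes d: "1 \<le> d" and N: "1 \<le> N" and pos: "0 < \<epsilon>" "0 < p" "p \<le> 1" "0 < LF" "0 < \<mu>"
  shows "bias_coeff m (real d) * LF\<^sup>2 * (nu_hat m d N \<epsilon> p LF \<mu>)\<^sup>2 \<le> 1.1 * (\<epsilon> * \<mu>)"
proof -
  let ?d = "real d" and ?N = "real N"
  have dN: "1 \<le> ?d" "1 \<le> ?N" using d N by simp_all
  define B where "B = bias_coeff m ?d"
  define r2 where "r2 = (radius_factor m d N)\<^sup>2"
  have nu: "(nu_hat m d N \<epsilon> p LF \<mu>)\<^sup>2 = r2 * (4 * \<epsilon> * p * \<mu> / (3 * LF\<^sup>2 * ?d))"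
    using pos by (simp add: nu_hat_def r2_def power_mult_distrib)
  have B: "0 \<le> B" by (simp add: B_def coeff_nonneg)
  \<comment> \<open>This is \<open>B * r2 * 4 / (3 * d) \<le> 1.1\<close> with denominators
    cleared.\<close>
  have "40 * (B * r2) \<le> 33 * ?d"
  proof (cases m)
    case GS
    let ?den = "8 * ?N + 24 * ?d + (?d + 2) * (?d + 4)"
    have den: "0 < ?den" using dN by (intro add_pos_nonneg) auto
    have r2: "r2 = 2 * (?N + 4.5 * ?d) / ?den"
      unfolding r2_def GS radius_factor.simps using dN by (intro real_sqrt_pow2) simp
    \<comment> \<open>The difference of the two sides below is
      \<open>24 * N + 33 * d\<^sup>2 - 90 * d + 264\<close>. Three hundredths of this square take
      care of its quadratic part and leave only positive terms.\<close>
    have "0 \<le> 11 * (10 * ?d - 14)\<^sup>2" by simp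
    then have "40 * (3 * (2 * (?N + 4.5 * ?d))) \<le> 33 * ?den"
      using dN by (simp add: power2_eq_square algebra_simps)
    then have "40 * (3 * ?d) * (2 * (?N + 4.5 * ?d)) \<le> 33 * ?d * ?den"
      using mult_left_mono[of "40 * (3 * (2 * (?N + 4.5 * ?d)))" "33 * ?den" ?d] dN
      by (simp only: mult_ac)
    then show ?thesis using den unfolding r2 B_def GS bias_coeff.simps
      by (simp add: pos_divide_le_eq del: distrib_right_numeral distrib_left_numeral)
  next
    case SS
    let ?den = "8 * ?N + 24 * ?d + ?d\<^sup>2"
    have den: "0 < ?den" using dN by (intro add_pos_nonneg) auto
    have r2: "r2 = 2 * (?N + 4.5 * ?d) * ?d / ?den"
      unfolding r2_def SS radius_factor.simps using dN by (intro real_sqrt_pow2) simp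
    have "0 \<le> ?d\<^sup>2" by simp
    then have "40 * (2 * (?N + 4.5 * ?d)) \<le> 33 * ?den"
      using dN by (simp add: algebra_simps)
    then have "40 * (2 * (?N + 4.5 * ?d)) * ?d \<le> 33 * ?den * ?d"
      using dN by (intro mult_right_mono) auto
    then have "40 * (2 * (?N + 4.5 * ?d) * ?d) / ?den \<le> 33 * ?d"
      using den by (subst pos_divide_le_eq) (simp_all add: mult_ac)
    then show ?thesis unfolding r2 B_def SS bias_coeff.simps by simp
  qed (use dN in \<open>auto simp: B_def r2_def\<close>)
  then have "40 * (B * r2) / (30 * ?d) \<le> 33 * ?d / (30 * ?d)"
    using dN by (intro divide_right_mono) auto
  then have "B * r2 * 4 / (3 * ?d) \<le> 1.1" using dN by (simp add: field_simps)
  then have "B * r2 * 4 / (3 * ?d) * (p * (\<epsilon> * \<mu>)) \<le> 1.1 * (p * (\<epsilon> * \<mu>))"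
    using pos by (intro mult_right_mono) auto
  also have "\<dots> \<le> 1.1 * (\<epsilon> * \<mu>)"
    using pos by (intro mult_left_mono mult_left_le_one_le) auto
  finally show ?thesis
    unfolding nu B_def[symmetric] using pos by (simp add: mult_ac)
qed

lemma nu_hat_pos:
  assumes "1 \<le> d" "1 \<le> N" "0 < \<epsilon>" "0 < p" "0 < LF" "0 < \<mu>"
  shows "0 < nu_hat m d N \<epsilon> p LF \<mu>"
proof -
  have "0 < radius_factor m d N"
  proof (cases m)
    case GS
    have "0 < 8 * real N + 24 * real d + (real d + 2) * (real d + 4)"
      using assms by (intro add_pos_nonneg) auto
    then show ?thesis unfolding GS radius_factor.simps using assms
      by (intro real_sqrt_gt_zero divide_pos_pos) auto
  next
    case SS
    have "0 < 8 * real N + 24 * real d + (real d)\<^sup>2"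
      using assms by (intro add_pos_nonneg) auto
    then show ?thesis unfolding SS radius_factor.simps using assms
      by (intro real_sqrt_gt_zero divide_pos_pos mult_pos_pos) auto
  qed auto
  then show ?thesis using assms by (simp add: nu_hat_def)
qed

text \<open>Triangle inequality with rounded square roots: \<open>1.41 < sqrt 2\<close>,
  \<open>sqrt 1.1 < 1.05\<close>, and the square of their difference 0.36 still exceeds
  \<open>1 / 8\<close>.\<close>

lemma norm_perturbed_gradient:
  fixes a g :: "'a::real_normed_vector"
  assumes a: "2 * t < (norm a)\<^sup>2" and g: "(norm (g - a))\<^sup>2 \<le> 1.1 * t" and t: "0 < t"
  shows "t / 8 < (norm g)\<^sup>2"
proof -
  define q where "q = sqrt t"
  have q: "0 < q" "q\<^sup>2 = t" using t by (simp_all add: q_def)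
  have "(1.41 * q)\<^sup>2 < (norm a)\<^sup>2" using a q t by (simp add: power_mult_distrib power2_eq_square)
  then have 1: "1.41 * q < norm a" by (rule power_less_imp_less_base) simp
  have "(norm (g - a))\<^sup>2 \<le> (1.05 * q)\<^sup>2" using g q t by (simp add: power_mult_distrib power2_eq_square)
  then have 2: "norm (g - a) \<le> 1.05 * q" by (rule power2_le_imp_le) (use q in simp)
  have "norm a \<le> norm g + norm (g - a)"
    using norm_triangle_sub[of a g] by (simp add: norm_minus_commute)
  then have "0.36 * q < norm g" using 1 2 by linarith
  then have "(0.36 * q)\<^sup>2 < (norm g)\<^sup>2" using q by (intro power_strict_mono) auto
  moreover have "t / 8 \<le> (0.36 * q)\<^sup>2" using q t by (simp add: power_mult_distrib power2_eq_square)
  ultimately show ?thesis by linarith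
qed

section \<open>Orders\<close>

lemma size_b1_order:
  assumes "1 \<le> d" "0 < \<theta>" "0 \<le> \<beta>1"
  shows "size_b1 m (real d) \<theta> \<beta>1 \<le> c_size \<theta> * b1_order m d \<beta>1"
proof -
  define t where "t = 1 / \<theta>\<^sup>2"
  have t: "0 \<le> t" by (simp add: t_def)
  have d: "1 \<le> real d" using assms by simp
  have eq: "size_b1 m (real d) \<theta> \<beta>1 = 1 + 2 * noise_coeff m (real d) * \<beta>1 * t" "c_size \<theta> = 40 * (1 + t)"
    by (simp_all add: t_def c_size_def)
  have nn: "0 \<le> t * \<beta>1" "0 \<le> t * real d" "0 \<le> \<beta>1 * real d" "0 \<le> t * \<beta>1 * real d"
    using t assms by simp_all
  have "40 * (1 + t) * (1 + \<beta>1) = 40 + 40 * \<beta>1 + 40 * t + 40 * (t * \<beta>1)"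
    "40 * (1 + t) * ((1 + \<beta>1) * real d)
      = 40 * real d + 40 * (\<beta>1 * real d) + 40 * (t * real d) + 40 * (t * \<beta>1 * real d)"
    by (simp_all add: algebra_simps)
  moreover have "2 * (6 * real d) * \<beta>1 * t = 12 * (t * \<beta>1 * real d)"
    "2 * (2 * real d) * \<beta>1 * t = 4 * (t * \<beta>1 * real d)" "2 * 2 * \<beta>1 * t = 4 * (t * \<beta>1)"
    by simp_all
  ultimately show ?thesis unfolding eq using nn t d assms(3)
    by (cases m; simp only: noise_coeff.simps b1_order.simps)
qed

text \<open>The 40 in \<open>c_size\<close> is set by \<open>GS\<close>, where the product of noise
  and bias coefficients gives \<open>2 * (6 * d) * (3 * d) = 36 * d\<^sup>2\<close> in front of
  \<open>\<beta>1\<close>.\<close>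

lemma size_b2_order:
  assumes "1 \<le> d" "0 < \<theta>" "0 \<le> \<beta>1" "0 \<le> \<beta>2"
  shows "size_b2 m (real d) \<theta> \<beta>1 \<beta>2 Lf \<nu> \<le> c_size \<theta> * b2_order m d \<beta>1 \<beta>2 Lf \<nu>"
proof -
  define t where "t = 1 / \<theta>\<^sup>2"
  define q where "q = Lf\<^sup>2 * \<nu>\<^sup>2"
  let ?d = "real d"
  define S where "S = 2 * noise_coeff m ?d * \<beta>1 * bias_coeff m ?d * q + noise_coeff m ?d * \<beta>2 + smoothing_coeff m ?d * q"
  have t: "0 \<le> t" and q: "0 \<le> q" by (simp_all add: t_def q_def)
  have d: "1 \<le> ?d" using assms by simp
  have b2: "b2_order m d \<beta>1 \<beta>2 Lf \<nu> = (case m of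
      GS \<Rightarrow> (\<beta>1 + ?d) * q * ?d\<^sup>2 + \<beta>2 * ?d
    | SS \<Rightarrow> (\<beta>1 + ?d) * q * ?d + \<beta>2 * ?d
    | _ \<Rightarrow> (1 + \<beta>1) * q * ?d + \<beta>2)"
    by (cases m) (simp_all add: q_def mult.assoc)
  have nn: "0 \<le> \<beta>1 * q * ?d" "0 \<le> \<beta>1 * q * ?d\<^sup>2" "0 \<le> q * ?d" "0 \<le> q * ?d\<^sup>2" "0 \<le> q * ?d ^ 3" "0 \<le> \<beta>2 * ?d"
    using q assms by simp_all
  have S: "S \<le> 40 * b2_order m d \<beta>1 \<beta>2 Lf \<nu>"
    unfolding S_def b2 using nn assms(3,4)
    by (cases m) (simp_all add: algebra_simps power2_eq_square power3_eq_cube)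
  have S0: "0 \<le> S" unfolding S_def using q assms by (simp add: coeff_nonneg)
  have "size_b2 m ?d \<theta> \<beta>1 \<beta>2 Lf \<nu> = t * S"
    by (simp add: S_def t_def q_def mult.assoc)
  also have "\<dots> \<le> (1 + t) * S" using S0 by (intro mult_right_mono) auto
  also have "\<dots> \<le> (1 + t) * (40 * b2_order m d \<beta>1 \<beta>2 Lf \<nu>)" using S t by (intro mult_left_mono) auto
  also have "\<dots> = c_size \<theta> * b2_order m d \<beta>1 \<beta>2 Lf \<nu>" by (simp add: c_size_def t_def)
  finally show ?thesis .
qed

text \<open>The restriction on \<open>\<epsilon> * p\<close> keeps \<open>l\<close> at least
  \<open>ln 2\<close>, hence at least \<open>2 / 3\<close>, so that additive constants can be
  absorbed. With \<open>\<rho> \<le> 1 / 8\<close> the rounding costs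
  \<open>3 / 16 * l / \<rho>\<close>, the initial gap at most
  \<open>3 / 2 * l * (1 + G) / \<rho>\<close>, together below the factor 2.\<close>

lemma iteration_bound_le:
  assumes gap: "0 < gap" and ep: "0 < \<epsilon>" "0 < p" "\<epsilon> * p \<le> 1 / 2" and rho: "0 < \<rho>" "\<rho> \<le> 1 / 8"
  shows "real (iteration_bound gap \<epsilon> p \<rho>) \<le> 2 * ln (1 / (\<epsilon> * p)) * (1 + max 0 (ln (2 * gap))) / \<rho>"
proof -
  define l where "l = ln (1 / (\<epsilon> * p))"
  define G where "G = max 0 (ln (2 * gap))"
  define D where "D = ln (1 / (1 - \<rho>))"
  have ep0: "0 < \<epsilon> * p" using ep by simp
  have l_eq: "l = - ln (\<epsilon> * p)" using ep by (simp add: l_def ln_div)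
  have "ln 2 \<le> l"
    unfolding l_def using ep ep0 by (subst ln_le_cancel_iff) (auto simp: field_simps)
  then have l: "2 / 3 \<le> l" using ln2_ge_two_thirds by linarith
  have G: "0 \<le> G" "ln (2 * gap) \<le> G" by (simp_all add: G_def)
  have "ln (1 - \<rho>) \<le> - \<rho>" using ln_add_one_self_le_self2[of "- \<rho>"] rho by simp
  then have D: "\<rho> \<le> D" using rho by (simp add: D_def ln_div)
  have "ln gap - ln (\<epsilon> * p / 2) = ln (2 * gap) + l"
    using gap ep by (simp add: l_eq ln_div ln_mult)
  then have "(ln gap - ln (\<epsilon> * p / 2)) / D \<le> (G + l) / D"
    using G D rho by (intro divide_right_mono) auto
  also have "\<dots> \<le> (G + l) / \<rho>"
    using G l D rho by (intro divide_left_mono) auto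
  finally have q: "(ln gap - ln (\<epsilon> * p / 2)) / D \<le> (G + l) / \<rho>" .
  have q0: "0 \<le> (G + l) / \<rho>" using G l rho by simp
  have "real (iteration_bound gap \<epsilon> p \<rho>) = max 1 (real (nat \<lceil>(ln gap - ln (\<epsilon> * p / 2)) / D\<rceil>))"
    using gap by (simp add: iteration_bound_def D_def of_nat_max)
  also have "\<dots> \<le> 1 + (G + l) / \<rho>"
    using q q0 by (intro max.boundedI) linarith+
  also have "\<dots> \<le> 3 / 16 * l / \<rho> + 3 / 2 * l * (1 + G) / \<rho>"
  proof (rule add_mono)
    have "\<rho> \<le> 3 / 16 * l" using l rho by linarith
    then show "1 \<le> 3 / 16 * l / \<rho>" using rho by simp
    have "G * (2 / 3) \<le> G * l" using l G by (intro mult_left_mono) auto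
    then have "G + l \<le> 3 / 2 * l * (1 + G)" using l by (simp add: algebra_simps)
    then show "(G + l) / \<rho> \<le> 3 / 2 * l * (1 + G) / \<rho>" using rho by (intro divide_right_mono) auto
  qed
  also have "\<dots> \<le> 2 * l * (1 + G) / \<rho>"
  proof -
    have "0 \<le> l * G" using l G by simp
    moreover have "3 / 2 * l * (1 + G) = 3 / 2 * l + 3 / 2 * (l * G)" "2 * l * (1 + G) = 2 * l + 2 * (l * G)"
      by (simp_all add: algebra_simps)
    ultimately have "3 / 16 * l + 3 / 2 * l * (1 + G) \<le> 2 * l * (1 + G)" using l by linarith
    then have "(3 / 16 * l + 3 / 2 * l * (1 + G)) / \<rho> \<le> 2 * l * (1 + G) / \<rho>"
      using rho by (intro divide_right_mono) auto
    then show ?thesis by (simp only: add_divide_distrib)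
  qed
  finally show ?thesis by (simp add: l_def G_def)
qed

text \<open>The denominators dominate both \<open>N\<close> and \<open>d\<^sup>2\<close>; the 11 is
  \<open>2 + 2 * 4.5\<close> from the numerator.\<close>

lemma radius_factor_square_le:
  assumes "1 \<le> d" "1 \<le> N"
  shows "(radius_factor GS d N)\<^sup>2 \<le> 11 * max (real N) (real d) / max (real N) ((real d)\<^sup>2)"
    and "(radius_factor SS d N)\<^sup>2 \<le> 11 * max (real N) (real d) * real d / max (real N) ((real d)\<^sup>2)"
proof -
  let ?d = "real d" and ?N = "real N"
  have dN: "1 \<le> ?d" "1 \<le> ?N" using assms by simp_all
  have M: "0 < max ?N (?d\<^sup>2)" using dN by (simp add: less_max_iff_disj)
  have num: "2 * (?N + 4.5 * ?d) \<le> 11 * max ?N ?d" by simp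
  show "(radius_factor GS d N)\<^sup>2 \<le> 11 * max ?N ?d / max ?N (?d\<^sup>2)"
  proof -
    have "(radius_factor GS d N)\<^sup>2 = 2 * (?N + 4.5 * ?d) / (8 * ?N + 24 * ?d + (?d + 2) * (?d + 4))"
      using dN by (simp add: real_sqrt_pow2)
    also have "\<dots> \<le> 11 * max ?N ?d / max ?N (?d\<^sup>2)"
      using dN M num by (intro frac_le) (auto simp: power2_eq_square algebra_simps)
    finally show ?thesis .
  qed
  show "(radius_factor SS d N)\<^sup>2 \<le> 11 * max ?N ?d * ?d / max ?N (?d\<^sup>2)"
  proof -
    have "(radius_factor SS d N)\<^sup>2 = 2 * (?N + 4.5 * ?d) * ?d / (8 * ?N + 24 * ?d + ?d\<^sup>2)"
      using dN by (simp add: real_sqrt_pow2)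
    also have "\<dots> \<le> 11 * max ?N ?d * ?d / max ?N (?d\<^sup>2)"
      using dN M num by (intro frac_le mult_right_mono) (auto simp: power2_eq_square)
    finally show ?thesis .
  qed
qed

text \<open>What remains of \<open>total_order\<close> after division by the common logarithm and
  condition number, with \<open>w\<close> for \<open>1 / (\<epsilon> * \<mu>)\<close>.\<close>

definition order_factor :: "estimator \<Rightarrow> real \<Rightarrow> real \<Rightarrow> real \<Rightarrow> real" where
  "order_factor m d N w =
     (if m \<in> {GS, SS} then (max N d)\<^sup>2 * d\<^sup>2 / max N (d\<^sup>2) + max N d * d * w else d + d * w)"

lemma total_order_eq:
  assumes "0 < \<epsilon>" "0 < \<mu>"
  shows "total_order m d N \<epsilon> p LF \<mu> =
    ln (1 / (\<epsilon> * p)) * (LF / \<mu>) * order_factor m (real d) (real N) (1 / (\<epsilon> * \<mu>))"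
  using assms
  by (cases m) (simp_all add: order_factor_def smoothing_order_def Omega7_def Omega8_def
      power2_eq_square field_simps)

text \<open>The number of iterations contributes \<open>1 / rate_factor\<close>, and
  \<open>N / rate_factor\<close> is \<open>d\<close> for the basis methods and
  \<open>N + 4.5 * d\<close> for \<open>GS\<close> and \<open>SS\<close>. The ratio of the Lipschitz
  constants appears squared because \<open>\<nu>\<^sup>2\<close> contains
  \<open>1 / LF\<^sup>2\<close>.\<close>

lemma cost_order:
  assumes d: "1 \<le> d" and N: "1 \<le> N" "m = FD \<longrightarrow> N = d"
    and pos: "0 < \<epsilon>" "0 < p" "p \<le> 1" "0 < LF" "LF \<le> Lf" "0 < \<mu>" "0 \<le> \<beta>1" "0 \<le> \<beta>2"
  defines "\<nu> \<equiv> nu_hat m d N \<epsilon> p LF \<mu>"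
  shows "real N / rate_factor m d N * (b1_order m d \<beta>1 + b2_order m d \<beta>1 \<beta>2 Lf \<nu> / (\<epsilon> * \<mu>))
    \<le> 90 * ((1 + \<beta>1 + \<beta>2) * (Lf / LF)\<^sup>2) * order_factor m (real d) (real N) (1 / (\<epsilon> * \<mu>))"
proof -
  let ?d = "real d" and ?N = "real N"
  define w where "w = 1 / (\<epsilon> * \<mu>)"
  define k where "k = (Lf / LF)\<^sup>2"
  define r2 where "r2 = (radius_factor m d N)\<^sup>2"
  define q where "q = Lf\<^sup>2 * \<nu>\<^sup>2 * w"
  define c where "c = (1 + \<beta>1 + \<beta>2) * k"
  have dN: "1 \<le> ?d" "1 \<le> ?N" using d N by simp_all
  have w: "0 < w" using pos by (simp add: w_def)
  have "1 \<le> Lf / LF" using pos by simp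
  then have k: "1 \<le> k" unfolding k_def by simp
  have \<nu>2: "\<nu>\<^sup>2 = r2 * (4 * \<epsilon> * p * \<mu> / (3 * LF\<^sup>2 * ?d))"
    using pos by (simp add: \<nu>_def nu_hat_def r2_def power_mult_distrib)
  have "q = k * r2 * (4 / (3 * ?d)) * p"
    using pos dN by (simp add: q_def \<nu>2 k_def w_def power_divide)
  also have "\<dots> \<le> k * r2 * (4 / (3 * ?d))"
    using pos k by (intro mult_right_le_one_le) (auto simp: r2_def)
  finally have q: "q \<le> k * r2 * (4 / (3 * ?d))" .
  have q0: "0 \<le> q" using w by (simp add: q_def)
  have c: "1 + \<beta>1 \<le> c" "\<beta>2 \<le> c" "(1 + \<beta>1) * k \<le> c"
  proof -
    have "1 + \<beta>1 + \<beta>2 \<le> c"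
      unfolding c_def using mult_left_mono[OF k, of "1 + \<beta>1 + \<beta>2"] pos by simp
    then show "1 + \<beta>1 \<le> c" "\<beta>2 \<le> c" using pos by auto
    show "(1 + \<beta>1) * k \<le> c" unfolding c_def using k pos by (intro mult_right_mono) auto
  qed
  have c0: "0 \<le> c" using c(2) pos by simp
  have basis: ?thesis if m: "m \<in> {FD, RC, RS}"
  proof -
    have rate: "?N / rate_factor m d N = ?d" using m N dN by auto
    have "r2 = 1" using m by (auto simp: r2_def)
    then have qd: "q * ?d \<le> 4 / 3 * k" using mult_right_mono[OF q, of ?d] dN by simp
    have "b1_order m d \<beta>1 + b2_order m d \<beta>1 \<beta>2 Lf \<nu> * w = (1 + \<beta>1) + (1 + \<beta>1) * (q * ?d) + \<beta>2 * w"
      using m by (auto simp: q_def algebra_simps)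
    also have "\<dots> \<le> c + 4 / 3 * c + c * w"
    proof (intro add_mono)
      have "(1 + \<beta>1) * (q * ?d) \<le> (1 + \<beta>1) * (4 / 3 * k)" using qd pos by (intro mult_left_mono) auto
      then show "(1 + \<beta>1) * (q * ?d) \<le> 4 / 3 * c" using c(3) by simp
      show "\<beta>2 * w \<le> c * w" using c w by (intro mult_right_mono) auto
    qed (rule c)
    also have "\<dots> \<le> 90 * c * (1 + w)" using c0 w by (simp add: algebra_simps)
    finally have "?d * (b1_order m d \<beta>1 + b2_order m d \<beta>1 \<beta>2 Lf \<nu> * w) \<le> ?d * (90 * c * (1 + w))"
      using dN by (intro mult_left_mono) auto
    moreover have "order_factor m ?d ?N w = ?d * (1 + w)" using m by (auto simp: order_factor_def algebra_simps)
    ultimately show ?thesis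
      unfolding rate w_def[symmetric] k_def[symmetric] c_def[symmetric]
      by (simp add: w_def mult_ac)
  qed
  have smooth: ?thesis if m: "m \<in> {GS, SS}"
  proof -
    define X where "X = max ?N ?d"
    define M where "M = max ?N (?d\<^sup>2)"
    define t where "t = ?d\<^sup>2 * X / M"
    have X: "?N \<le> X" "?d \<le> X" "1 \<le> X" using dN by (simp_all add: X_def)
    have M: "1 \<le> M" using dN by (simp add: M_def)
    have "?N * 1 \<le> X * ?d" "?d * ?d \<le> X * ?d" using X dN by (intro mult_mono; simp)+
    then have MX: "M \<le> X * ?d" by (simp add: M_def power2_eq_square)
    \<comment> \<open>\<open>t\<close> is the smoothing term. That it dominates d allows the order
      of \<open>b1\<close> to be absorbed into it.\<close>
    have t: "?d \<le> t"
    proof -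
      have "?d * M \<le> ?d * (X * ?d)" using MX dN by (intro mult_left_mono) auto
      then show ?thesis using M by (simp add: t_def pos_le_divide_eq power2_eq_square mult_ac)
    qed
    have t0: "0 \<le> t" using t dN by linarith
    have rate: "?N / rate_factor m d N \<le> 11 / 2 * X"
    proof -
      have "?N / rate_factor m d N = ?N + 4.5 * ?d" using m dN by auto
      then show ?thesis using X by simp
    qed
    define Q where "Q = b2_order m d \<beta>1 \<beta>2 Lf \<nu> * w - \<beta>2 * ?d * w"
    have Q: "Q \<le> 44 / 3 * c * t"
    proof -
      have *: "(\<beta>1 + ?d) \<le> (1 + \<beta>1) * ?d"
        using dN pos mult_left_mono[of 1 ?d \<beta>1] by (simp add: algebra_simps)
      \<comment> \<open>\<open>GS\<close> has one more factor d in its \<open>b2\<close>,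
        \<open>SS\<close> one more in its squared radius, so both arrive at the same multiple of
        \<open>t\<close>.\<close>
      define D where "D = (if m = GS then ?d\<^sup>2 else ?d)"
      have D: "0 \<le> D" by (simp add: D_def)
      have r2: "?d * (r2 * (4 / (3 * ?d))) * D \<le> 44 / 3 * t"
      proof (cases "m = GS")
        case True
        have "r2 \<le> 11 * X / M"
          unfolding r2_def True X_def M_def by (rule radius_factor_square_le[OF d N(1)])
        then have "4 / 3 * r2 * ?d\<^sup>2 \<le> 4 / 3 * (11 * X / M) * ?d\<^sup>2"
          by (intro mult_right_mono mult_left_mono) auto
        then show ?thesis using True dN by (simp add: D_def t_def mult_ac)
      next
        case False
        then have m: "m = SS" using m by simp
        have "r2 \<le> 11 * X * ?d / M"
          unfolding r2_def m X_def M_def by (rule radius_factor_square_le[OF d N(1)])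
        then have "4 / 3 * r2 * ?d \<le> 4 / 3 * (11 * X * ?d / M) * ?d"
          by (intro mult_right_mono mult_left_mono) auto
        then show ?thesis using False dN by (simp add: D_def t_def power2_eq_square mult_ac)
      qed
      have "Q = (\<beta>1 + ?d) * q * D" using m by (auto simp: Q_def D_def q_def algebra_simps)
      also have "\<dots> \<le> ((1 + \<beta>1) * ?d) * (k * r2 * (4 / (3 * ?d))) * D"
        using * q q0 D pos by (intro mult_right_mono mult_mono) auto
      also have "\<dots> = ((1 + \<beta>1) * k) * (?d * (r2 * (4 / (3 * ?d))) * D)" by (simp add: mult_ac)
      also have "\<dots> \<le> c * (44 / 3 * t)"
        using c0 D dN by (intro mult_mono[OF c(3) r2]) (auto simp: r2_def)
      finally show ?thesis by simp
    qed
    have "b1_order m d \<beta>1 + b2_order m d \<beta>1 \<beta>2 Lf \<nu> * w = (1 + \<beta>1) * ?d + Q + \<beta>2 * ?d * w"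
      using m by (auto simp: Q_def)
    also have "\<dots> \<le> c * t + 44 / 3 * c * t + c * ?d * w"
      using c Q t dN w pos c0 by (intro add_mono mult_mono) auto
    also have "\<dots> \<le> 47 / 3 * c * (t + ?d * w)"
      using c0 dN w by (simp add: algebra_simps)
    finally have Y: "b1_order m d \<beta>1 + b2_order m d \<beta>1 \<beta>2 Lf \<nu> * w \<le> 47 / 3 * c * (t + ?d * w)" .
    have Y0: "0 \<le> b1_order m d \<beta>1 + b2_order m d \<beta>1 \<beta>2 Lf \<nu> * w"
      using m pos w by auto
    have "?N / rate_factor m d N * (b1_order m d \<beta>1 + b2_order m d \<beta>1 \<beta>2 Lf \<nu> * w)
        \<le> 11 / 2 * X * (47 / 3 * c * (t + ?d * w))"
      using rate Y Y0 X by (intro mult_mono) auto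
    \<comment> \<open>The product of \<open>11 / 2\<close> and \<open>47 / 3\<close>; 90 is a round
      number above it.\<close>
    also have "\<dots> = 517 / 6 * c * (X * (t + ?d * w))" by simp
    also have "\<dots> \<le> 90 * c * (X * (t + ?d * w))"
      using c0 X t0 dN w by (intro mult_right_mono) auto
    also have "X * (t + ?d * w) = order_factor m ?d ?N w"
      using m by (auto simp: order_factor_def X_def M_def t_def power2_eq_square algebra_simps)
    finally show ?thesis by (simp add: w_def k_def c_def)
  qed
  show ?thesis using basis smooth by (cases m) auto
qed

text \<open>The numerical factor of \<open>c_total\<close> rounds up
  \<open>16 * 16 * 40 * 90 = 921600\<close>: \<open>c_evals\<close>, the iteration bound (2 from the
  logarithms, 8 from \<open>rho\<close>), \<open>c_size\<close>, and the cost of one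
  iteration.\<close>

lemma total_cost_order:
  fixes \<theta> b1 b2 :: real
  assumes d: "1 \<le> d" and N: "1 \<le> N" "m = FD \<longrightarrow> N = d" "m \<in> {RC, RS} \<longrightarrow> N \<le> d"
    and pos: "0 < \<epsilon>" "0 < p" "p \<le> 1" "0 < LF" "LF \<le> Lf" "0 < \<mu>" "0 \<le> \<beta>1" "0 \<le> \<beta>2"
    and \<mu>: "\<mu> \<le> LF" and ep: "\<epsilon> * p \<le> 1 / 2" and gap: "0 < gap"
  defines "\<nu> \<equiv> nu_hat m d N \<epsilon> p LF \<mu>"
    and "K \<equiv> iteration_bound gap \<epsilon> p (rho m d N \<theta> LF \<mu>)"
  assumes b: "b1 \<le> c_size \<theta> * b1_order m d \<beta>1" "b2 \<le> c_size \<theta> * b2_order m d \<beta>1 \<beta>2 Lf \<nu>"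
  shows "c_evals * (real N * b1 * real K + real N * b2 * real K / (\<epsilon> * \<mu>))
     \<le> c_total \<theta> \<beta>1 \<beta>2 (Lf / LF) gap * total_order m d N \<epsilon> p LF \<mu>"
proof -
  define l where "l = ln (1 / (\<epsilon> * p))"
  define G where "G = max 0 (ln (2 * gap))"
  define rf where "rf = rate_factor m d N"
  define w where "w = 1 / (\<epsilon> * \<mu>)"
  define Y where "Y = b1_order m d \<beta>1 + b2_order m d \<beta>1 \<beta>2 Lf \<nu> * w"
  define h where "h = (1 + \<beta>1 + \<beta>2) * (Lf / LF)\<^sup>2"
  define R where "R = order_factor m (real d) (real N) w"
  have dN: "1 \<le> real d" "1 \<le> real N" using d N by simp_all
  have rf: "0 < rf" "rf \<le> 1"
    using N dN by (cases m; auto simp: rf_def divide_simps)+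
  have t1: "0 < 1 + \<theta>\<^sup>2" by (simp add: add_pos_nonneg)
  have t2: "0 \<le> c_size \<theta>" by (simp add: c_size_def)
  have w: "0 < w" using pos by (simp add: w_def)
  have l: "0 \<le> l"
    unfolding l_def using pos ep by (intro ln_ge_zero) (auto simp: field_simps)
  have G: "0 \<le> G" by (simp add: G_def)
  define \<rho> where "\<rho> = rho m d N \<theta> LF \<mu>"
  have \<rho>: "\<rho> = rf * (\<mu> / (8 * (1 + \<theta>\<^sup>2) * LF))" by (simp add: \<rho>_def rho_def rf_def)
  have "\<mu> / (8 * (1 + \<theta>\<^sup>2) * LF) \<le> 1 / 8"
  proof -
    define T where "T = 1 + \<theta>\<^sup>2"
    have "\<mu> * 1 \<le> LF * T" using \<mu> pos by (intro mult_mono) (auto simp: T_def)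
    then have "\<mu> / (8 * T * LF) \<le> 1 / 8" using pos t1 by (simp add: T_def[symmetric] divide_simps mult_ac)
    then show ?thesis by (simp add: T_def)
  qed
  then have \<rho>8: "\<rho> \<le> 1 / 8"
    unfolding \<rho> using rf pos t1 by (intro mult_left_le_one_le[THEN order_trans]) auto
  have \<rho>0: "0 < \<rho>" unfolding \<rho> using rf pos t1 by simp
  have "real K \<le> 2 * l * (1 + G) / \<rho>"
    unfolding K_def l_def G_def \<rho>_def[symmetric]
    by (rule iteration_bound_le[OF gap pos(1,2) ep \<rho>0 \<rho>8])
  also have "\<dots> = 16 * (1 + \<theta>\<^sup>2) * (1 + G) * (l * (LF / \<mu>)) / rf"
    unfolding \<rho> using rf pos t1 by (simp add: field_simps)
  finally have K: "real K \<le> 16 * (1 + \<theta>\<^sup>2) * (1 + G) * (l * (LF / \<mu>)) / rf" .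
  have Y0: "0 \<le> Y" unfolding Y_def using pos w by (cases m) auto
  have "b1 + b2 * w \<le> c_size \<theta> * b1_order m d \<beta>1 + (c_size \<theta> * b2_order m d \<beta>1 \<beta>2 Lf \<nu>) * w"
    using b w by (intro add_mono mult_right_mono) auto
  then have bY: "b1 + b2 * w \<le> c_size \<theta> * Y" by (simp add: Y_def algebra_simps)
  have cost: "real N / rf * Y \<le> 90 * h * R"
    using cost_order[OF d N(1,2) pos(1,2,3,4,5,6,7,8)]
    by (simp add: Y_def rf_def h_def R_def w_def \<nu>_def)
  have lLF: "0 \<le> l * (LF / \<mu>)" using l pos by simp
  have hR: "0 \<le> h * R"
    using pos dN w unfolding h_def R_def order_factor_def by (auto intro!: mult_nonneg_nonneg add_nonneg_nonneg divide_nonneg_nonneg simp: le_max_iff_disj)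
  have "c_evals * (real N * b1 * real K + real N * b2 * real K / (\<epsilon> * \<mu>)) = 16 * (real N * real K * (b1 + b2 * w))"
    by (simp add: c_evals_def w_def algebra_simps)
  also have "\<dots> \<le> 16 * (real N * real K * (c_size \<theta> * Y))"
    using bY by (intro mult_left_mono) auto
  also have "\<dots> \<le> 16 * (real N * (16 * (1 + \<theta>\<^sup>2) * (1 + G) * (l * (LF / \<mu>)) / rf) * (c_size \<theta> * Y))"
    using K t2 Y0 by (intro mult_left_mono mult_right_mono) auto
  also have "\<dots> = 256 * (1 + \<theta>\<^sup>2) * (1 + G) * (l * (LF / \<mu>)) * c_size \<theta> * (real N / rf * Y)"
    by (simp add: mult_ac)
  also have "\<dots> \<le> 256 * (1 + \<theta>\<^sup>2) * (1 + G) * (l * (LF / \<mu>)) * c_size \<theta> * (90 * h * R)"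
    using cost t1 t2 G l pos by (intro mult_left_mono mult_nonneg_nonneg) auto
  also have "\<dots> = 921600 * ((1 + \<theta>\<^sup>2) * (1 + 1 / \<theta>\<^sup>2) * (1 + G) * (l * (LF / \<mu>)) * (h * R))"
  proof -
    have "256 * a * b * c * (40 * d) * (90 * h * R) = 921600 * (a * d * b * c * (h * R))" for a b c d :: real
      by simp
    then show ?thesis unfolding c_size_def .
  qed
  also have "\<dots> \<le> 10 ^ 6 * ((1 + \<theta>\<^sup>2) * (1 + 1 / \<theta>\<^sup>2) * (1 + G) * (l * (LF / \<mu>)) * (h * R))"
  proof (rule mult_right_mono)
    have "0 \<le> (1 + \<theta>\<^sup>2) * (1 + 1 / \<theta>\<^sup>2) * (1 + G)" using t1 G by simp
    then show "0 \<le> (1 + \<theta>\<^sup>2) * (1 + 1 / \<theta>\<^sup>2) * (1 + G) * (l * (LF / \<mu>)) * (h * R)"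
      using lLF hR by (rule mult_nonneg_nonneg[OF mult_nonneg_nonneg])
  qed simp
  also have "\<dots> = c_total \<theta> \<beta>1 \<beta>2 (Lf / LF) gap * total_order m d N \<epsilon> p LF \<mu>"
    unfolding total_order_eq[OF pos(1,6)] c_total_def R_def h_def l_def G_def w_def by (simp only: mult_ac)
  finally show ?thesis .
qed

section \<open>The run\<close>

context stochastic_problem
begin

text \<open>Strong convexity bounds the squared gradient from below by the gap, smoothness from
  above. A point with positive gap is required: a constant \<open>F\<close> would leave
  \<open>\<mu>\<close> unrestricted.\<close>

lemma mu_le_LF:
  assumes "F xs < F y"
  shows "\<mu> \<le> LF"
proof -
  have "2 * \<mu> * (F y - F xs) \<le> 2 * LF * (F y - F xs)"
    using strong_convexity lipschitz_gradient_bounded_below[OF F_gradient F'_lipschitz LF_pos minimizer]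
    by (rule order_trans)
  then show ?thesis using assms by simp
qed

lemma sample_avg_measurable:
  assumes n [measurable]: "n \<in> H \<rightarrow>\<^sub>M count_space UNIV" and Z [measurable]: "\<And>i. Z i \<in> H \<rightarrow>\<^sub>M P"
    and y [measurable]: "y \<in> borel_measurable H"
  shows "(\<lambda>\<omega>. sample_avg f (n \<omega>) (\<lambda>i. Z i \<omega>) (y \<omega>)) \<in> borel_measurable H"
proof (rule measurable_compose_countable[OF _ n])
  show "(\<lambda>\<omega>. sample_avg f j (\<lambda>i. Z i \<omega>) (y \<omega>)) \<in> borel_measurable H" for j
    unfolding sample_avg_def by measurable
qed

end

section \<open>Measurability and sample sizes along the run\<close>

context adaptive_run
begin

abbreviation "H k l \<equiv> history M (dir_space N :: (nat \<Rightarrow> real ^ 'd) measure) P U Z k l"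

abbreviation "D k \<equiv> dir_distr M N U k"

abbreviation "g k \<equiv> g_mean P f m N \<nu> (D k)"

lemma samples_measurable: "Z k i \<in> M \<rightarrow>\<^sub>M P"
  using samples_iid(1)[of k] by (auto simp: run.indep_vars_def)

lemma subalgebra_H: "subalgebra M (H k l)"
  by (rule subalgebra_history[OF directions_measurable samples_measurable])

lemma H_measurable_mono:
  assumes "h \<in> H k l \<rightarrow>\<^sub>M L" "k \<le> k'" "l \<le> l'"
  shows "h \<in> H k' l' \<rightarrow>\<^sub>M L"
  using measurable_from_subalg[OF subalgebra_history_mono[OF assms(2,3)] assms(1)] .

text \<open>The random iterate and a sample are inserted into \<open>f\<close> together, which is
  where its joint measurability counts; the random sample size is handled by countable
  composition.\<close>

lemma iterate_measurable: "x k \<in> borel_measurable (H k k)"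
proof (induction k)
  case 0
  have "(\<lambda>_. x0) \<in> borel_measurable (H 0 0)" by simp
  then show ?case by (rule measurable_cong[THEN iffD1, rotated]) (simp add: start)
next
  case (Suc k)
  have [measurable]: "x k \<in> borel_measurable (H (Suc k) (Suc k))"
    by (rule H_measurable_mono[OF Suc]) auto
  have U_meas [measurable]: "U k \<in> H (Suc k) (Suc k) \<rightarrow>\<^sub>M dir_space N"
    using measurable_space[OF directions_measurable] by (intro history_directions_measurable) auto
  have [measurable]: "Z k i \<in> H (Suc k) (Suc k) \<rightarrow>\<^sub>M P" for i
    using measurable_space[OF samples_measurable] by (intro history_samples_measurable) auto
  have [measurable]: "n k \<in> H (Suc k) (Suc k) \<rightarrow>\<^sub>M count_space UNIV"
    by (rule H_measurable_mono[OF size_adapted]) auto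
  have U_comp [measurable]: "(\<lambda>\<omega>. U k \<omega> j) \<in> borel_measurable (H (Suc k) (Suc k))" if "j < N" for j
    using measurable_compose[OF U_meas measurable_component_singleton[of j]] that by simp
  have "(\<lambda>\<omega>. sample_avg f (n k \<omega>) (\<lambda>i. Z k i \<omega>) (x k \<omega> + \<nu> *\<^sub>R U k \<omega> j)) \<in> borel_measurable (H (Suc k) (Suc k))"
    if "j < N" for j
    using U_comp[OF that] by (intro sample_avg_measurable) auto
  moreover have "(\<lambda>\<omega>. sample_avg f (n k \<omega>) (\<lambda>i. Z k i \<omega>) (x k \<omega>)) \<in> borel_measurable (H (Suc k) (Suc k))"
    by (intro sample_avg_measurable) auto
  ultimately have "(\<lambda>\<omega>. x k \<omega> - \<alpha> *\<^sub>R grad_est m N \<nu> (U k \<omega>) (sample_avg f (n k \<omega>) (\<lambda>i. Z k i \<omega>)) (x k \<omega>))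
      \<in> borel_measurable (H (Suc k) (Suc k))"
    unfolding grad_est_def using U_comp
    by (intro borel_measurable_diff borel_measurable_scaleR borel_measurable_const borel_measurable_sum
        borel_measurable_divide) auto
  then show ?case by (rule measurable_cong[THEN iffD1, rotated]) (simp add: step)
qed

lemma D_prob: "prob_space (D k)"
  by (rule run.prob_space_distr[OF directions_measurable])

lemma nu_pos: "0 < \<nu>"
  unfolding nu_eq using N_pos eps_pos p_range LF_pos mu_pos
  by (intro nu_hat_pos) (auto simp: Suc_le_eq)

lemmas run_size_bounds = size_from_bounds[OF D_prob sets_distr directions_law N_pos nu_pos theta_pos]

lemma H_sigma_finite: "sigma_finite_subalgebra M (H k l)"
  by (intro finite_measure_subalgebra_is_sigma_finite finite_measure_subalgebra.intro
      finite_measure_subalgebra_axioms.intro subalgebra_H run.finite_measure_axioms)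

lemma size_measurable: "(\<lambda>\<omega>. ennreal (real (n k \<omega>))) \<in> borel_measurable M"
  using measurable_from_subalg[OF subalgebra_H size_adapted] by measurable

abbreviation "mean_size k \<equiv> nn_cond_exp M (H k k) (\<lambda>\<omega>. ennreal (real (n k \<omega>)))"

lemma g_mean_large:
  assumes "\<epsilon> < F y - F xs"
  shows "\<epsilon> * \<mu> / 8 < (norm (g k y))\<^sup>2"
proof (rule norm_perturbed_gradient)
  have "\<epsilon> * (2 * \<mu>) < (F y - F xs) * (2 * \<mu>)" using assms mu_pos by simp
  then show "2 * (\<epsilon> * \<mu>) < (norm (F' y))\<^sup>2" using strong_convexity[of y] by (simp add: mult_ac)
  have "(norm (g k y - F' y))\<^sup>2 \<le> bias_coeff m CARD('d) * LF\<^sup>2 * \<nu>\<^sup>2"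
    using direction_law_estimator_bounds[OF directions_law N_pos nu_pos] unfolding estimator_bounds_def by blast
  also have "\<dots> \<le> 1.1 * (\<epsilon> * \<mu>)"
    unfolding nu_eq using N_pos eps_pos p_range LF_pos mu_pos
    by (intro bias_coeff_nu_hat) (auto simp: Suc_le_eq)
  finally show "(norm (g k y - F' y))\<^sup>2 \<le> 1.1 * (\<epsilon> * \<mu>)" .
  show "0 < \<epsilon> * \<mu>" using eps_pos mu_pos by simp
qed

lemma b_nonneg: "0 \<le> size_b1 m (real CARD('d)) \<theta> \<beta>1" "0 \<le> size_b2 m (real CARD('d)) \<theta> \<beta>1 \<beta>2 Lf \<nu>"
  using beta_nonneg coeff_nonneg[of "real CARD('d)" m] by simp_all

lemma b_order:
  "size_b1 m (real CARD('d)) \<theta> \<beta>1 \<le> c_size \<theta> * b1_order m CARD('d) \<beta>1" "size_b2 m (real CARD('d)) \<theta> \<beta>1 \<beta>2 Lf \<nu> \<le> c_size \<theta> * b2_order m CARD('d) \<beta>1 \<beta>2 Lf \<nu>"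
  using beta_nonneg theta_pos by (intro size_b1_order size_b2_order; simp add: Suc_le_eq)+

text \<open>Condition 3 sees the run only through the iterate, so the bound holds on almost every
  path without conditioning.\<close>

lemma size_bound_of_condition3:
  assumes "\<forall>k. AE \<omega> in M. chosen_by (condition3 P f m N \<nu> \<theta> (D k) (x k \<omega>)) (n k \<omega>)"
  shows "size_bound P f M m N \<nu> U n x (size_b1 m (real CARD('d)) \<theta> \<beta>1) (size_b2 m (real CARD('d)) \<theta> \<beta>1 \<beta>2 Lf \<nu>)"
  unfolding size_bound_def
proof (intro allI impI)
  fix e :: real and k assume e: "0 < e"
  have "AE \<omega> in M. chosen_by (condition3 P f m N \<nu> \<theta> (D k) (x k \<omega>)) (n k \<omega>)" using assms by blast
  then show "AE \<omega> in M. e < (norm (g k (x k \<omega>)))\<^sup>2 \<longrightarrow> real (n k \<omega>) \<le> size_b1 m (real CARD('d)) \<theta> \<beta>1 + size_b2 m (real CARD('d)) \<theta> \<beta>1 \<beta>2 Lf \<nu> / e"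
    using AE_space
  proof (eventually_elim, intro impI)
    fix \<omega> assume chosen: "chosen_by (condition3 P f m N \<nu> \<theta> (D k) (x k \<omega>)) (n k \<omega>)"
      and \<omega>: "\<omega> \<in> space M" and big: "e < (norm (g k (x k \<omega>)))\<^sup>2"
    note bound = run_size_bounds[OF e big]
    have "real (n k \<omega>) \<le> 1 + (\<integral>u. g_var P f m N \<nu> u (x k \<omega>) \<partial>D k) / (\<theta>\<^sup>2 * g_sq P f m N \<nu> (D k) (x k \<omega>))"
      using chosen size_pos[OF \<omega>] bound(1)
      by (intro chosen_by_le integral_nonneg) (auto simp: condition3_def[abs_def] g_var_def)
    then show "real (n k \<omega>) \<le> size_b1 m (real CARD('d)) \<theta> \<beta>1 + size_b2 m (real CARD('d)) \<theta> \<beta>1 \<beta>2 Lf \<nu> / e" using bound(3) by (rule order_trans)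
  qed
qed

text \<open>\<open>\<phi>\<close> bounds the size as a function of the past and the current
  directions; its average over the directions is the bound for one iteration proved before.\<close>

lemma mean_size_bound_of_condition2:
  assumes "\<forall>k. AE \<omega> in M. chosen_by (condition2 P f m N \<nu> \<theta> (D k) (U k \<omega>) (x k \<omega>)) (n k \<omega>)"
  shows "mean_size_bound P f M m N \<nu> U Z n x (size_b1 m (real CARD('d)) \<theta> \<beta>1) (size_b2 m (real CARD('d)) \<theta> \<beta>1 \<beta>2 Lf \<nu>)"
  unfolding mean_size_bound_def
proof (intro allI impI)
  fix e :: real and k assume e: "0 < e"
  interpret sf: sigma_finite_subalgebra M "H k k" by (rule H_sigma_finite)
  define S where "S y = \<theta>\<^sup>2 * g_sq P f m N \<nu> (D k) y" for y
  define big where "big y \<longleftrightarrow> e < (norm (g k y))\<^sup>2" for y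
  \<comment> \<open>The bound is available only where the mean estimator is large. This event
    depends on the iterate alone, hence on the past, so its indicator passes through the conditional
    expectation.\<close>
  define I where "I y = (if big y then 1 else 0 :: ennreal)" for y
  define \<phi> where "\<phi> z = I (x k (fst z)) * ennreal (1 + g_var P f m N \<nu> (snd z) (x k (fst z)) / S (x k (fst z)))"
    for z :: "'w \<times> (nat \<Rightarrow> real ^ 'd)"
  have [measurable]: "x k \<in> borel_measurable (H k k)" by (rule iterate_measurable)
  have [measurable]: "g k \<in> borel_measurable borel"
    by (rule g_mean_measurable[OF D_prob sets_distr])
  have [measurable]: "S \<in> borel_measurable borel"
    unfolding S_def using g_sq_measurable[OF D_prob sets_distr] by measurable
  have [measurable]: "I \<in> borel_measurable borel"
    unfolding I_def big_def by measurable
  have Ix [measurable]: "(\<lambda>\<omega>. I (x k \<omega>)) \<in> borel_measurable (H k k)" by measurable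
  note n_meas [measurable] = size_measurable[of k]
  have \<phi>_meas: "\<phi> \<in> borel_measurable (H k k \<Otimes>\<^sub>M dir_space N)"
  proof -
    have "(\<lambda>z. g_var P f m N \<nu> (snd z) (x k (fst z))) \<in> borel_measurable (H k k \<Otimes>\<^sub>M dir_space N)"
      using measurable_compose[OF _ g_var_measurable, of "\<lambda>z. (x k (fst z), snd z)" "H k k \<Otimes>\<^sub>M dir_space N"]
      by simp
    then show ?thesis unfolding \<phi>_def by measurable
  qed
  have \<phi>U_meas: "(\<lambda>\<omega>. \<phi> (\<omega>, U k \<omega>)) \<in> borel_measurable M"
  proof -
    have "(\<lambda>\<omega>. (\<omega>, U k \<omega>)) \<in> M \<rightarrow>\<^sub>M H k k \<Otimes>\<^sub>M dir_space N"
      using subalgebra_H[of k k] directions_measurable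
      by (intro measurable_Pair) (auto simp: subalgebra_def measurable_def)
    from measurable_compose[OF this \<phi>_meas] show ?thesis .
  qed
  have "AE \<omega> in M. chosen_by (condition2 P f m N \<nu> \<theta> (D k) (U k \<omega>) (x k \<omega>)) (n k \<omega>)" using assms by blast
  then have le: "AE \<omega> in M. I (x k \<omega>) * ennreal (real (n k \<omega>)) \<le> \<phi> (\<omega>, U k \<omega>)"
    using AE_space
  proof eventually_elim
    fix \<omega> assume chosen: "chosen_by (condition2 P f m N \<nu> \<theta> (D k) (U k \<omega>) (x k \<omega>)) (n k \<omega>)"
      and \<omega>: "\<omega> \<in> space M"
    show "I (x k \<omega>) * ennreal (real (n k \<omega>)) \<le> \<phi> (\<omega>, U k \<omega>)"
    proof (cases "big (x k \<omega>)")
      case True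
      then have "0 < S (x k \<omega>)"
        using run_size_bounds(1)[OF e]
        by (simp add: S_def big_def)
      then have "real (n k \<omega>) \<le> 1 + g_var P f m N \<nu> (U k \<omega>) (x k \<omega>) / S (x k \<omega>)"
        using chosen size_pos[OF \<omega>]
        by (intro chosen_by_le) (auto simp: condition2_def[abs_def] S_def g_var_def)
      then show ?thesis by (simp add: \<phi>_def mult_left_mono ennreal_leI)
    qed (simp add: I_def)
  qed
  have "AE \<omega> in M. I (x k \<omega>) * mean_size k \<omega>
      = nn_cond_exp M (H k k) (\<lambda>\<omega>. I (x k \<omega>) * ennreal (real (n k \<omega>))) \<omega>"
    by (rule sf.nn_cond_exp_prod[OF Ix n_meas])
  moreover have "AE \<omega> in M. nn_cond_exp M (H k k) (\<lambda>\<omega>. I (x k \<omega>) * ennreal (real (n k \<omega>))) \<omega>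
      \<le> nn_cond_exp M (H k k) (\<lambda>\<omega>. \<phi> (\<omega>, U k \<omega>)) \<omega>"
  proof (rule sf.nn_cond_exp_mono[OF le _ \<phi>U_meas])
    show "(\<lambda>\<omega>. I (x k \<omega>) * ennreal (real (n k \<omega>))) \<in> borel_measurable M"
      using measurable_from_subalg[OF subalgebra_H Ix] by measurable
  qed
  \<comment> \<open>Independence of the directions from the past replaces conditioning by
    integration over their law.\<close>
  moreover have "AE \<omega> in M. (\<integral>\<^sup>+u. \<phi> (\<omega>, u) \<partial>D k) = nn_cond_exp M (H k k) (\<lambda>\<omega>. \<phi> (\<omega>, U k \<omega>)) \<omega>"
    by (rule run.nn_cond_exp_indep[OF subalgebra_H directions_measurable directions_indep \<phi>_meas])
  ultimately show "AE \<omega> in M. e < (norm (g k (x k \<omega>)))\<^sup>2 \<longrightarrow>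
      mean_size k \<omega> \<le> ennreal (size_b1 m (real CARD('d)) \<theta> \<beta>1 + size_b2 m (real CARD('d)) \<theta> \<beta>1 \<beta>2 Lf \<nu> / e)"
  proof (eventually_elim, intro impI)
    fix \<omega>
    assume prod: "I (x k \<omega>) * mean_size k \<omega>
        = nn_cond_exp M (H k k) (\<lambda>\<omega>. I (x k \<omega>) * ennreal (real (n k \<omega>))) \<omega>"
      and mono: "nn_cond_exp M (H k k) (\<lambda>\<omega>. I (x k \<omega>) * ennreal (real (n k \<omega>))) \<omega>
        \<le> nn_cond_exp M (H k k) (\<lambda>\<omega>. \<phi> (\<omega>, U k \<omega>)) \<omega>"
      and indep: "(\<integral>\<^sup>+u. \<phi> (\<omega>, u) \<partial>D k) = nn_cond_exp M (H k k) (\<lambda>\<omega>. \<phi> (\<omega>, U k \<omega>)) \<omega>"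
      and *: "e < (norm (g k (x k \<omega>)))\<^sup>2"
    have I1: "I (x k \<omega>) = 1" using * by (simp add: I_def big_def)
    then have "mean_size k \<omega> \<le> (\<integral>\<^sup>+u. \<phi> (\<omega>, u) \<partial>D k)"
      using prod mono indep by simp
    also have "\<dots> \<le> ennreal (size_b1 m (real CARD('d)) \<theta> \<beta>1 + size_b2 m (real CARD('d)) \<theta> \<beta>1 \<beta>2 Lf \<nu> / e)"
      using run_size_bounds(2)[OF e *] I1
      by (simp add: \<phi>_def S_def)
    finally show "mean_size k \<omega> \<le> ennreal (size_b1 m (real CARD('d)) \<theta> \<beta>1 + size_b2 m (real CARD('d)) \<theta> \<beta>1 \<beta>2 Lf \<nu> / e)" .
  qed
qed

section \<open>From sample sizes to numbers of evaluations\<close>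

abbreviation evals_order :: "real \<Rightarrow> real \<Rightarrow> nat \<Rightarrow> real" where
  "evals_order b1 b2 K \<equiv> c_evals * (real N * b1 * real K + real N * b2 * real K / (\<epsilon> * \<mu>))"

text \<open>The 16 in \<open>c_evals\<close>: \<open>N + 1 \<le> 2 * N\<close>, and another 8 from
  the threshold \<open>\<epsilon> * \<mu> / 8\<close>.\<close>

lemma evals_bound:
  assumes b: "0 \<le> b1'" "0 \<le> b2'"
  shows "(real N + 1) * (real K * (b1' + b2' / (\<epsilon> * \<mu> / 8)))
    \<le> evals_order b1' b2' K"
proof -
  have em: "0 < \<epsilon> * \<mu>" using eps_pos mu_pos by simp
  have e8: "b2' / (\<epsilon> * \<mu> / 8) = 8 * (b2' / (\<epsilon> * \<mu>))" by simp
  have "(real N + 1) * (real K * (b1' + b2' / (\<epsilon> * \<mu> / 8))) \<le> 2 * real N * (real K * (8 * b1' + 8 * (b2' / (\<epsilon> * \<mu>))))"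
    unfolding e8 using N_pos b em by (intro mult_mono add_mono) auto
  also have "\<dots> = evals_order b1' b2' K"
    by (simp add: c_evals_def algebra_simps)
  finally show ?thesis .
qed

lemma evals_le_of_size_bound:
  assumes bound: "size_bound P f M m N \<nu> U n x b1' b2'" and b: "0 \<le> b1'" "0 \<le> b2'"
  shows "AE \<omega> in M. evals_to_accuracy F xs \<epsilon> x N n K \<omega>
    \<le> evals_order b1' b2' K"
proof -
  let ?e = "\<epsilon> * \<mu> / 8" and ?b = "b1' + b2' / (\<epsilon> * \<mu> / 8)"
  have e: "0 < ?e" using eps_pos mu_pos by simp
  have b0: "0 \<le> ?b" using b e by (intro add_nonneg_nonneg divide_nonneg_pos)
  have "AE \<omega> in M. \<forall>k. ?e < (norm (g k (x k \<omega>)))\<^sup>2 \<longrightarrow> real (n k \<omega>) \<le> ?b"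
    unfolding AE_all_countable using bound e unfolding size_bound_def by blast
  then show ?thesis
  proof eventually_elim
    fix \<omega> assume *: "\<forall>k. ?e < (norm (g k (x k \<omega>)))\<^sup>2 \<longrightarrow> real (n k \<omega>) \<le> ?b"
    have "(\<Sum>i | i < K \<and> F (x i \<omega>) - F xs > \<epsilon>. real (n i \<omega>)) \<le> (\<Sum>i | i < K \<and> F (x i \<omega>) - F xs > \<epsilon>. ?b)"
      using * g_mean_large by (intro sum_mono) auto
    also have "\<dots> \<le> (\<Sum>i<K. ?b)"
      using b0 by (intro sum_mono2) auto
    also have "\<dots> = real K * ?b" by simp
    finally have "evals_to_accuracy F xs \<epsilon> x N n K \<omega> \<le> (real N + 1) * (real K * ?b)"
      unfolding evals_to_accuracy_def by (intro mult_left_mono) auto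
    also have "\<dots> \<le> evals_order b1' b2' K"
      by (rule evals_bound[OF b])
    finally show "evals_to_accuracy F xs \<epsilon> x N n K \<omega>
        \<le> evals_order b1' b2' K" .
  qed
qed

text \<open>By the tower property, under the integral the size may be replaced by its conditional
  mean on the event that the iterate is still inaccurate.\<close>

lemma mean_evals_le_of_mean_size_bound:
  assumes bound: "mean_size_bound P f M m N \<nu> U Z n x b1' b2'" and b: "0 \<le> b1'" "0 \<le> b2'"
  shows "mean_le M (evals_to_accuracy F xs \<epsilon> x N n K)
    (evals_order b1' b2' K)"
proof -
  let ?e = "\<epsilon> * \<mu> / 8" and ?b = "b1' + b2' / (\<epsilon> * \<mu> / 8)"
  have e: "0 < ?e" using eps_pos mu_pos by simp
  have b0: "0 \<le> ?b" using b e by (intro add_nonneg_nonneg divide_nonneg_pos)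
  define I where "I i \<omega> = (if F (x i \<omega>) - F xs > \<epsilon> then 1 else 0 :: ennreal)" for i \<omega>
  have part: "(\<integral>\<^sup>+\<omega>. I i \<omega> * ennreal (real (n i \<omega>)) \<partial>M) \<le> ennreal ?b"
    and part_meas: "(\<lambda>\<omega>. I i \<omega> * ennreal (real (n i \<omega>))) \<in> borel_measurable M" for i
  proof -
    interpret sf: sigma_finite_subalgebra M "H i i" by (rule H_sigma_finite)
    have [measurable]: "x i \<in> borel_measurable (H i i)" by (rule iterate_measurable)
    \<comment> \<open>Whether iterate \<open>i\<close> is accurate is known before its directions
      and samples are drawn; this is what the tower property requires.\<close>
    have I_meas [measurable]: "I i \<in> borel_measurable (H i i)" unfolding I_def by measurable
    note n_meas [measurable] = size_measurable[of i]
    show "(\<lambda>\<omega>. I i \<omega> * ennreal (real (n i \<omega>))) \<in> borel_measurable M"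
      using measurable_from_subalg[OF subalgebra_H I_meas] by measurable
    have "(\<integral>\<^sup>+\<omega>. I i \<omega> * ennreal (real (n i \<omega>)) \<partial>M)
        = (\<integral>\<^sup>+\<omega>. I i \<omega> * mean_size i \<omega> \<partial>M)"
      by (rule sf.nn_cond_exp_intg[OF I_meas n_meas, symmetric])
    also have "\<dots> \<le> (\<integral>\<^sup>+\<omega>. ennreal ?b \<partial>M)"
    proof (rule nn_integral_mono_AE)
      have "AE \<omega> in M. ?e < (norm (g i (x i \<omega>)))\<^sup>2 \<longrightarrow>
          mean_size i \<omega> \<le> ennreal ?b"
        using bound e unfolding mean_size_bound_def by blast
      then show "AE \<omega> in M. I i \<omega> * mean_size i \<omega> \<le> ennreal ?b"
        by eventually_elim (use g_mean_large in \<open>auto simp: I_def\<close>)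
    qed
    also have "\<dots> = ennreal ?b" by (simp add: run.emeasure_space_1)
    finally show "(\<integral>\<^sup>+\<omega>. I i \<omega> * ennreal (real (n i \<omega>)) \<partial>M) \<le> ennreal ?b" .
  qed
  have "(\<integral>\<^sup>+\<omega>. ennreal (evals_to_accuracy F xs \<epsilon> x N n K \<omega>) \<partial>M)
      = (\<integral>\<^sup>+\<omega>. ennreal (real N + 1) * (\<Sum>i<K. I i \<omega> * ennreal (real (n i \<omega>))) \<partial>M)"
  proof (rule nn_integral_cong)
    fix \<omega>
    \<comment> \<open>The random index set becomes a fixed one with indicators, so that the
      expectation can be taken term by term.\<close>
    have "(\<Sum>i | i < K \<and> F (x i \<omega>) - F xs > \<epsilon>. real (n i \<omega>))
        = (\<Sum>i<K. if F (x i \<omega>) - F xs > \<epsilon> then real (n i \<omega>) else 0)"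
      by (simp add: sum.If_cases Int_def)
    then have "ennreal (evals_to_accuracy F xs \<epsilon> x N n K \<omega>)
        = ennreal (real N + 1) * ennreal (\<Sum>i<K. if F (x i \<omega>) - F xs > \<epsilon> then real (n i \<omega>) else 0)"
      unfolding evals_to_accuracy_def by (simp only:) (intro ennreal_mult sum_nonneg, auto)
    also have "ennreal (\<Sum>i<K. if F (x i \<omega>) - F xs > \<epsilon> then real (n i \<omega>) else 0)
        = (\<Sum>i<K. ennreal (if F (x i \<omega>) - F xs > \<epsilon> then real (n i \<omega>) else 0))"
      by (rule sum_ennreal[symmetric]) simp
    also have "\<dots> = (\<Sum>i<K. I i \<omega> * ennreal (real (n i \<omega>)))"
      by (intro sum.cong refl) (simp add: I_def)
    finally show "ennreal (evals_to_accuracy F xs \<epsilon> x N n K \<omega>)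
        = ennreal (real N + 1) * (\<Sum>i<K. I i \<omega> * ennreal (real (n i \<omega>)))" .
  qed
  also have "\<dots> = ennreal (real N + 1) * (\<Sum>i<K. \<integral>\<^sup>+\<omega>. I i \<omega> * ennreal (real (n i \<omega>)) \<partial>M)"
    using part_meas by (simp add: nn_integral_cmult nn_integral_sum)
  also have "\<dots> \<le> ennreal (real N + 1) * (\<Sum>i<K. ennreal ?b)"
    using part by (intro mult_left_mono sum_mono) auto
  also have "\<dots> = ennreal ((real N + 1) * (real K * ?b))"
    using b0 by (simp add: ennreal_mult ennreal_of_nat_eq_real_of_nat)
  also have "\<dots> \<le> ennreal (evals_order b1' b2' K)"
    by (rule ennreal_leI[OF evals_bound[OF b]])
  finally show ?thesis unfolding mean_le_def .
qed

lemma total_evals_eq: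
  assumes "\<forall>i<K. F (x i \<omega>) - F xs > \<epsilon>"
  shows "total_evals N n K \<omega> = evals_to_accuracy F xs \<epsilon> x N n K \<omega>"
proof -
  have "{i. i < K \<and> F (x i \<omega>) - F xs > \<epsilon>} = {..<K}" using assms by auto
  then show ?thesis by (simp add: total_evals_def evals_to_accuracy_def)
qed

lemma mean_le_total_evals:
  assumes "AE \<omega> in M. \<forall>i<K. F (x i \<omega>) - F xs > \<epsilon>"
    and "mean_le M (evals_to_accuracy F xs \<epsilon> x N n K) B"
  shows "mean_le M (total_evals N n K) B"
proof -
  have "(\<integral>\<^sup>+\<omega>. ennreal (total_evals N n K \<omega>) \<partial>M) = (\<integral>\<^sup>+\<omega>. ennreal (evals_to_accuracy F xs \<epsilon> x N n K \<omega>) \<partial>M)"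
    by (rule nn_integral_cong_AE) (use assms(1) in eventually_elim, simp add: total_evals_eq)
  then show ?thesis using assms(2) by (simp add: mean_le_def)
qed

lemma direction_count: "m = FD \<longrightarrow> N = CARD('d)" "m \<in> {RC, RS} \<longrightarrow> N \<le> CARD('d)"
  using directions_law[of 0] by auto

section \<open>Totals per method\<close>

context
  fixes K :: nat and b1 b2 B' :: real
  assumes K: "K = iteration_bound (F x0 - F xs) \<epsilon> p (rho m CARD('d) N \<theta> LF \<mu>)"
    and B': "B' = c_total \<theta> \<beta>1 \<beta>2 (Lf / LF) (F x0 - F xs) * total_order m CARD('d) N \<epsilon> p LF \<mu>"
    and b: "0 \<le> b1" "0 \<le> b2" "b1 \<le> c_size \<theta> * b1_order m CARD('d) \<beta>1"
      "b2 \<le> c_size \<theta> * b2_order m CARD('d) \<beta>1 \<beta>2 Lf \<nu>"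
    and ep: "\<epsilon> * p \<le> 1 / 2"
begin

lemma bound_le_total_order:
  assumes "F xs < F x0"
  shows "evals_order b1 b2 K \<le> B'"
  unfolding K B'
  using b direction_count N_pos eps_pos p_range LF_pos LF_le mu_pos beta_nonneg ep
    mu_le_LF[OF assms] assms
  by (intro total_cost_order) (auto simp: nu_eq Suc_le_eq)

text \<open>Starting at a minimizer, the iteration bound is 1 and the only iterate counted is
  already accurate. This case is separate because both the logarithm of the gap and
  \<open>\<mu> \<le> LF\<close> require a positive gap.\<close>

lemma no_evals:
  assumes "\<not> F xs < F x0" "\<omega> \<in> space M"
  shows "evals_to_accuracy F xs \<epsilon> x N n K \<omega> = 0"
proof -
  have *: "{i. i < K \<and> F (x i \<omega>) - F xs > \<epsilon>} = {}"
    using assms eps_pos start[of \<omega>] by (auto simp: K iteration_bound_def)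
  show ?thesis unfolding evals_to_accuracy_def * by simp
qed

lemma total_order_bound_nonneg: "0 \<le> B'"
proof -
  have "0 \<le> ln (1 / (\<epsilon> * p))"
    using eps_pos p_range ep by (intro ln_ge_zero) (auto simp: field_simps)
  moreover have "0 \<le> order_factor m (real CARD('d)) (real N) (1 / (\<epsilon> * \<mu>))"
    using eps_pos mu_pos unfolding order_factor_def
    by (auto intro!: mult_nonneg_nonneg add_nonneg_nonneg divide_nonneg_nonneg simp: le_max_iff_disj)
  ultimately show ?thesis
    unfolding B' total_order_eq[OF eps_pos mu_pos] c_total_def
    using LF_pos mu_pos beta_nonneg by (intro mult_nonneg_nonneg add_nonneg_nonneg) auto
qed

lemma mean_evals_total_order:
  assumes "mean_size_bound P f M m N \<nu> U Z n x b1 b2"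
  shows "mean_le M (evals_to_accuracy F xs \<epsilon> x N n K) B'"
proof (cases "F xs < F x0")
  case True
  have "(\<integral>\<^sup>+\<omega>. ennreal (evals_to_accuracy F xs \<epsilon> x N n K \<omega>) \<partial>M)
      \<le> ennreal (evals_order b1 b2 K)"
    using mean_evals_le_of_mean_size_bound[OF assms b(1,2)] by (simp only: mean_le_def)
  also have "\<dots> \<le> ennreal B'" by (rule ennreal_leI[OF bound_le_total_order[OF True]])
  finally show ?thesis by (simp only: mean_le_def)
next
  case False
  then have "(\<integral>\<^sup>+\<omega>. ennreal (evals_to_accuracy F xs \<epsilon> x N n K \<omega>) \<partial>M) = (\<integral>\<^sup>+\<omega>. 0 \<partial>M)"
    by (intro nn_integral_cong) (simp add: no_evals)
  then show ?thesis by (simp add: mean_le_def)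
qed

lemma evals_total_order:
  assumes "size_bound P f M m N \<nu> U n x b1 b2"
  shows "AE \<omega> in M. evals_to_accuracy F xs \<epsilon> x N n K \<omega> \<le> B'"
proof (cases "F xs < F x0")
  case True
  show ?thesis
    using evals_le_of_size_bound[OF assms b(1,2), of K]
    by eventually_elim (use bound_le_total_order[OF True] in linarith)
next
  case False
  then show ?thesis using no_evals total_order_bound_nonneg by (intro AE_I2) simp
qed

end

end

theorem theorem3p10:
  fixes P :: "'z measure" and f :: "real ^ 'd \<Rightarrow> 'z \<Rightarrow> real" and f' F F' xs Lf LF \<beta>1 \<beta>2 \<mu>
    and M :: "'w measure" and m N \<theta> \<epsilon> p \<nu> \<alpha> x0 U Z n x
    and K :: nat and W W\<^sub>\<epsilon> :: "'w \<Rightarrow> real" and B :: "real \<Rightarrow> real \<Rightarrow> real" and B' :: real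
  assumes run: "adaptive_run P f f' F F' xs Lf LF \<beta>1 \<beta>2 \<mu> M m N \<theta> \<epsilon> p \<nu> \<alpha> x0 U Z n x"
    and K: "K = iteration_bound (F x0 - F xs) \<epsilon> p (rho m CARD('d) N \<theta> LF \<mu>)"
    and W: "W = total_evals N n K"
    and W\<^sub>\<epsilon>: "W\<^sub>\<epsilon> = evals_to_accuracy F xs \<epsilon> x N n K"
    and B: "\<And>b1 b2. B b1 b2 = c_evals * (real N * b1 * real K + real N * b2 * real K / (\<epsilon> * \<mu>))"
    and B': "B' = c_total \<theta> \<beta>1 \<beta>2 (Lf / LF) (F x0 - F xs) * total_order m CARD('d) N \<epsilon> p LF \<mu>"
  shows
    "((\<forall>k. AE \<omega> in M.
         chosen_by (condition2 P f m N \<nu> \<theta> (dir_distr M N U k) (U k \<omega>) (x k \<omega>)) (n k \<omega>)) \<longrightarrow>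
       (\<exists>b1\<ge>0. \<exists>b2\<ge>0. b1 \<le> c_size \<theta> * b1_order m CARD('d) \<beta>1 \<and>
                       b2 \<le> c_size \<theta> * b2_order m CARD('d) \<beta>1 \<beta>2 Lf \<nu> \<and>
                       mean_size_bound P f M m N \<nu> U Z n x b1 b2) \<and>
       (\<forall>b1\<ge>0. \<forall>b2\<ge>0. mean_size_bound P f M m N \<nu> U Z n x b1 b2 \<longrightarrow>
          mean_le M W\<^sub>\<epsilon> (B b1 b2) \<and>
          ((AE \<omega> in M. \<forall>i<K. F (x i \<omega>) - F xs > \<epsilon>) \<longrightarrow> mean_le M W (B b1 b2))) \<and>
       (\<epsilon> * p \<le> 1 / 2 \<longrightarrow>
          mean_le M W\<^sub>\<epsilon> B' \<and>
          ((AE \<omega> in M. \<forall>i<K. F (x i \<omega>) - F xs > \<epsilon>) \<longrightarrow> mean_le M W B')))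
     \<and>
     ((\<forall>k. AE \<omega> in M.
         chosen_by (condition3 P f m N \<nu> \<theta> (dir_distr M N U k) (x k \<omega>)) (n k \<omega>)) \<longrightarrow>
       (\<exists>b1\<ge>0. \<exists>b2\<ge>0. b1 \<le> c_size \<theta> * b1_order m CARD('d) \<beta>1 \<and>
                       b2 \<le> c_size \<theta> * b2_order m CARD('d) \<beta>1 \<beta>2 Lf \<nu> \<and>
                       size_bound P f M m N \<nu> U n x b1 b2) \<and>
       (\<forall>b1\<ge>0. \<forall>b2\<ge>0. size_bound P f M m N \<nu> U n x b1 b2 \<longrightarrow>
          (AE \<omega> in M. W\<^sub>\<epsilon> \<omega> \<le> B b1 b2 \<and>
             ((\<forall>i<K. F (x i \<omega>) - F xs > \<epsilon>) \<longrightarrow> W \<omega> \<le> B b1 b2))) \<and>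
       (\<epsilon> * p \<le> 1 / 2 \<longrightarrow>
          (AE \<omega> in M. W\<^sub>\<epsilon> \<omega> \<le> B' \<and>
             ((\<forall>i<K. F (x i \<omega>) - F xs > \<epsilon>) \<longrightarrow> W \<omega> \<le> B'))))"
proof -
  interpret adaptive_run P f f' F F' xs Lf LF \<beta>1 \<beta>2 \<mu> M m N \<theta> \<epsilon> p \<nu> \<alpha> x0 U Z n x
    by (rule run)
  show ?thesis
  proof ((rule conjI; rule impI), goal_cases)
    case 1
    note bound = mean_size_bound_of_condition2[OF 1]
    show ?case
      unfolding W W\<^sub>\<epsilon> B
      using bound b_nonneg b_order mean_evals_le_of_mean_size_bound
        mean_evals_total_order[OF K B' b_nonneg b_order _ bound] mean_le_total_evals
      by blast
  next
    case 2
    note bound = size_bound_of_condition3[OF 2]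
    \<comment> \<open>On a path without an accurate iterate before \<open>K\<close> the two counts
      coincide, so one bound serves both.\<close>
    have W_le: "AE \<omega> in M. W\<^sub>\<epsilon> \<omega> \<le> C \<and> ((\<forall>i<K. F (x i \<omega>) - F xs > \<epsilon>) \<longrightarrow> W \<omega> \<le> C)"
      if "AE \<omega> in M. W\<^sub>\<epsilon> \<omega> \<le> C" for C
      using that by eventually_elim (auto simp: W W\<^sub>\<epsilon> total_evals_eq)
    show ?case
      using bound b_nonneg b_order W_le evals_le_of_size_bound[of _ _ K, folded W\<^sub>\<epsilon> B]
        evals_total_order[OF K B' b_nonneg b_order _ bound, folded W\<^sub>\<epsilon>]
      by blast
  qed
qed

end
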